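(* For any group $G$ and for any positive integer $n$, the following assertions are equivalent: (i) $\overline{G}[x_{1},\ldots,x_{n}]$ is polycyclic; (ii) $G$ is finitely generated, soluble, and nilpotent-by-finite; (iii) $\overline{G}[x_{1},\ldots,x_{n}]$ is finitely generated, soluble, and nilpotent-by-finite.
   Context: Let $G$ be a group, $n$ a positive integer, and $F_n$ the free group freely generated by $x_1,\ldots,x_n$. Put $G[x_1,\ldots,x_n] := G * F_n$ (free product). Each element $f(x_1,\ldots,x_n)\in G[x_1,\ldots,x_n]$ defines a map $G^n\to G$, $(t_1,\ldots,t_n)\mapsto f(t_1,\ldots,t_n)$, obtained by substituting $t_i$ for $x_i$ (i.e. applying the homomorphism $G*F_n\to G$ that is the identity on $G$ and sends $x_i$ to $t_i$). Such maps are called polynomial functions, and $\overline{G}[x_1,\ldots,x_n]$ denotes the set of all of them. It is a group under the pointwise product: the product of $(t_1,\ldots,t_n)\mapsto f(t_1,\ldots,t_n)$ and $(t_1,\ldots,t_n)\mapsto g(t_1,\ldots,t_n)$ is $(t_1,\ldots,t_n)\mapsto f(t_1,\ldots,t_n)g(t_1,\ldots,t_n)$. A Noetherian group is a group satisfying the maximal condition for its subgroups; a polycyclic group is a soluble Noetherian group. A group is nilpotent-by-finite if it has a nilpotent normal subgroup of finite index. *)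

theory Defs
  imports "HOL-Algebra.Solvable_Groups" "HOL-Algebra.Product_Groups"
begin

section \<open>Finiteness conditions on groups\<close>

definition finitely_generated_group :: "('a, 'b) monoid_scheme \<Rightarrow> bool" where
  "finitely_generated_group G \<longleftrightarrow>
     (\<exists>S. finite S \<and> S \<subseteq> carrier G \<and> generate G S = carrier G)"

definition noetherian_group :: "('a, 'b) monoid_scheme \<Rightarrow> bool" where
  "noetherian_group G \<longleftrightarrow>
     (\<forall>C. C \<noteq> {} \<and> (\<forall>H\<in>C. subgroup H G) \<longrightarrow> (\<exists>M\<in>C. \<forall>H\<in>C. M \<subseteq> H \<longrightarrow> H = M))"

definition polycyclic_group :: "('a, 'b) monoid_scheme \<Rightarrow> bool" where
  "polycyclic_group G \<longleftrightarrow> solvable G \<and> noetherian_group G"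

primrec lower_central :: "('a, 'b) monoid_scheme \<Rightarrow> nat \<Rightarrow> 'a set" where
  "lower_central G 0 = carrier G"
| "lower_central G (Suc k) = generate G
     {x \<otimes>\<^bsub>G\<^esub> y \<otimes>\<^bsub>G\<^esub> inv\<^bsub>G\<^esub> x \<otimes>\<^bsub>G\<^esub> inv\<^bsub>G\<^esub> y | x y. x \<in> lower_central G k \<and> y \<in> carrier G}"

definition nilpotent_group :: "('a, 'b) monoid_scheme \<Rightarrow> bool" where
  "nilpotent_group G \<longleftrightarrow> (\<exists>k. lower_central G k = {\<one>\<^bsub>G\<^esub>})"

definition nilpotent_by_finite :: "('a, 'b) monoid_scheme \<Rightarrow> bool" where
  "nilpotent_by_finite G \<longleftrightarrow>
     (\<exists>N. N \<lhd> G \<and> nilpotent_group (G\<lparr>carrier := N\<rparr>) \<and> finite (rcosets\<^bsub>G\<^esub> N))"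


section \<open>Monoids given by generators and relations\<close>

text \<open>The least congruence on the free monoid of words over the alphabet \<open>A\<close> that contains
  the relations \<open>R\<close>.\<close>

inductive word_cong :: "'x set \<Rightarrow> ('x list \<times> 'x list) set \<Rightarrow> 'x list \<Rightarrow> 'x list \<Rightarrow> bool"
  for A R where
    refl: "set w \<subseteq> A \<Longrightarrow> word_cong A R w w"
  | sym: "word_cong A R v w \<Longrightarrow> word_cong A R w v"
  | trans: "word_cong A R u v \<Longrightarrow> word_cong A R v w \<Longrightarrow> word_cong A R u w"
  | rel: "(u, v) \<in> R \<Longrightarrow> set u \<subseteq> A \<Longrightarrow> set v \<subseteq> A \<Longrightarrow> set p \<subseteq> A \<Longrightarrow> set q \<subseteq> A \<Longrightarrow>
      word_cong A R (p @ u @ q) (p @ v @ q)"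

definition word_class :: "'x set \<Rightarrow> ('x list \<times> 'x list) set \<Rightarrow> 'x list \<Rightarrow> 'x list set" where
  "word_class A R w = {v. word_cong A R w v}"

definition presented_monoid :: "'x set \<Rightarrow> ('x list \<times> 'x list) set \<Rightarrow> 'x list set monoid" where
  "presented_monoid A R =
     \<lparr>carrier = word_class A R ` {w. set w \<subseteq> A},
      monoid.mult = (\<lambda>c d. \<Union>v\<in>c. \<Union>w\<in>d. word_class A R (v @ w)),
      one = word_class A R []\<rparr>"

definition word_eval :: "('a, 'b) monoid_scheme \<Rightarrow> ('x \<Rightarrow> 'a) \<Rightarrow> 'x list \<Rightarrow> 'a" where
  "word_eval M f w = foldr (\<lambda>a m. f a \<otimes>\<^bsub>M\<^esub> m) w \<one>\<^bsub>M\<^esub>"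

text \<open>The homomorphism out of a presented monoid induced by a map \<open>f\<close> on letters that respects
  the relations; all words in a class \<open>c\<close> then have the same value, cf. \<open>presented_lift_class\<close>.\<close>

definition presented_lift :: "('a, 'b) monoid_scheme \<Rightarrow> ('x \<Rightarrow> 'a) \<Rightarrow> 'x list set \<Rightarrow> 'a" where
  "presented_lift M f c = the_elem (word_eval M f ` c)"

lemma word_cong_set: "word_cong A R v w \<Longrightarrow> set v \<subseteq> A \<and> set w \<subseteq> A"
  by (induction rule: word_cong.induct) auto

lemma word_cong_prepend:
  "word_cong A R v w \<Longrightarrow> set p \<subseteq> A \<Longrightarrow> word_cong A R (p @ v) (p @ w)"
proof (induction rule: word_cong.induct)
  case (refl w)
  then show ?case by (intro word_cong.refl) simp
next
  case (sym v w)
  then show ?case by (blast intro: word_cong.sym)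
next
  case (trans u v w)
  then show ?case by (meson word_cong.trans)
next
  case (rel u v p' q)
  then show ?case using word_cong.rel[of u v R A "p @ p'" q] by simp
qed

lemma word_cong_append:
  "word_cong A R v w \<Longrightarrow> set q \<subseteq> A \<Longrightarrow> word_cong A R (v @ q) (w @ q)"
proof (induction rule: word_cong.induct)
  case (refl w)
  then show ?case by (intro word_cong.refl) simp
next
  case (sym v w)
  then show ?case by (blast intro: word_cong.sym)
next
  case (trans u v w)
  then show ?case by (meson word_cong.trans)
next
  case (rel u v p' q')
  then show ?case using word_cong.rel[of u v R A p' "q' @ q"] by simp
qed

lemma word_cong_mult:
  assumes "word_cong A R v v'" "word_cong A R w w'"
  shows "word_cong A R (v @ w) (v' @ w')"
proof (rule word_cong.trans)
  show "word_cong A R (v @ w) (v' @ w)"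
    using assms by (intro word_cong_append) (auto dest: word_cong_set)
  show "word_cong A R (v' @ w) (v' @ w')"
    using assms by (intro word_cong_prepend) (auto dest: word_cong_set)
qed

lemma word_class_eq:
  assumes "word_cong A R v w"
  shows "word_class A R v = word_class A R w"
proof -
  have "word_cong A R v u \<longleftrightarrow> word_cong A R w u" for u
    using word_cong.trans[OF assms] word_cong.trans[OF word_cong.sym[OF assms]] by blast
  then show ?thesis by (simp add: word_class_def)
qed

lemma word_class_self: "set w \<subseteq> A \<Longrightarrow> w \<in> word_class A R w"
  unfolding word_class_def by (simp add: word_cong.refl)

lemma carrier_presented_monoid [simp]:
  "carrier (presented_monoid A R) = word_class A R ` {w. set w \<subseteq> A}"
  by (simp add: presented_monoid_def)

lemma one_presented_monoid: "\<one>\<^bsub>presented_monoid A R\<^esub> = word_class A R []"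
  by (simp add: presented_monoid_def)

lemma mult_presented_monoid:
  assumes "set v \<subseteq> A" "set w \<subseteq> A"
  shows "word_class A R v \<otimes>\<^bsub>presented_monoid A R\<^esub> word_class A R w = word_class A R (v @ w)"
proof -
  have "word_class A R (v' @ w') = word_class A R (v @ w)"
    if "v' \<in> word_class A R v" "w' \<in> word_class A R w" for v' w'
    using that word_class_eq[OF word_cong_mult] unfolding word_class_def by blast
  then have "(\<Union>v'\<in>word_class A R v. \<Union>w'\<in>word_class A R w. word_class A R (v' @ w')) =
      (\<Union>v'\<in>word_class A R v. \<Union>w'\<in>word_class A R w. word_class A R (v @ w))"
    by (intro SUP_cong HOL.refl)
  also have "\<dots> = word_class A R (v @ w)"
    using word_class_self[OF assms(1), of R] word_class_self[OF assms(2), of R] by blast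
  finally show ?thesis by (simp add: presented_monoid_def)
qed

lemma monoid_presented_monoid: "monoid (presented_monoid A R)"
proof (rule monoidI)
  let ?M = "presented_monoid A R"
  show "\<one>\<^bsub>?M\<^esub> \<in> carrier ?M"
    by (simp add: one_presented_monoid)
  fix x y z assume "x \<in> carrier ?M"
  then obtain u where u: "set u \<subseteq> A" "x = word_class A R u" by auto
  then show "\<one>\<^bsub>?M\<^esub> \<otimes>\<^bsub>?M\<^esub> x = x" "x \<otimes>\<^bsub>?M\<^esub> \<one>\<^bsub>?M\<^esub> = x"
    by (simp_all add: one_presented_monoid mult_presented_monoid)
  assume "y \<in> carrier ?M"
  then obtain v where v: "set v \<subseteq> A" "y = word_class A R v" by auto
  with u show "x \<otimes>\<^bsub>?M\<^esub> y \<in> carrier ?M"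
    by (simp add: mult_presented_monoid)
  assume "z \<in> carrier ?M"
  then obtain w where w: "set w \<subseteq> A" "z = word_class A R w" by auto
  with u v show "x \<otimes>\<^bsub>?M\<^esub> y \<otimes>\<^bsub>?M\<^esub> z = x \<otimes>\<^bsub>?M\<^esub> (y \<otimes>\<^bsub>?M\<^esub> z)"
    by (simp add: mult_presented_monoid)
qed

lemma group_presented_monoid:
  assumes "\<And>a. a \<in> A \<Longrightarrow> \<exists>b\<in>A. word_cong A R [b, a] []"
  shows "group (presented_monoid A R)"
proof -
  have inv: "\<exists>v. set v \<subseteq> A \<and> word_cong A R (v @ w) []" if "set w \<subseteq> A" for w
    using that
  proof (induction w)
    case Nil
    then show ?case by (auto intro!: exI[of _ "[]"] word_cong.refl)
  next
    case (Cons a w)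
    then obtain v where v: "set v \<subseteq> A" "word_cong A R (v @ w) []" by auto
    obtain b where b: "b \<in> A" "word_cong A R [b, a] []"
      using assms[of a] Cons.prems by auto
    have "word_cong A R (v @ [b, a] @ w) (v @ [] @ w)"
      using b Cons.prems v by (intro word_cong_prepend word_cong_append) auto
    then have "word_cong A R ((v @ [b]) @ (a # w)) []"
      using v word_cong.trans by fastforce
    then show ?case using v b by (intro exI[of _ "v @ [b]"]) auto
  qed
  show ?thesis
  proof (rule monoid.group_l_invI[OF monoid_presented_monoid])
    fix x assume "x \<in> carrier (presented_monoid A R)"
    then obtain w where w: "set w \<subseteq> A" "x = word_class A R w" by auto
    with inv obtain v where "set v \<subseteq> A" "word_cong A R (v @ w) []" by blast
    with w show "\<exists>y\<in>carrier (presented_monoid A R).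
        y \<otimes>\<^bsub>presented_monoid A R\<^esub> x = \<one>\<^bsub>presented_monoid A R\<^esub>"
      using word_class_eq by (fastforce simp: mult_presented_monoid one_presented_monoid)
  qed
qed

lemma word_eval_simps [simp]:
  "word_eval M f [] = \<one>\<^bsub>M\<^esub>" "word_eval M f (a # w) = f a \<otimes>\<^bsub>M\<^esub> word_eval M f w"
  by (simp_all add: word_eval_def)

context
  fixes M :: "('a, 'b) monoid_scheme" (structure) and A :: "'x set" and f :: "'x \<Rightarrow> 'a"
  assumes M: "monoid M" and f: "\<And>a. a \<in> A \<Longrightarrow> f a \<in> carrier M"
begin

interpretation monoid M by (rule M)

lemma word_eval_closed: "set w \<subseteq> A \<Longrightarrow> word_eval M f w \<in> carrier M"
  by (induction w) (auto simp: f)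

lemma word_eval_append:
  "set v \<subseteq> A \<Longrightarrow> set w \<subseteq> A \<Longrightarrow> word_eval M f (v @ w) = word_eval M f v \<otimes> word_eval M f w"
proof (induction v)
  case Nil
  then show ?case by (simp add: word_eval_closed)
next
  case (Cons a v)
  then show ?case
    using word_eval_closed[of v] word_eval_closed[of w] f[of a] by (simp add: m_assoc)
qed

context
  fixes R
  assumes R: "\<And>u v. (u, v) \<in> R \<Longrightarrow> set u \<subseteq> A \<Longrightarrow> set v \<subseteq> A \<Longrightarrow> word_eval M f u = word_eval M f v"
begin

lemma word_eval_cong: "word_cong A R v w \<Longrightarrow> word_eval M f v = word_eval M f w"
proof (induction rule: word_cong.induct)
  case (rel u v p q)
  then show ?case using R[of u v] by (simp add: word_eval_append)
qed auto

lemma presented_lift_class: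
  assumes "set w \<subseteq> A"
  shows "presented_lift M f (word_class A R w) = word_eval M f w"
proof -
  have "word_eval M f u = word_eval M f w" if "u \<in> word_class A R w" for u
    using that word_eval_cong[of w u] by (simp add: word_class_def)
  then have "word_eval M f ` word_class A R w = {word_eval M f w}"
    using word_class_self[OF assms, of R] by blast
  then show ?thesis by (simp add: presented_lift_def)
qed

lemma presented_lift_hom: "presented_lift M f \<in> hom (presented_monoid A R) M"
  by (rule homI)
    (auto simp: presented_lift_class mult_presented_monoid word_eval_closed word_eval_append
     )

lemma presented_lift_letter:
  "a \<in> A \<Longrightarrow> presented_lift M f (word_class A R [a]) = f a"
  using f[of a] by (simp add: presented_lift_class)

end

end


section \<open>Free groups and free products\<close>

text \<open>The letters \<open>(x, True)\<close> and \<open>(x, False)\<close> stand for \<open>x\<close> and its formal inverse.\<close>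

definition free_group_rels :: "'x set \<Rightarrow> (('x \<times> bool) list \<times> ('x \<times> bool) list) set" where
  "free_group_rels X = {([(x, b), (x, \<not> b)], []) | x b. x \<in> X}"

definition free_group :: "'x set \<Rightarrow> ('x \<times> bool) list set monoid" where
  "free_group X = presented_monoid (X \<times> UNIV) (free_group_rels X)"

definition free_gen :: "'x set \<Rightarrow> 'x \<Rightarrow> ('x \<times> bool) list set" where
  "free_gen X x = word_class (X \<times> UNIV) (free_group_rels X) [(x, True)]"

definition free_group_lift :: "('a, 'b) monoid_scheme \<Rightarrow> ('x \<Rightarrow> 'a) \<Rightarrow> ('x \<times> bool) list set \<Rightarrow> 'a" where
  "free_group_lift M t = presented_lift M (\<lambda>(x, b). if b then t x else inv\<^bsub>M\<^esub> (t x))"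

definition free_product_rels ::
    "('a, 'm) monoid_scheme \<Rightarrow> ('b, 'n) monoid_scheme \<Rightarrow> (('a + 'b) list \<times> ('a + 'b) list) set" where
  "free_product_rels G H =
     {([Inl g, Inl g'], [Inl (g \<otimes>\<^bsub>G\<^esub> g')]) | g g'. g \<in> carrier G \<and> g' \<in> carrier G}
     \<union> {([Inr h, Inr h'], [Inr (h \<otimes>\<^bsub>H\<^esub> h')]) | h h'. h \<in> carrier H \<and> h' \<in> carrier H}
     \<union> {([Inl \<one>\<^bsub>G\<^esub>], []), ([Inr \<one>\<^bsub>H\<^esub>], [])}"

definition free_product ::
    "('a, 'm) monoid_scheme \<Rightarrow> ('b, 'n) monoid_scheme \<Rightarrow> ('a + 'b) list set monoid" where
  "free_product G H = presented_monoid (carrier G <+> carrier H) (free_product_rels G H)"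

definition free_product_inl ::
    "('a, 'm) monoid_scheme \<Rightarrow> ('b, 'n) monoid_scheme \<Rightarrow> 'a \<Rightarrow> ('a + 'b) list set" where
  "free_product_inl G H g = word_class (carrier G <+> carrier H) (free_product_rels G H) [Inl g]"

definition free_product_inr ::
    "('a, 'm) monoid_scheme \<Rightarrow> ('b, 'n) monoid_scheme \<Rightarrow> 'b \<Rightarrow> ('a + 'b) list set" where
  "free_product_inr G H h = word_class (carrier G <+> carrier H) (free_product_rels G H) [Inr h]"

definition free_product_lift ::
    "('c, 'm) monoid_scheme \<Rightarrow> ('a \<Rightarrow> 'c) \<Rightarrow> ('b \<Rightarrow> 'c) \<Rightarrow> ('a + 'b) list set \<Rightarrow> 'c" where
  "free_product_lift M f g = presented_lift M (case_sum f g)"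

lemma group_free_group: "group (free_group X)"
  unfolding free_group_def
proof (rule group_presented_monoid)
  fix a assume "a \<in> X \<times> (UNIV :: bool set)"
  then obtain x b where "a = (x, b)" "x \<in> X" by auto
  then show "\<exists>c\<in>X \<times> UNIV.
      word_cong (X \<times> UNIV) (free_group_rels X) [c, a] []"
    using word_cong.rel[of "[(x, \<not> b), (x, b)]" "[]" "free_group_rels X" "X \<times> UNIV" "[]" "[]"]
    by (intro bexI[of _ "(x, \<not> b)"]) (auto simp: free_group_rels_def)
qed

lemma free_gen_closed: "x \<in> X \<Longrightarrow> free_gen X x \<in> carrier (free_group X)"
  unfolding free_gen_def free_group_def by auto

context
  fixes M :: "('a, 'b) monoid_scheme" (structure) and X :: "'x set" and t :: "'x \<Rightarrow> 'a"
  assumes M: "group M" and t: "\<And>x. x \<in> X \<Longrightarrow> t x \<in> carrier M"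
begin

interpretation group M by (rule M)

lemma free_group_lift_hom: "free_group_lift M t \<in> hom (free_group X) M"
  unfolding free_group_lift_def free_group_def
  by (rule presented_lift_hom[OF is_monoid])
    (auto simp: t free_group_rels_def r_inv l_inv split: if_splits)

lemma free_group_lift_gen: "x \<in> X \<Longrightarrow> free_group_lift M t (free_gen X x) = t x"
  unfolding free_group_lift_def free_gen_def
  by (subst presented_lift_letter[OF is_monoid])
    (auto simp: t free_group_rels_def r_inv l_inv split: if_splits)

end

context
  fixes G :: "('a, 'm) monoid_scheme" and H :: "('b, 'n) monoid_scheme"
  assumes G: "group G" and H: "group H"
begin

interpretation G: group G by (rule G)
interpretation H: group H by (rule H)

lemma group_free_product: "group (free_product G H)"
  unfolding free_product_def
proof (rule group_presented_monoid)
  let ?A = "carrier G <+> carrier H" and ?R = "free_product_rels G H"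
  fix a assume "a \<in> ?A"
  then consider g where "a = Inl g" "g \<in> carrier G" | h where "a = Inr h" "h \<in> carrier H"
    by auto
  then show "\<exists>b\<in>?A. word_cong ?A ?R [b, a] []"
  proof cases
    case 1
    have "([Inl (inv\<^bsub>G\<^esub> g), Inl g], [Inl \<one>\<^bsub>G\<^esub>]) \<in> ?R" "([Inl \<one>\<^bsub>G\<^esub>], []) \<in> ?R"
      using 1 G.inv_closed[of g] G.l_inv[of g] unfolding free_product_rels_def by force+
    then have "word_cong ?A ?R [Inl (inv\<^bsub>G\<^esub> g), Inl g] []"
      using 1 word_cong.rel[of "[Inl (inv\<^bsub>G\<^esub> g), Inl g]" "[Inl \<one>\<^bsub>G\<^esub>]" ?R ?A "[]" "[]"]
        word_cong.rel[of "[Inl \<one>\<^bsub>G\<^esub>]" "[]" ?R ?A "[]" "[]"]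
      by (auto intro: word_cong.trans)
    with 1 show ?thesis by auto
  next
    case 2
    have "([Inr (inv\<^bsub>H\<^esub> h), Inr h], [Inr \<one>\<^bsub>H\<^esub>]) \<in> ?R" "([Inr \<one>\<^bsub>H\<^esub>], []) \<in> ?R"
      using 2 H.inv_closed[of h] H.l_inv[of h] unfolding free_product_rels_def by force+
    then have "word_cong ?A ?R [Inr (inv\<^bsub>H\<^esub> h), Inr h] []"
      using 2 word_cong.rel[of "[Inr (inv\<^bsub>H\<^esub> h), Inr h]" "[Inr \<one>\<^bsub>H\<^esub>]" ?R ?A "[]" "[]"]
        word_cong.rel[of "[Inr \<one>\<^bsub>H\<^esub>]" "[]" ?R ?A "[]" "[]"]
      by (auto intro: word_cong.trans)
    with 2 show ?thesis by auto
  qed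
qed

lemma free_product_inl_hom: "free_product_inl G H \<in> hom G (free_product G H)"
proof (rule homI)
  fix g g' assume g: "g \<in> carrier G" "g' \<in> carrier G"
  let ?A = "carrier G <+> carrier H" and ?R = "free_product_rels G H"
  have "([Inl g, Inl g'], [Inl (g \<otimes>\<^bsub>G\<^esub> g')]) \<in> ?R"
    using g unfolding free_product_rels_def by auto
  then have "word_cong ?A ?R [Inl g, Inl g'] [Inl (g \<otimes>\<^bsub>G\<^esub> g')]"
    using g word_cong.rel[of "[Inl g, Inl g']" "[Inl (g \<otimes>\<^bsub>G\<^esub> g')]" ?R ?A "[]" "[]"] by auto
  with g show "free_product_inl G H (g \<otimes>\<^bsub>G\<^esub> g') =
      free_product_inl G H g \<otimes>\<^bsub>free_product G H\<^esub> free_product_inl G H g'"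
    using mult_presented_monoid[of "[Inl g]" ?A "[Inl g']" ?R]
    by (auto simp: free_product_inl_def free_product_def word_class_eq)
qed (auto simp: free_product_inl_def free_product_def)

lemma free_product_inr_hom: "free_product_inr G H \<in> hom H (free_product G H)"
proof (rule homI)
  fix h h' assume h: "h \<in> carrier H" "h' \<in> carrier H"
  let ?A = "carrier G <+> carrier H" and ?R = "free_product_rels G H"
  have "([Inr h, Inr h'], [Inr (h \<otimes>\<^bsub>H\<^esub> h')]) \<in> ?R"
    using h unfolding free_product_rels_def by auto
  then have "word_cong ?A ?R [Inr h, Inr h'] [Inr (h \<otimes>\<^bsub>H\<^esub> h')]"
    using h word_cong.rel[of "[Inr h, Inr h']" "[Inr (h \<otimes>\<^bsub>H\<^esub> h')]" ?R ?A "[]" "[]"] by auto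
  with h show "free_product_inr G H (h \<otimes>\<^bsub>H\<^esub> h') =
      free_product_inr G H h \<otimes>\<^bsub>free_product G H\<^esub> free_product_inr G H h'"
    using mult_presented_monoid[of "[Inr h]" ?A "[Inr h']" ?R]
    by (auto simp: free_product_inr_def free_product_def word_class_eq)
qed (auto simp: free_product_inr_def free_product_def)

context
  fixes M :: "('c, 'k) monoid_scheme" and f g
  assumes M: "group M" and f: "f \<in> hom G M" and g: "g \<in> hom H M"
begin

interpretation M: group M by (rule M)

private lemma case_sum_closed: "a \<in> carrier G <+> carrier H \<Longrightarrow> case_sum f g a \<in> carrier M"
  using hom_in_carrier[OF f] hom_in_carrier[OF g] by auto

private lemma free_product_rels_eval:
  "(u, v) \<in> free_product_rels G H \<Longrightarrow>
     word_eval M (case_sum f g) u = word_eval M (case_sum f g) v"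
  using hom_one[OF f G M] hom_one[OF g H M] hom_in_carrier[OF f] hom_in_carrier[OF g]
  by (auto simp: free_product_rels_def hom_mult[OF f] hom_mult[OF g] M.m_assoc)

lemma free_product_lift_hom: "free_product_lift M f g \<in> hom (free_product G H) M"
  unfolding free_product_lift_def free_product_def
  by (rule presented_lift_hom[OF M.is_monoid case_sum_closed free_product_rels_eval])

lemma free_product_lift_inl:
  "x \<in> carrier G \<Longrightarrow> free_product_lift M f g (free_product_inl G H x) = f x"
  unfolding free_product_lift_def free_product_inl_def
  by (subst presented_lift_letter[OF M.is_monoid case_sum_closed free_product_rels_eval]) auto

lemma free_product_lift_inr:
  "x \<in> carrier H \<Longrightarrow> free_product_lift M f g (free_product_inr G H x) = g x"
  unfolding free_product_lift_def free_product_inr_def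
  by (subst presented_lift_letter[OF M.is_monoid case_sum_closed free_product_rels_eval]) auto

end

end


section \<open>Polynomial functions\<close>

definition poly_group ::
    "('a, 'b) monoid_scheme \<Rightarrow> nat \<Rightarrow> ('a + (nat \<times> bool) list set) list set monoid" where
  "poly_group G n = free_product G (free_group {1..n})"

text \<open>Points of \<open>G\<^sup>n\<close> are extensional functions on \<open>{1..n}\<close>, and maps on \<open>G\<^sup>n\<close> are in turn
  extensional, so that two polynomials inducing the same map on \<open>G\<^sup>n\<close> give equal elements of
  \<open>poly_fun_group\<close>.\<close>

abbreviation tuples :: "('a, 'b) monoid_scheme \<Rightarrow> nat \<Rightarrow> (nat \<Rightarrow> 'a) set" where
  "tuples G n \<equiv> \<Pi>\<^sub>E i\<in>{1..n}. carrier G"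

text \<open>By \<open>poly_subst_hom\<close>, \<open>poly_subst_const\<close> and \<open>poly_subst_var\<close> below, this is the homomorphism
  from \<open>G * F\<^sub>n\<close> to \<open>G\<close> that is the identity on \<open>G\<close> and sends \<open>x\<^sub>i\<close> to \<open>t i\<close>.\<close>

definition poly_subst ::
    "('a, 'b) monoid_scheme \<Rightarrow> (nat \<Rightarrow> 'a) \<Rightarrow> ('a + (nat \<times> bool) list set) list set \<Rightarrow> 'a" where
  "poly_subst G t = free_product_lift G (\<lambda>g. g) (free_group_lift G t)"

definition poly_fun ::
    "('a, 'b) monoid_scheme \<Rightarrow> nat \<Rightarrow> ('a + (nat \<times> bool) list set) list set \<Rightarrow> (nat \<Rightarrow> 'a) \<Rightarrow> 'a" where
  "poly_fun G n f = (\<lambda>t\<in>tuples G n. poly_subst G t f)"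

definition poly_fun_group ::
    "('a, 'b) monoid_scheme \<Rightarrow> nat \<Rightarrow> ((nat \<Rightarrow> 'a) \<Rightarrow> 'a) monoid" where
  "poly_fun_group G n =
     (product_group (tuples G n) (\<lambda>_. G))\<lparr>carrier := poly_fun G n ` carrier (poly_group G n)\<rparr>"

context
  fixes G :: "('a, 'b) monoid_scheme" (structure) and n :: nat
  assumes G: "group G"
begin

interpretation group G by (rule G)

lemma group_poly_group: "group (poly_group G n)"
  unfolding poly_group_def by (rule group_free_product[OF G group_free_group])

context
  fixes t assumes t: "t \<in> tuples G n"
begin

private lemma lift_hom: "free_group_lift G t \<in> hom (free_group {1..n}) G"
  by (rule free_group_lift_hom[OF G]) (use t in \<open>auto simp: PiE_iff\<close>)

private lemma id_hom: "(\<lambda>g. g) \<in> hom G G"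
  by (simp add: hom_def)

lemma poly_subst_hom: "poly_subst G t \<in> hom (poly_group G n) G"
  unfolding poly_subst_def poly_group_def
  by (rule free_product_lift_hom[OF G group_free_group G id_hom lift_hom])

lemma poly_subst_const:
  "g \<in> carrier G \<Longrightarrow> poly_subst G t (free_product_inl G (free_group {1..n}) g) = g"
  unfolding poly_subst_def
  by (rule free_product_lift_inl[OF G group_free_group G id_hom lift_hom])

lemma poly_subst_var:
  assumes "i \<in> {1..n}"
  shows "poly_subst G t (free_product_inr G (free_group {1..n}) (free_gen {1..n} i)) = t i"
proof -
  have "poly_subst G t (free_product_inr G (free_group {1..n}) (free_gen {1..n} i)) =
      free_group_lift G t (free_gen {1..n} i)"
    unfolding poly_subst_def
    by (rule free_product_lift_inr[OF G group_free_group G id_hom lift_hom free_gen_closed[OF assms]])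
  also have "\<dots> = t i"
    by (rule free_group_lift_gen[OF G _ assms]) (use t in \<open>auto simp: PiE_iff\<close>)
  finally show ?thesis .
qed

end

lemma poly_fun_hom: "poly_fun G n \<in> hom (poly_group G n) (product_group (tuples G n) (\<lambda>_. G))"
  by (rule homI)
    (auto simp: poly_fun_def hom_mult[OF poly_subst_hom] hom_in_carrier[OF poly_subst_hom]
      simp del: PiE_iff intro!: restrict_ext)

lemma group_poly_fun_group: "group (poly_fun_group G n)"
proof -
  let ?P = "product_group (tuples G n) (\<lambda>_. G)"
  interpret group_hom "poly_group G n" ?P "poly_fun G n"
    using group_poly_group poly_fun_hom G by (intro group_hom.intro group_hom_axioms.intro) auto
  show ?thesis
    unfolding poly_fun_group_def
    by (rule subgroup.subgroup_is_group[OF img_is_subgroup]) simp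
qed

end

end

theory Submission
  imports Defs "HOL-Algebra.FiniteProduct"
begin

text \<open>
  Write \<open>P\<close> for the group of polynomial functions in \<open>n\<close> variables on \<open>G\<close>.

  Passing from \<open>G\<close> to \<open>P\<close> is easy. \<open>P\<close> is generated by the constants and the \<open>n\<close> coordinate
  functions, so it is finitely generated if \<open>G\<close> is; and it is a group of \<open>G\<close>-valued functions, so it
  satisfies the laws of \<open>G\<close>, in particular solubility of a given derived length. If \<open>N\<close> is a nilpotent
  normal subgroup of finite index in \<open>G\<close>, the polynomial functions with all values in \<open>N\<close> form a
  nilpotent normal subgroup of \<open>P\<close>. It has finite index because modulo \<open>N\<close> a polynomial function
  only depends on its arguments modulo \<open>N\<close>, so it is determined there by finitely many values. A finitely
  generated nilpotent-by-finite group is Noetherian, so \<open>P\<close> is then polycyclic.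

  The substance lies in the converse: if \<open>P\<close> is polycyclic, then \<open>G\<close> is nilpotent-by-finite. As an
  image of \<open>P\<close>, the group \<open>G\<close> is itself polycyclic. For \<open>a \<in> G\<close> let \<open>f\<^sub>k \<in> P\<close> be the function
  \<open>s \<mapsto> s\<^sup>k a s\<^sup>-\<^sup>k\<close>. The chain of the subgroups generated by \<open>f\<^sub>0, \<dots>, f\<^sub>d\<^sub>-\<^sub>1\<close> becomes stationary, so for
  some \<open>d\<close> the function \<open>f\<^sub>d\<close> is a word in \<open>f\<^sub>0, \<dots>, f\<^sub>d\<^sub>-\<^sub>1\<close>. The point is that one word serves
  all \<open>s \<in> G\<close>, in particular all powers of a single \<open>t\<close>. Let \<open>a\<close> lie in an abelian section of \<open>G\<close>,
  written additively, that is normalised by \<open>t\<close>, and let \<open>\<phi>\<close> be conjugation by \<open>t\<close>. The word gives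
  integers \<open>c\<^sub>k\<close> with \<open>c\<^sub>d = 1\<close> and
  \<open>\<Sum>\<^sub>k c\<^sub>k \<phi>\<^sup>k\<^sup>j a = 0\<close> for every \<open>j\<close>. This is a linear system of Vandermonde type in the unknowns
  \<open>c\<^sub>k a\<close>; eliminating all unknowns but the last leaves
  \<open>(\<phi> - 1)(\<phi>\<^sup>2 - 1) \<cdots> (\<phi>\<^sup>d - 1) a = 0\<close>, hence \<open>(\<phi>\<^sup>m - 1)\<^sup>d a = 0\<close> whenever \<open>m\<close> is divisible by
  \<open>1, \<dots>, d\<close>. This is lemma \<open>vandermonde_elimination\<close>. It replaces the usual argument with
  eigenvalues that are roots of unity, and it is indifferent to torsion in the section.

  If \<open>M\<close> is a nilpotent subgroup normalised by \<open>t\<close>, this applies to the factors of its lower central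
  series, which are finitely generated. So one power \<open>t\<^sup>m\<close>, with \<open>m > 0\<close>, acts unipotently on all of
  them, and \<open>M\<close> and \<open>t\<^sup>m\<close> together generate a nilpotent group (lemma \<open>nilpotent_cyclic_extension\<close>).
  Virtual nilpotency thus survives cyclic extensions, and a polycyclic group is reached from the trivial
  group by finitely many of these (\<open>polycyclic_induct\<close>).
\<close>

section \<open>Conjugation and commutators\<close>

context group begin

definition conjugate :: "'a \<Rightarrow> 'a \<Rightarrow> 'a" where
  "conjugate g x = g \<otimes> x \<otimes> inv g"

definition commutator :: "'a \<Rightarrow> 'a \<Rightarrow> 'a" where
  "commutator x y = x \<otimes> y \<otimes> inv x \<otimes> inv y"

text \<open>The condition is an equivalence, not just \<open>conjugate g u \<in> U\<close> for \<open>u \<in> U\<close>: in an infinite group the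
  latter need not define a subgroup.\<close>
definition normalizer :: "'a set \<Rightarrow> 'a set" where
  "normalizer U = {g \<in> carrier G. \<forall>u \<in> carrier G. conjugate g u \<in> U \<longleftrightarrow> u \<in> U}"

lemma conjugate_closed [simp, intro]:
  "g \<in> carrier G \<Longrightarrow> x \<in> carrier G \<Longrightarrow> conjugate g x \<in> carrier G"
  by (simp add: conjugate_def)

lemma commutator_closed [simp, intro]:
  "x \<in> carrier G \<Longrightarrow> y \<in> carrier G \<Longrightarrow> commutator x y \<in> carrier G"
  by (simp add: commutator_def)

lemma inv_mult_cancel [simp]:
  assumes "x \<in> carrier G" "y \<in> carrier G"
  shows "inv x \<otimes> (x \<otimes> y) = y" "x \<otimes> (inv x \<otimes> y) = y"
  using assms by (simp_all flip: m_assoc)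

lemma conjugate_mult:
  "g \<in> carrier G \<Longrightarrow> x \<in> carrier G \<Longrightarrow> y \<in> carrier G \<Longrightarrow>
    conjugate g (x \<otimes> y) = conjugate g x \<otimes> conjugate g y"
  by (simp add: conjugate_def m_assoc)

lemma conjugate_conjugate:
  "g \<in> carrier G \<Longrightarrow> h \<in> carrier G \<Longrightarrow> x \<in> carrier G \<Longrightarrow>
    conjugate g (conjugate h x) = conjugate (g \<otimes> h) x"
  by (simp add: conjugate_def m_assoc inv_mult_group)

lemma conjugate_one_left [simp]: "x \<in> carrier G \<Longrightarrow> conjugate \<one> x = x"
  by (simp add: conjugate_def)

lemma conjugate_one_right [simp]: "g \<in> carrier G \<Longrightarrow> conjugate g \<one> = \<one>"
  by (simp add: conjugate_def)

lemma conjugate_inv: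
  "g \<in> carrier G \<Longrightarrow> x \<in> carrier G \<Longrightarrow> conjugate g (inv x) = inv (conjugate g x)"
  by (simp add: conjugate_def m_assoc inv_mult_group)

lemma conjugate_inv_cancel [simp]:
  assumes "g \<in> carrier G" "x \<in> carrier G"
  shows "conjugate (inv g) (conjugate g x) = x" "conjugate g (conjugate (inv g) x) = x"
  using assms by (simp_all add: conjugate_conjugate)

lemma conjugate_commutator:
  "g \<in> carrier G \<Longrightarrow> x \<in> carrier G \<Longrightarrow> y \<in> carrier G \<Longrightarrow>
    conjugate g (commutator x y) = commutator (conjugate g x) (conjugate g y)"
  by (simp add: commutator_def conjugate_mult conjugate_inv)

lemma conjugate_nat_pow:
  "g \<in> carrier G \<Longrightarrow> x \<in> carrier G \<Longrightarrow> conjugate g (x [^] (k::nat)) = conjugate g x [^] k"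
  by (induction k) (simp_all add: conjugate_mult)

lemma commutator_eq_conjugate:
  "x \<in> carrier G \<Longrightarrow> y \<in> carrier G \<Longrightarrow> commutator x y = conjugate x y \<otimes> inv y"
  by (simp add: commutator_def conjugate_def)

lemma conjugate_eq_commutator:
  "x \<in> carrier G \<Longrightarrow> y \<in> carrier G \<Longrightarrow> conjugate x y = commutator x y \<otimes> y"
  by (simp add: commutator_def conjugate_def m_assoc)

lemma inv_commutator:
  "x \<in> carrier G \<Longrightarrow> y \<in> carrier G \<Longrightarrow> inv (commutator x y) = commutator y x"
  by (simp add: commutator_def m_assoc inv_mult_group)

lemma commutator_mult_right:
  "x \<in> carrier G \<Longrightarrow> y \<in> carrier G \<Longrightarrow> z \<in> carrier G \<Longrightarrow>
    commutator x (y \<otimes> z) = commutator x y \<otimes> conjugate y (commutator x z)"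
  by (simp add: commutator_def conjugate_def m_assoc inv_mult_group)

lemma commutator_inv_right:
  "x \<in> carrier G \<Longrightarrow> y \<in> carrier G \<Longrightarrow>
    commutator x (inv y) = conjugate (inv y) (inv (commutator x y))"
  by (simp add: commutator_def conjugate_def m_assoc inv_mult_group)

lemma commutator_one [simp]:
  "x \<in> carrier G \<Longrightarrow> commutator x \<one> = \<one>" "x \<in> carrier G \<Longrightarrow> commutator \<one> x = \<one>"
  by (simp_all add: commutator_def)

lemma normalizer_subset: "normalizer U \<subseteq> carrier G"
  by (auto simp: normalizer_def)

lemma normalizerD:
  "g \<in> normalizer U \<Longrightarrow> u \<in> carrier G \<Longrightarrow> conjugate g u \<in> U \<longleftrightarrow> u \<in> U"
  by (auto simp: normalizer_def)

lemma normalizerI: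
  assumes "g \<in> carrier G" "U \<subseteq> carrier G"
    and "\<And>u. u \<in> U \<Longrightarrow> conjugate g u \<in> U" "\<And>u. u \<in> U \<Longrightarrow> conjugate (inv g) u \<in> U"
  shows "g \<in> normalizer U"
  using assms conjugate_inv_cancel(1)[of g] unfolding normalizer_def by fastforce

lemma subgroup_normalizer: "subgroup (normalizer U) G"
proof
  fix g h assume gh: "g \<in> normalizer U" "h \<in> normalizer U"
  then show "g \<otimes> h \<in> normalizer U"
    unfolding normalizer_def by (auto simp flip: conjugate_conjugate)
next
  fix g assume g: "g \<in> normalizer U"
  then have gc: "g \<in> carrier G" using normalizer_subset by auto
  have "conjugate (inv g) u \<in> U \<longleftrightarrow> u \<in> U" if "u \<in> carrier G" for u
    using normalizerD[OF g, of "conjugate (inv g) u"] gc that by auto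
  with gc show "inv g \<in> normalizer U" by (auto simp: normalizer_def)
qed (auto simp: normalizer_def)

lemma subgroup_le_normalizer:
  assumes "subgroup U G" shows "U \<subseteq> normalizer U"
proof
  fix u assume u: "u \<in> U"
  interpret subgroup U G by fact
  show "u \<in> normalizer U"
    by (rule normalizerI) (use u in \<open>auto simp: conjugate_def\<close>)
qed

lemma normalizer_carrier: "normalizer (carrier G) = carrier G"
  by (auto simp: normalizer_def)

lemma generate_normalizer:
  assumes S: "S \<subseteq> carrier G" and g: "g \<in> carrier G"
    and conj: "\<And>x. x \<in> S \<Longrightarrow> conjugate g x \<in> generate G S"
      "\<And>x. x \<in> S \<Longrightarrow> conjugate (inv g) x \<in> generate G S"
  shows "g \<in> normalizer (generate G S)"
proof -
  have *: "conjugate h u \<in> generate G S"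
    if "h \<in> carrier G" "\<And>x. x \<in> S \<Longrightarrow> conjugate h x \<in> generate G S" "u \<in> generate G S" for h u
    using that(3)
  proof induction
    case (inv x)
    then show ?case
      using that(1) that(2)[of x] S conjugate_inv[of h x] generate_m_inv_closed[OF S] by auto
  next
    case (eng x y)
    then show ?case
      using that(1) generate_in_carrier[OF S] by (auto simp: conjugate_mult intro: generate.eng)
  qed (use that in \<open>auto intro: generate.intros\<close>)
  show ?thesis
    by (rule normalizerI) (use S g conj * generate_in_carrier[OF S] in auto)
qed

lemma normal_iff_normalizer:
  assumes "subgroup N G" "subgroup H G" "N \<subseteq> H"
  shows "N \<lhd> G\<lparr>carrier := H\<rparr> \<longleftrightarrow> H \<subseteq> normalizer N"
proof -
  interpret H: group "G\<lparr>carrier := H\<rparr>" using assms subgroup_imp_group by blast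
  have HG: "H \<subseteq> carrier G" using assms(2) subgroup.subset by blast
  have inv: "inv\<^bsub>G\<lparr>carrier := H\<rparr>\<^esub> h = inv h" if "h \<in> H" for h
    using that assms(2) m_inv_consistent by blast
  have "N \<lhd> G\<lparr>carrier := H\<rparr> \<longleftrightarrow> (\<forall>h\<in>H. \<forall>n\<in>N. conjugate h n \<in> N)"
    unfolding H.normal_inv_iff using assms subgroup_incl[OF assms(1,2)] inv
    by (auto simp: conjugate_def)
  also have "\<dots> \<longleftrightarrow> H \<subseteq> normalizer N"
    using normalizerI[of _ N] normalizerD[of _ N] HG subgroup.subset[OF assms(1)]
      subgroup.m_inv_closed[OF assms(2)] by (smt (verit) subset_iff)
  finally show ?thesis .
qed

text \<open>By \<open>[z, xy] = [z, x] x [z, y] x\<inverse>\<close> the elements \<open>k\<close> with \<open>[z, k] \<in> W\<close> form a subgroup, provided that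
  \<open>W\<close> is normalised by the elements in question. All commutator conditions below are reduced to
  generators in this way.\<close>

lemma commutator_generate:
  assumes W: "subgroup W G" and S: "S \<subseteq> carrier G" "generate G S \<subseteq> normalizer W"
    and z: "z \<in> carrier G" and zS: "\<And>s. s \<in> S \<Longrightarrow> commutator z s \<in> W"
    and k: "k \<in> generate G S"
  shows "commutator z k \<in> W"
proof -
  interpret subgroup W G by fact
  have inv: "inv s \<in> normalizer W" if "s \<in> generate G S" for s
    using that S(2) generate_m_inv_closed[OF S(1)] by blast
  from k show ?thesis
  proof induction
    case (inv s)
    then have "s \<in> carrier G" "inv s \<in> normalizer W" using S by (auto intro: generate.intros)
    with inv z zS[of s] show ?case
      using normalizerD[of "inv s" W "inv (commutator z s)"] by (simp add: commutator_inv_right)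
  next
    case (eng x y)
    then have "x \<in> carrier G" "y \<in> carrier G" "x \<in> normalizer W"
      using S generate_in_carrier by blast+
    with eng z show ?case
      using normalizerD[of x W "commutator z y"] by (simp add: commutator_mult_right)
  qed (use z zS one_closed in auto)
qed

end

section \<open>Vandermonde elimination in abelian groups\<close>

context comm_group begin

text \<open>In additive notation this is the operator \<open>\<phi>\<^sup>m - 1\<close>.\<close>
definition power_diff :: "('a \<Rightarrow> 'a) \<Rightarrow> nat \<Rightarrow> 'a \<Rightarrow> 'a" where
  "power_diff \<phi> m x = (\<phi> ^^ m) x \<otimes> inv x"

lemma power_diff_eq: "x \<in> carrier G \<Longrightarrow> power_diff \<phi> m x = (\<phi> ^^ m) x \<otimes> inv x"
  by (simp add: power_diff_def)

context
  fixes \<phi> :: "'a \<Rightarrow> 'a"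
  assumes \<phi>: "\<phi> \<in> hom G G"
begin

lemma funpow_hom: "\<phi> ^^ k \<in> hom G G"
  by (induction k) (use \<phi> in \<open>auto simp: hom_def Pi_iff\<close>)

lemma funpow_closed: "x \<in> carrier G \<Longrightarrow> (\<phi> ^^ k) x \<in> carrier G"
  using funpow_hom[of k] by (rule hom_in_carrier)

lemma funpow_mult_hom: 
  "x \<in> carrier G \<Longrightarrow> y \<in> carrier G \<Longrightarrow> (\<phi> ^^ k) (x \<otimes> y) = (\<phi> ^^ k) x \<otimes> (\<phi> ^^ k) y"
  using funpow_hom[of k] by (auto simp: hom_def)

lemma funpow_inv_hom: 
  "x \<in> carrier G \<Longrightarrow> (\<phi> ^^ k) (inv x) = inv ((\<phi> ^^ k) x)"
  using funpow_hom[of k] by (simp add: group_hom.hom_inv group_hom_def group_hom_axioms_def)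

lemma power_diff_hom: "power_diff \<phi> m \<in> hom G G"
  by (rule homI) (simp_all add: power_diff_eq funpow_closed funpow_mult_hom m_ac inv_mult)

lemma funpow_finprod:
  assumes "b \<in> {..d::nat} \<rightarrow> carrier G"
  shows "(\<phi> ^^ k) (\<Otimes>i\<in>{..d}. b i) = (\<Otimes>i\<in>{..d}. (\<phi> ^^ k) (b i))"
  using assms
proof (induction d)
  case (Suc d)
  then have *: "b \<in> {..d} \<rightarrow> carrier G" "b (Suc d) \<in> carrier G" by auto
  then have "(\<lambda>i. (\<phi> ^^ k) (b i)) \<in> {..Suc d} \<rightarrow> carrier G" using Suc.prems by (auto intro!: funpow_closed)
  with Suc * show ?case by (simp add: funpow_mult_hom del: finprod_Suc add: finprod_Suc)
qed (auto simp: funpow_closed)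

lemma power_diff_funpow:
  assumes "x \<in> carrier G"
  shows "(power_diff \<phi> m ^^ l) ((\<phi> ^^ k) x) = (\<phi> ^^ k) ((power_diff \<phi> m ^^ l) x)"
proof (induction l)
  case (Suc l)
  have c: "(power_diff \<phi> m ^^ l) x \<in> carrier G"
    by (induction l) (use assms power_diff_hom hom_in_carrier in \<open>fastforce+\<close>)
  have "(\<phi> ^^ m) ((\<phi> ^^ k) y) = (\<phi> ^^ k) ((\<phi> ^^ m) y)" for y
    by (metis add.commute comp_apply funpow_add)
  with Suc c show ?case
    by (simp add: power_diff_eq funpow_mult_hom funpow_inv_hom funpow_closed)
qed auto

lemma power_diff_funpow_hom: "power_diff \<phi> m ^^ l \<in> hom G G"
  by (induction l) (use power_diff_hom in \<open>auto simp: hom_def Pi_iff\<close>)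

text \<open>The elements killed by \<open>(\<phi>\<^sup>m - 1)\<^sup>l\<close> form a \<open>\<phi>\<close>-invariant subgroup, and
  \<open>\<phi>\<^sup>n\<^sup>q - 1\<close> is a multiple of \<open>\<phi>\<^sup>n - 1\<close>.\<close>
lemma power_diff_dvd:
  assumes x: "x \<in> carrier G" and kill: "(power_diff \<phi> m ^^ l) (power_diff \<phi> n x) = \<one>"
  shows "(power_diff \<phi> m ^^ l) (power_diff \<phi> (n * q) x) = \<one>"
proof (induction q)
  case 0
  then show ?case
    using x power_diff_funpow_hom[of l m] hom_one[OF _ is_group is_group] by (simp add: power_diff_eq)
next
  case (Suc q)
  let ?K = "power_diff \<phi> m ^^ l"
  have "power_diff \<phi> (n * Suc q) x = (\<phi> ^^ n) (power_diff \<phi> (n * q) x) \<otimes> power_diff \<phi> n x"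
    using x by (simp add: power_diff_eq funpow_add funpow_mult_hom funpow_inv_hom funpow_closed m_assoc)
  moreover have "power_diff \<phi> i x \<in> carrier G" for i
    using hom_in_carrier[OF power_diff_hom x] .
  ultimately have "?K (power_diff \<phi> (n * Suc q) x) = (\<phi> ^^ n) (?K (power_diff \<phi> (n * q) x)) \<otimes> ?K (power_diff \<phi> n x)"
    using hom_mult[OF power_diff_funpow_hom] by (simp add: funpow_closed power_diff_funpow)
  then show ?case
    using Suc kill hom_one[OF funpow_hom is_group is_group, of n] by simp
qed

text \<open>Elimination for the system \<open>\<Sum>\<^sub>k \<phi>\<^sup>k\<^sup>j b\<^sub>k = 0\<close>, \<open>j = 0, 1, \<dots>\<close>. Subtracting equation \<open>j\<close> from
  equation \<open>j + 1\<close> removes \<open>b\<^sub>0\<close> and multiplies \<open>b\<^sub>k\<close> by \<open>\<phi>\<^sup>k - 1\<close>; cancelling \<open>\<phi>\<^sup>j\<close> leaves a system of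
  the same shape with one unknown less. Each round contributes one operator \<open>\<phi>\<^sup>i - 1\<close> to the relation for
  the last unknown, and \<open>\<phi>\<^sup>m - 1\<close> is a multiple of every one of them.\<close>
theorem vandermonde_elimination:
  assumes inj: "inj_on \<phi> (carrier G)"
    and b: "b \<in> {..d} \<rightarrow> carrier G"
    and rel: "\<And>j. (\<Otimes>k\<in>{..d}. (\<phi> ^^ (k * j)) (b k)) = \<one>"
    and m: "\<And>i. i \<in> {1..d} \<Longrightarrow> i dvd m"
  shows "(power_diff \<phi> m ^^ d) (b d) = \<one>"
  using b rel m
proof (induction d arbitrary: b)
  case 0
  then show ?case by simp
next
  case (Suc d)
  have inj_pow: "inj_on (\<phi> ^^ k) (carrier G)" for k
  proof (induction k)
    case (Suc k)
    then show ?case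
      using inj funpow_closed by (auto simp: inj_on_def)
  qed simp
  \<comment> \<open>the unknowns of the reduced system\<close>
  define c where "c k = power_diff \<phi> (Suc k) (b (Suc k))" for k
  have bk: "b k \<in> carrier G" if "k \<le> Suc d" for k
    using Suc.prems(1) that by auto
  have c: "c \<in> {..d} \<rightarrow> carrier G"
    unfolding c_def using bk hom_in_carrier[OF power_diff_hom] by auto
  have "(\<Otimes>k\<in>{..d}. (\<phi> ^^ (k * j)) (c k)) = \<one>" for j
  proof -
    \<comment> \<open>the \<open>k\<close>-th term of equation \<open>j + 1\<close> minus equation \<open>j\<close>\<close>
    let ?D = "\<lambda>k. (\<phi> ^^ (k * j)) (power_diff \<phi> k (b k))"
    have D: "?D \<in> {..Suc d} \<rightarrow> carrier G"
      using bk hom_in_carrier[OF power_diff_hom] by (auto simp: funpow_closed)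
    have pD: "power_diff \<phi> k (b k) \<in> carrier G" if "k \<le> Suc d" for k
      using bk[OF that] hom_in_carrier[OF power_diff_hom] by auto
    have split: "(\<phi> ^^ (k * Suc j)) (b k) = ?D k \<otimes> (\<phi> ^^ (k * j)) (b k)" if "k \<le> Suc d" for k
    proof -
      have "(\<phi> ^^ (k * Suc j)) (b k) = (\<phi> ^^ (k * j)) ((\<phi> ^^ k) (b k))"
        by (metis add.commute comp_apply funpow_add mult_Suc_right)
      also have "(\<phi> ^^ k) (b k) = power_diff \<phi> k (b k) \<otimes> b k"
        using bk[OF that] by (simp add: power_diff_eq m_assoc funpow_closed)
      finally show ?thesis using bk[OF that] pD[OF that] by (simp add: funpow_mult_hom)
    qed
    have "\<one> = (\<Otimes>k\<in>{..Suc d}. (\<phi> ^^ (k * Suc j)) (b k))"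
      by (rule Suc.prems(2)[symmetric])
    also have "\<dots> = (\<Otimes>k\<in>{..Suc d}. ?D k \<otimes> (\<phi> ^^ (k * j)) (b k))"
      using split bk by (intro finprod_cong' HOL.refl) (auto simp: funpow_closed D[THEN Pi_mem] pD)
    also have "\<dots> = (\<Otimes>k\<in>{..Suc d}. ?D k) \<otimes> (\<Otimes>k\<in>{..Suc d}. (\<phi> ^^ (k * j)) (b k))"
      using D bk by (intro finprod_multf) (auto simp: funpow_closed)
    also have "(\<Otimes>k\<in>{..Suc d}. (\<phi> ^^ (k * j)) (b k)) = \<one>"
      by (rule Suc.prems(2))
    finally have 1: "(\<Otimes>k\<in>{..Suc d}. ?D k) = \<one>"
      using finprod_closed[OF D] by simp
    have "(\<Otimes>k\<in>{..Suc d}. ?D k) = (\<Otimes>k\<in>{..d}. ?D (Suc k)) \<otimes> ?D 0"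
      by (rule finprod_Suc2) (rule D)
    also have "?D 0 = \<one>"
      using bk[of 0] by (simp add: power_diff_eq)
    also have "(\<Otimes>k\<in>{..d}. ?D (Suc k)) = (\<Otimes>k\<in>{..d}. (\<phi> ^^ j) ((\<phi> ^^ (k * j)) (c k)))"
      by (intro finprod_cong' HOL.refl)
        (auto simp: c_def funpow_add funpow_closed pD)
    also have "\<dots> = (\<phi> ^^ j) (\<Otimes>k\<in>{..d}. (\<phi> ^^ (k * j)) (c k))"
      using c by (intro funpow_finprod[symmetric]) (auto intro!: funpow_closed)
    finally have "(\<phi> ^^ j) (\<Otimes>k\<in>{..d}. (\<phi> ^^ (k * j)) (c k)) = \<one>"
      using 1 c by (auto simp: funpow_closed Pi_iff)
    moreover have "(\<phi> ^^ j) \<one> = \<one>"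
      by (rule hom_one[OF funpow_hom is_group is_group])
    moreover have "(\<Otimes>k\<in>{..d}. (\<phi> ^^ (k * j)) (c k)) \<in> carrier G"
      using c by (intro finprod_closed) (auto intro!: funpow_closed)
    ultimately show ?thesis
      using inj_pow[of j] by (metis inj_onD one_closed)
  qed
  then have "(power_diff \<phi> m ^^ d) (c d) = \<one>"
    using Suc.prems(3) by (intro Suc.IH[OF c]) auto
  moreover obtain q where "m = Suc d * q"
    using Suc.prems(3)[of "Suc d"] by (auto elim: dvdE)
  ultimately have "(power_diff \<phi> m ^^ d) (power_diff \<phi> m (b (Suc d))) = \<one>"
    using power_diff_dvd[of "b (Suc d)" d m "Suc d" q] bk by (simp add: c_def)
  then show ?case by (simp only: funpow_Suc_right comp_apply)
qed

end

end

section \<open>The maximal condition\<close>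

context group begin

text \<open>The maximal condition for an arbitrary family of sets: it is needed for all subgroups, for the subgroups
  of a given one, and for the subgroups between two given ones.\<close>
definition max_cond :: "'a set set \<Rightarrow> bool" where
  "max_cond F \<longleftrightarrow> (\<forall>C. C \<noteq> {} \<and> C \<subseteq> F \<longrightarrow> (\<exists>M\<in>C. \<forall>H\<in>C. M \<subseteq> H \<longrightarrow> H = M))"

lemma max_condD:
  assumes "max_cond F" "C \<noteq> {}" "C \<subseteq> F"
  shows "\<exists>M\<in>C. \<forall>H\<in>C. M \<subseteq> H \<longrightarrow> H = M"
  using assms unfolding max_cond_def by simp

lemma max_cond_mono: "max_cond F \<Longrightarrow> F' \<subseteq> F \<Longrightarrow> max_cond F'"
  unfolding max_cond_def by (meson subset_trans)

lemma subgroup_restrict_iff: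
  assumes "subgroup H G"
  shows "subgroup L (G\<lparr>carrier := H\<rparr>) \<longleftrightarrow> subgroup L G \<and> L \<subseteq> H"
  using assms incl_subgroup[of H L] subgroup_incl[of L H] subgroup.subset[of L "G\<lparr>carrier := H\<rparr>"]
  by auto

lemma noetherian_iff_max_cond: "noetherian_group G \<longleftrightarrow> max_cond {H. subgroup H G}"
  unfolding noetherian_group_def max_cond_def by (metis mem_Collect_eq subset_iff)

lemma noetherian_subgroup_iff:
  assumes "subgroup H G"
  shows "noetherian_group (G\<lparr>carrier := H\<rparr>) \<longleftrightarrow> max_cond {L. subgroup L G \<and> L \<subseteq> H}"
proof -
  interpret H: group "G\<lparr>carrier := H\<rparr>" using assms subgroup_imp_group by blast
  show ?thesis
    unfolding H.noetherian_iff_max_cond subgroup_restrict_iff[OF assms]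
      H.max_cond_def max_cond_def ..
qed

lemma noetherian_subgroup:
  assumes "noetherian_group G" "subgroup H G"
  shows "noetherian_group (G\<lparr>carrier := H\<rparr>)"
  unfolding noetherian_subgroup_iff[OF assms(2)]
  by (rule max_cond_mono[of "{L. subgroup L G}"]) (use assms noetherian_iff_max_cond in auto)

lemma noetherian_imp_finitely_generated:
  assumes noeth: "noetherian_group G" and H: "subgroup H G"
  obtains S where "finite S" "S \<subseteq> H" "generate G S = H"
proof -
  interpret H: subgroup H G by fact
  let ?C = "{generate G S | S. finite S \<and> S \<subseteq> H}"
  have C: "?C \<subseteq> {H. subgroup H G}"
    by (intro subsetI CollectI, elim CollectE exE conjE, hypsubst, rule generate_is_subgroup)
      (rule subset_trans[OF _ H.subset])
  have ne: "?C \<noteq> {}" by blast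
  obtain M where M: "M \<in> ?C" "\<forall>L\<in>?C. M \<subseteq> L \<longrightarrow> L = M"
    using max_condD[OF noeth[unfolded noetherian_iff_max_cond] ne C] by (elim bexE)
  then obtain S where S: "M = generate G S" "finite S" "S \<subseteq> H" by blast
  have "h \<in> M" if "h \<in> H" for h
  proof -
    have "generate G (insert h S) \<in> ?C" using S that by blast
    moreover have "M \<subseteq> generate G (insert h S)" unfolding S by (rule mono_generate) auto
    ultimately have "generate G (insert h S) = M" by (rule M(2)[rule_format])
    then show ?thesis using generate.incl[of h "insert h S" G] by auto
  qed
  moreover have "M \<subseteq> H" unfolding S using S H by (intro generate_subgroup_incl) auto
  ultimately show thesis using S that by blast
qed

lemma derived_subset_imp_normalizer:
  assumes "subgroup H G" "subgroup N G" "derived G H \<subseteq> N" "N \<subseteq> H"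
  shows "H \<subseteq> normalizer N"
proof
  fix h assume h: "h \<in> H"
  interpret N: subgroup N G by fact
  interpret H: subgroup H G by fact
  have *: "conjugate g n \<in> N" if "g \<in> H" "n \<in> N" for g n
  proof -
    have "commutator g n \<in> derived G H"
      unfolding derived_def commutator_def using that assms(4) by (auto intro!: generate.incl)
    then show ?thesis
      using that assms(3) by (auto simp: conjugate_eq_commutator)
  qed
  show "h \<in> normalizer N"
    by (rule normalizerI) (use * h N.subset in auto)
qed

text \<open>Induction along a polycyclic series, without constructing one. Going up the derived series from
  \<open>D'\<close> to \<open>D\<close>, take a maximal subgroup \<open>L\<close> between the two for which \<open>\<Phi>\<close> holds. It contains the derived
  subgroup of \<open>D\<close>, so every \<open>t \<in> D\<close> normalises it, and adjoining \<open>t\<close> contradicts maximality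
  unless \<open>t \<in> L\<close>.\<close>
theorem polycyclic_induct [consumes 2, case_names trivial cyclic_extension]:
  assumes solv: "solvable G" and noeth: "noetherian_group G"
    and one: "\<Phi> {\<one>}"
    and step: "\<And>N t. subgroup N G \<Longrightarrow> t \<in> normalizer N \<Longrightarrow> \<Phi> N \<Longrightarrow> \<Phi> (generate G (insert t N))"
  shows "\<Phi> (carrier G)"
proof -
  obtain n where n: "(derived G ^^ n) (carrier G) = {\<one>}"
    using solv solvable_iff_trivial_derived_seq by blast
  have down: "\<Phi> D" if D: "subgroup D G" and D': "\<Phi> (derived G D)" for D
  proof -
    let ?C = "{L. subgroup L G \<and> derived G D \<subseteq> L \<and> L \<subseteq> D \<and> \<Phi> L}"
    have "derived G D \<in> ?C"
      using D D' derived_incl[OF subset_refl D] derived_is_subgroup[OF subgroup.subset[OF D]] by auto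
    then have C: "?C \<noteq> {}" "?C \<subseteq> {H. subgroup H G}" by blast+
    obtain L where L: "L \<in> ?C" "\<forall>K\<in>?C. L \<subseteq> K \<longrightarrow> K = L"
      using max_condD[OF noeth[unfolded noetherian_iff_max_cond] C] by (elim bexE)
    have "t \<in> L" if t: "t \<in> D" for t
    proof -
      have N: "t \<in> normalizer L"
        using derived_subset_imp_normalizer[OF D] L(1) t by blast
      let ?K = "generate G (insert t L)"
      have sub: "insert t L \<subseteq> carrier G" using t L(1) subgroup.subset[OF D] by blast
      have "subgroup ?K G" by (rule generate_is_subgroup[OF sub])
      moreover have "?K \<subseteq> D" using generate_subgroup_incl[OF _ D] t L(1) by blast
      moreover have LK: "L \<subseteq> ?K" by (auto intro: generate.incl)
      moreover have "\<Phi> ?K" by (rule step) (use L(1) N in auto)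
      ultimately have "?K \<in> ?C" using L(1) by blast
      then have "?K = L" using LK by (rule L(2)[rule_format])
      then show ?thesis using generate.incl[of t "insert t L" G] by auto
    qed
    with L(1) show ?thesis by (metis (mono_tags, lifting) mem_Collect_eq subset_antisym subsetI)
  qed
  have "\<Phi> ((derived G ^^ i) (carrier G)) \<Longrightarrow> \<Phi> (carrier G)" for i
  proof (induction i)
    case (Suc i)
    then show ?case using down[OF exp_of_derived_is_subgroup[OF subgroup_self, of i]] by simp
  qed simp
  with n one show ?thesis by metis
qed

section \<open>Cyclic extensions and subgroups of finite index\<close>

text \<open>Powers of \<open>t\<close> can be collected on the left, since \<open>t\<close> normalises \<open>N\<close>.\<close>
lemma generate_insert_normalizer:
  assumes N: "subgroup N G" and t: "t \<in> normalizer N" and h: "h \<in> generate G (insert t N)"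
  obtains j :: int and x where "x \<in> N" "h = t [^] j \<otimes> x"
proof -
  interpret N: subgroup N G by fact
  have tc: "t \<in> carrier G" using t normalizer_subset by auto
  have tj: "t [^] (j::int) \<in> normalizer N" for j
    using subgroup_normalizer subgroup_int_pow_closed t by blast
  have move: "\<exists>x'\<in>N. x \<otimes> t [^] j = t [^] j \<otimes> x'" if "x \<in> N" for x and j :: int
  proof
    show "conjugate (t [^] (-j)) x \<in> N" using that normalizerD[OF tj] by auto
    show "x \<otimes> t [^] j = t [^] j \<otimes> conjugate (t [^] (-j)) x"
      using that tc by (simp add: conjugate_def int_pow_neg m_assoc)
  qed
  have "\<exists>(j::int) x. x \<in> N \<and> h = t [^] j \<otimes> x"
    using h
  proof induction
    case one
    show ?case by (intro exI[of _ 0] exI[of _ \<one>]) auto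
  next
    case (incl h)
    then consider "h = t" | "h \<in> N" by blast
    then show ?case
    proof cases
      case 1
      then show ?thesis using tc by (intro exI[of _ 1] exI[of _ \<one>]) auto
    next
      case 2
      then show ?thesis by (intro exI[of _ 0] exI[of _ h]) auto
    qed
  next
    case (inv h)
    then consider "h = t" | "h \<in> N" by blast
    then show ?case
    proof cases
      case 1
      then show ?thesis using tc by (intro exI[of _ "-1"] exI[of _ \<one>]) (auto simp: int_pow_neg)
    next
      case 2
      then show ?thesis by (intro exI[of _ 0] exI[of _ "inv h"]) auto
    qed
  next
    case (eng g h)
    then obtain i j x y where g: "x \<in> N" "g = t [^] (i::int) \<otimes> x"
      and h: "y \<in> N" "h = t [^] (j::int) \<otimes> y" by blast
    obtain x' where x': "x' \<in> N" "x \<otimes> t [^] j = t [^] j \<otimes> x'" using move[OF g(1)] by blast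
    have "g \<otimes> h = t [^] i \<otimes> (x \<otimes> t [^] j) \<otimes> y" using g h tc by (simp add: m_assoc)
    also have "\<dots> = t [^] (i + j) \<otimes> (x' \<otimes> y)" using x' h tc by (simp add: m_assoc int_pow_mult)
    finally show ?case using x' h by blast
  qed
  then show thesis using that by blast
qed

text \<open>For \<open>B \<le> H\<close> this says that \<open>B\<close> has finite index in \<open>H\<close>. In general it counts the cosets of \<open>B\<close> that
  meet \<open>H\<close>, and in this form it passes to larger \<open>B\<close>.\<close>
definition finite_index_in :: "'a set \<Rightarrow> 'a set \<Rightarrow> bool" where
  "finite_index_in B H \<longleftrightarrow> finite ((\<lambda>h. B #> h) ` H)"

lemma finite_index_in_carrier: "finite_index_in B (carrier G) \<longleftrightarrow> finite (rcosets B)"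
proof -
  have "rcosets B = (\<lambda>h. B #> h) ` carrier G" by (auto simp: RCOSETS_def)
  then show ?thesis by (simp add: finite_index_in_def)
qed

lemma finite_index_in_mono:
  assumes "finite_index_in B H" "subgroup B G" "subgroup B' G" "B \<subseteq> B'" "H \<subseteq> carrier G"
  shows "finite_index_in B' H"
proof -
  interpret B': subgroup B' G by fact
  have "B' #> h = B' <#> (B #> h)" if "h \<in> H" for h
  proof -
    have "B' <#> B = B'"
      using set_mult_subgroup_idem[OF assms(3)] assms(2-4) subgroup_restrict_iff by blast
    moreover have "B' <#> (B #> h) = (B' <#> B) #> h"
      using that assms B'.subset subgroup.subset by (intro setmult_rcos_assoc) blast+
    ultimately show ?thesis by simp
  qed
  then have "(\<lambda>h. B' #> h) ` H = (\<lambda>C. B' <#> C) ` ((\<lambda>h. B #> h) ` H)"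
    by (simp add: image_image cong: image_cong_simp)
  then show ?thesis using assms(1) by (simp add: finite_index_in_def)
qed

lemma r_coset_eq_iff:
  assumes "subgroup B G" "x \<in> carrier G" "y \<in> carrier G"
  shows "B #> x = B #> y \<longleftrightarrow> x \<otimes> inv y \<in> B"
proof -
  interpret subgroup B G by fact
  have "x \<otimes> inv y \<in> B \<longleftrightarrow> x \<in> B #> y"
    using rcos_module[OF is_group assms(3,2)] ..
  also have "\<dots> \<longleftrightarrow> B #> x = B #> y"
    using assms repr_independence rcos_self by metis
  finally show ?thesis ..
qed

text \<open>An element of the extension is \<open>t\<^sup>j x\<close> with \<open>x \<in> N\<close>, and \<open>j\<close> only matters modulo \<open>k\<close> because
  \<open>t\<^sup>k \<in> B\<close>. Since \<open>t\<close> normalises \<open>B\<close>, the coset of \<open>t\<^sup>r x\<close> is the translate by \<open>t\<^sup>r\<close> of the coset of \<open>x\<close>;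
  so there are at most \<open>k\<close> times as many cosets as before.\<close>
lemma finite_index_cyclic_extension:
  assumes N: "subgroup N G" and t: "t \<in> normalizer N"
    and B: "subgroup B G" "t \<in> normalizer B" "t [^] k \<in> B" "0 < (k::nat)"
    and fin: "finite_index_in B N"
  shows "finite_index_in B (generate G (insert t N))"
proof -
  interpret N: subgroup N G by fact
  interpret B: subgroup B G by fact
  have tc: "t \<in> carrier G" using t normalizer_subset by auto
  \<comment> \<open>left translation of a coset by a power of \<open>t\<close>\<close>
  define F where "F = (\<lambda>(r::int, C). (\<lambda>x. t [^] r \<otimes> x) ` C)"
  have "B #> h \<in> F ` ({0..<int k} \<times> (\<lambda>h. B #> h) ` N)" if h: "h \<in> generate G (insert t N)" for h
  proof -
    obtain j x where jx: "x \<in> N" "h = t [^] (j::int) \<otimes> x"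
      using generate_insert_normalizer[OF N t h] .
    define r where "r = j mod int k"
    have rB: "t [^] r \<in> normalizer B"
      using subgroup_normalizer subgroup_int_pow_closed B(2) by blast
    have "j = int k * (j div int k) + r" by (simp add: r_def)
    then have "t [^] j = t [^] (int k * (j div int k)) \<otimes> t [^] r"
      using tc int_pow_mult by metis
    also have "t [^] (int k * (j div int k)) = (t [^] k) [^] (j div int k)"
      using tc int_pow_pow[of t "int k"] by (simp add: int_pow_int)
    finally have tj: "t [^] j = (t [^] k) [^] (j div int k) \<otimes> t [^] r" .
    have q: "(t [^] k) [^] (j div int k) \<in> B"
      by (rule subgroup_int_pow_closed[OF B(1,3)])
    have "B #> h = B #> (t [^] r \<otimes> x)"
      using q jx tc by (subst r_coset_eq_iff[OF B(1)]) (simp_all add: tj m_assoc inv_mult_group)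
    also have "\<dots> = (\<lambda>y. t [^] r \<otimes> y) ` (B #> x)"
    proof (intro Set.set_eqI iffI)
      fix z assume "z \<in> B #> (t [^] r \<otimes> x)"
      then obtain b where b: "b \<in> B" "z = b \<otimes> (t [^] r \<otimes> x)" by (auto simp: r_coset_def)
      let ?b = "conjugate (inv (t [^] r)) b"
      have "?b \<in> B" using b normalizerD[OF rB, of ?b] tc by auto
      moreover have "z = t [^] r \<otimes> (?b \<otimes> x)"
        using b jx tc by (simp add: conjugate_def m_assoc)
      ultimately show "z \<in> (\<lambda>y. t [^] r \<otimes> y) ` (B #> x)" by (auto simp: r_coset_def)
    next
      fix z assume "z \<in> (\<lambda>y. t [^] r \<otimes> y) ` (B #> x)"
      then obtain b where b: "b \<in> B" "z = t [^] r \<otimes> (b \<otimes> x)" by (auto simp: r_coset_def)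
      then have "conjugate (t [^] r) b \<in> B" using normalizerD[OF rB, of b] by auto
      moreover have "z = conjugate (t [^] r) b \<otimes> (t [^] r \<otimes> x)"
        using b jx tc by (simp add: conjugate_def m_assoc)
      ultimately show "z \<in> B #> (t [^] r \<otimes> x)" by (auto simp: r_coset_def)
    qed
    also have "\<dots> = F (r, B #> x)" by (simp add: F_def)
    finally show ?thesis using jx B(4) by (auto simp: r_def)
  qed
  then have "(\<lambda>h. B #> h) ` generate G (insert t N) \<subseteq> F ` ({0..<int k} \<times> (\<lambda>h. B #> h) ` N)"
    by blast
  then show ?thesis
    unfolding finite_index_in_def
    by (rule finite_subset) (use fin in \<open>auto simp: finite_index_in_def\<close>)
qed

text \<open>A soluble Noetherian torsion group is finite, here stated for the quotient by \<open>Q\<close>: along a polycyclic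
  series each step adds finitely many cosets.\<close>
lemma torsion_quotient_finite:
  assumes "solvable G" "noetherian_group G" and Q: "Q \<lhd> G"
    and tors: "\<And>g. g \<in> carrier G \<Longrightarrow> \<exists>k>0. g [^] (k::nat) \<in> Q"
  shows "finite (rcosets Q)"
proof -
  interpret Q: normal Q G by fact
  have QG: "normalizer Q = carrier G"
  proof -
    have "subgroup Q G" ..
    then have "carrier G \<subseteq> normalizer Q"
      using normal_iff_normalizer[of Q "carrier G"] subgroup_self Q Q.subset by auto
    then show ?thesis using normalizer_subset by auto
  qed
  have "finite_index_in Q (carrier G)"
    using assms(1,2)
  proof (induction rule: polycyclic_induct)
    case trivial
    then show ?case by (simp add: finite_index_in_def)
  next
    case (cyclic_extension N t)
    then have tc: "t \<in> carrier G" using normalizer_subset by auto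
    then obtain k where "k > 0" "t [^] (k::nat) \<in> Q" using tors by blast
    with cyclic_extension tc show ?case
      by (intro finite_index_cyclic_extension[of N t Q k]) (auto simp: QG Q.is_subgroup)
  qed
  then show ?thesis by (simp add: finite_index_in_carrier)
qed

text \<open>With \<open>c\<close> cosets, two of \<open>1, h, \<dots>, h\<^sup>c\<close> share a coset, so \<open>h\<^sup>e \<in> B\<close> for some \<open>1 \<le> e \<le> c\<close>.
  The exponent \<open>c!\<close> therefore works for all \<open>h\<close> at once.\<close>
lemma finite_index_imp_power:
  assumes B: "subgroup B G" and H: "subgroup H G" and fin: "finite_index_in B H"
  obtains k :: nat where "k > 0" "\<And>h. h \<in> H \<Longrightarrow> h [^] k \<in> B"
proof
  interpret B: subgroup B G by fact
  interpret H: subgroup H G by fact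
  define c where "c = card ((\<lambda>h. B #> h) ` H)"
  show "fact c > (0::nat)" by simp
  fix h assume h: "h \<in> H"
  then have hc: "h \<in> carrier G" using H.subset by blast
  have hp: "h [^] (i::nat) \<in> H" for i by (induction i) (use h in auto)
  have "\<not> inj_on (\<lambda>i::nat. B #> h [^] i) {0..c}"
  proof
    assume "inj_on (\<lambda>i::nat. B #> h [^] i) {0..c}"
    then have "card {0..c} \<le> card ((\<lambda>h. B #> h) ` H)"
      by (rule card_inj_on_le) (use hp fin in \<open>auto simp: finite_index_in_def\<close>)
    then show False by (simp add: c_def)
  qed
  then obtain i j where ij: "i < j" "j \<le> c" "B #> h [^] i = B #> h [^] j"
    unfolding inj_on_def by (metis atLeastAtMost_iff nat_neq_iff)
  define e where "e = j - i"
  have "h [^] j = h [^] e \<otimes> h [^] i"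
    using hc ij(1) by (simp add: e_def nat_pow_mult)
  moreover have "h [^] j \<otimes> inv (h [^] i) \<in> B"
    using r_coset_eq_iff[OF B, of "h [^] j" "h [^] i"] ij(3) hc by auto
  ultimately have e: "h [^] e \<in> B" using hc by (simp add: m_assoc)
  have "e dvd fact c" using ij by (intro dvd_fact) (auto simp: e_def)
  then obtain q where "fact c = e * q" by (auto elim: dvdE)
  then have "h [^] (fact c :: nat) = (h [^] e) [^] q" using hc by (simp add: nat_pow_pow)
  moreover have "(h [^] e) [^] q \<in> B" by (induction q) (use e in auto)
  ultimately show "h [^] (fact c :: nat) \<in> B" by simp
qed

text \<open>A substitute for a subgroup \<open>B\<close> of finite index in \<open>H\<close>: for suitable \<open>k > 0\<close> it is contained in \<open>B\<close>,
  it is invariant under everything that normalises \<open>H\<close>, and in a soluble Noetherian group its index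
  in \<open>H\<close> is still finite.\<close>
definition power_subgroup :: "nat \<Rightarrow> 'a set \<Rightarrow> 'a set" where
  "power_subgroup k H = generate G ((\<lambda>h. h [^] k) ` H)"

lemma power_subgroup_properties:
  assumes solv: "solvable G" and noeth: "noetherian_group G"
    and H: "subgroup H G" and k: "k > 0"
  shows subgroup_power_subgroup: "subgroup (power_subgroup k H) G"
    and power_subgroup_subset: "power_subgroup k H \<subseteq> H"
    and normalizer_power_subgroup: "normalizer H \<subseteq> normalizer (power_subgroup k H)"
    and finite_index_power_subgroup: "finite_index_in (power_subgroup k H) H"
proof -
  interpret H: subgroup H G by fact
  let ?S = "(\<lambda>h. h [^] k) ` H" and ?Q = "power_subgroup k H"
  have pow: "h [^] k \<in> H" if "h \<in> H" for h by (induction k) (use that in auto)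
  have S: "?S \<subseteq> H" "?S \<subseteq> carrier G" using pow H.subset by auto
  show Q: "subgroup ?Q G" unfolding power_subgroup_def by (rule generate_is_subgroup[OF S(2)])
  show QH: "?Q \<subseteq> H"
    unfolding power_subgroup_def by (rule generate_subgroup_incl[OF S(1) H])
  show nn: "normalizer H \<subseteq> normalizer ?Q"
  proof
    fix t assume t: "t \<in> normalizer H"
    then have t': "inv t \<in> normalizer H" using subgroup.m_inv_closed[OF subgroup_normalizer] by blast
    have tc: "t \<in> carrier G" using t normalizer_subset by auto
    have "conjugate g x \<in> generate G ?S" if "g \<in> normalizer H" "x \<in> ?S" for g x
    proof -
      have gc: "g \<in> carrier G" using that normalizer_subset by auto
      from that obtain h where h: "h \<in> H" "x = h [^] k" by blast
      then have "conjugate g x = (conjugate g h) [^] k" using gc by (simp add: conjugate_nat_pow)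
      moreover have "conjugate g h \<in> H" using normalizerD[OF that(1)] h by auto
      ultimately show ?thesis by (auto intro: generate.incl)
    qed
    then show "t \<in> normalizer ?Q"
      unfolding power_subgroup_def using t t' tc by (intro generate_normalizer[OF S(2)]) auto
  qed
  show "finite_index_in ?Q H"
  proof -
    interpret K: group "G\<lparr>carrier := H\<rparr>" by (rule subgroup_imp_group[OF H])
    have "H \<subseteq> normalizer ?Q" using subgroup_le_normalizer[OF H] nn by blast
    then have "?Q \<lhd> G\<lparr>carrier := H\<rparr>" using normal_iff_normalizer[OF Q H QH] by blast
    moreover have "solvable (G\<lparr>carrier := H\<rparr>)"
    proof -
      have inc: "group_hom (G\<lparr>carrier := H\<rparr>) G id"
        using H canonical_inj_is_hom by blast
      show ?thesis by (rule group_hom.inj_hom_imp_solvable[OF inc _ solv]) auto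
    qed
    moreover have "noetherian_group (G\<lparr>carrier := H\<rparr>)" by (rule noetherian_subgroup[OF noeth H])
    moreover have "\<exists>k>0. g [^]\<^bsub>G\<lparr>carrier := H\<rparr>\<^esub> (k::nat) \<in> ?Q" if "g \<in> carrier (G\<lparr>carrier := H\<rparr>)" for g
      using that k by (auto intro!: exI[of _ k] generate.incl simp: power_subgroup_def simp flip: nat_pow_consistent)
    ultimately have "finite (rcosets\<^bsub>G\<lparr>carrier := H\<rparr>\<^esub> ?Q)" by (intro K.torsion_quotient_finite) auto
    moreover have "rcosets\<^bsub>G\<lparr>carrier := H\<rparr>\<^esub> ?Q = (\<lambda>h. ?Q #> h) ` H"
      by (auto simp: RCOSETS_def)
    ultimately show ?thesis by (simp add: finite_index_in_def)
  qed
qed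

end

section \<open>Nilpotent subgroups\<close>

context group begin

lemma lower_central_Suc_subgroup:
  assumes K: "subgroup K G" and sub: "lower_central (G\<lparr>carrier := K\<rparr>) i \<subseteq> K"
  shows "lower_central (G\<lparr>carrier := K\<rparr>) (Suc i) =
    generate G {commutator x y | x y. x \<in> lower_central (G\<lparr>carrier := K\<rparr>) i \<and> y \<in> K}"
    (is "_ = generate G ?S")
proof -
  interpret K: subgroup K G by fact
  have "{x \<otimes> y \<otimes> inv\<^bsub>G\<lparr>carrier := K\<rparr>\<^esub> x \<otimes> inv\<^bsub>G\<lparr>carrier := K\<rparr>\<^esub> y | x y.
      x \<in> lower_central (G\<lparr>carrier := K\<rparr>) i \<and> y \<in> K} = ?S"
    by (rule Collect_cong, intro ex_cong1)
      (use sub m_inv_consistent[OF K] in \<open>auto simp: commutator_def subset_iff\<close>)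
  moreover have "?S \<subseteq> K" using sub by (auto simp: commutator_def)
  ultimately show ?thesis using generate_consistent[OF _ K, of ?S] by simp
qed

lemma lower_central_subgroup:
  assumes K: "subgroup K G"
  shows "subgroup (lower_central (G\<lparr>carrier := K\<rparr>) i) G \<and> lower_central (G\<lparr>carrier := K\<rparr>) i \<subseteq> K"
proof (induction i)
  case (Suc i)
  interpret K: subgroup K G by fact
  let ?S = "{commutator x y | x y. x \<in> lower_central (G\<lparr>carrier := K\<rparr>) i \<and> y \<in> K}"
  have S: "?S \<subseteq> K" using Suc by (auto simp: commutator_def)
  then show ?case
    unfolding lower_central_Suc_subgroup[OF K conjunct2[OF Suc]]
    using generate_is_subgroup[of ?S] generate_subgroup_incl[OF S K] K.subset by blast
qed (use K in auto)

lemma commutator_in_lower_central: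
  assumes K: "subgroup K G" and "x \<in> lower_central (G\<lparr>carrier := K\<rparr>) i" "y \<in> K"
  shows "commutator x y \<in> lower_central (G\<lparr>carrier := K\<rparr>) (Suc i)"
  unfolding lower_central_Suc_subgroup[OF K conjunct2[OF lower_central_subgroup[OF K]]]
  using assms by (auto intro!: generate.incl)

lemma normalizer_lower_central:
  assumes K: "subgroup K G" and t: "t \<in> normalizer K"
  shows "t \<in> normalizer (lower_central (G\<lparr>carrier := K\<rparr>) i)"
proof (induction i)
  case 0
  show ?case using t by simp
next
  case (Suc i)
  interpret K: subgroup K G by fact
  let ?L = "lower_central (G\<lparr>carrier := K\<rparr>) i"
  let ?S = "{commutator x y | x y. x \<in> ?L \<and> y \<in> K}"
  have L: "?L \<subseteq> K" using lower_central_subgroup[OF K] by blast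
  then have S: "?S \<subseteq> carrier G" by auto
  have "conjugate g s \<in> generate G ?S"
    if g: "g \<in> normalizer K" "g \<in> normalizer ?L" and s: "s \<in> ?S" for g s
  proof -
    obtain x y where xy: "x \<in> ?L" "y \<in> K" "s = commutator x y" using s by blast
    moreover have "g \<in> carrier G" using g normalizer_subset by auto
    ultimately have "conjugate g s = commutator (conjugate g x) (conjugate g y)"
      using L by (auto simp: conjugate_commutator)
    moreover have "conjugate g x \<in> ?L" "conjugate g y \<in> K"
      using xy L normalizerD[OF g(1), of y] normalizerD[OF g(2), of x] by auto
    ultimately show ?thesis by (auto intro!: generate.incl)
  qed
  moreover have "t \<in> carrier G" using t normalizer_subset by auto
  moreover have "inv t \<in> normalizer K" "inv t \<in> normalizer ?L"
    using t Suc subgroup.m_inv_closed[OF subgroup_normalizer] by blast+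
  ultimately show ?case
    unfolding lower_central_Suc_subgroup[OF K L] using t Suc
    by (intro generate_normalizer[OF S]) blast+
qed

lemma lower_central_decreasing:
  assumes K: "subgroup K G"
  shows "lower_central (G\<lparr>carrier := K\<rparr>) (Suc i) \<subseteq> lower_central (G\<lparr>carrier := K\<rparr>) i"
proof -
  let ?L = "lower_central (G\<lparr>carrier := K\<rparr>) i"
  have L: "subgroup ?L G" "?L \<subseteq> K" using lower_central_subgroup[OF K] by blast+
  interpret K: subgroup K G by (rule K)
  interpret L: subgroup ?L G by (rule L)
  have "commutator x y \<in> ?L" if xy: "x \<in> ?L" "y \<in> K" for x y
  proof -
    have "y \<in> normalizer K" using subgroup_le_normalizer[OF K] xy(2) by blast
    then have "y \<in> normalizer ?L" by (rule normalizer_lower_central[OF K])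
    then have "conjugate y (inv x) \<in> ?L" using xy normalizerD[of y ?L "inv x"] by simp
    moreover have "commutator x y = x \<otimes> conjugate y (inv x)"
      using xy by (simp add: commutator_def conjugate_def m_assoc)
    ultimately show ?thesis using xy by simp
  qed
  then show ?thesis
    unfolding lower_central_Suc_subgroup[OF K L(2)]
    by (intro generate_subgroup_incl[OF _ L(1)]) blast
qed

text \<open>\<open>Z\<close> descends to the trivial subgroup in finitely many steps, each absorbing the commutators with \<open>K\<close>;
  in a group \<open>K\<close> with \<open>Z \<le> K\<close> this means that \<open>Z\<close> lies in a term of the upper central series. It suits
  the proofs better than the lower central series, as any descending chain may serve as witness.\<close>
inductive hypercentral :: "'a set \<Rightarrow> 'a set \<Rightarrow> bool" for K where
  trivial: "hypercentral K {\<one>}"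
| step: "hypercentral K Z' \<Longrightarrow> subgroup Z' G \<Longrightarrow>
    (\<And>z k. z \<in> Z \<Longrightarrow> k \<in> K \<Longrightarrow> commutator z k \<in> Z') \<Longrightarrow> hypercentral K Z"

lemma hypercentral_subset_left: "hypercentral K Z \<Longrightarrow> M \<subseteq> K \<Longrightarrow> hypercentral M Z"
  by (induction rule: hypercentral.induct) (blast intro: hypercentral.intros)+

lemma hypercentral_subset_right:
  assumes "hypercentral K Z" "K \<subseteq> carrier G" "Y \<subseteq> Z" "Y \<noteq> {}"
  shows "hypercentral K Y"
  using assms(1)
proof cases
  case trivial
  with assms show ?thesis using hypercentral.trivial by (metis subset_singletonD)
next
  case (step Z')
  with assms show ?thesis by (blast intro: hypercentral.step)
qed

lemma hypercentral_lower_central: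
  assumes K: "subgroup K G"
  shows "lower_central (G\<lparr>carrier := K\<rparr>) c = {\<one>} \<Longrightarrow> hypercentral K (lower_central (G\<lparr>carrier := K\<rparr>) (c - i))"
proof (induction i)
  case (Suc i)
  show ?case
  proof (cases "c - Suc i = c - i")
    case False
    then have "c - i = Suc (c - Suc i)" by simp
    then show ?thesis
      using Suc lower_central_subgroup[OF K] commutator_in_lower_central[OF K]
      by (metis hypercentral.step)
  qed (use Suc in simp)
qed (simp add: hypercentral.trivial)

lemma lower_central_le_hypercentral:
  assumes K: "subgroup K G" and "hypercentral K Z"
  shows "lower_central (G\<lparr>carrier := K\<rparr>) i \<subseteq> Z \<Longrightarrow> \<exists>c. lower_central (G\<lparr>carrier := K\<rparr>) c = {\<one>}"
  using assms(2)
proof (induction arbitrary: i)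
  case trivial
  then show ?case using subgroup.one_closed lower_central_subgroup[OF K] by blast
next
  case (step Z' Z)
  let ?L = "lower_central (G\<lparr>carrier := K\<rparr>) i"
  have L: "?L \<subseteq> K" using lower_central_subgroup[OF K] by blast
  have "lower_central (G\<lparr>carrier := K\<rparr>) (Suc i) \<subseteq> Z'"
    unfolding lower_central_Suc_subgroup[OF K L]
    by (rule generate_subgroup_incl[OF _ step(2)]) (use step in blast)
  then show ?case by (rule step.IH)
qed

text \<open>The lower central series is the fastest descending central chain.\<close>
theorem nilpotent_iff_hypercentral:
  assumes K: "subgroup K G"
  shows "nilpotent_group (G\<lparr>carrier := K\<rparr>) \<longleftrightarrow> hypercentral K K"
proof
  assume "nilpotent_group (G\<lparr>carrier := K\<rparr>)"
  then obtain c where "lower_central (G\<lparr>carrier := K\<rparr>) c = {\<one>}"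
    by (auto simp: nilpotent_group_def)
  then show "hypercentral K K" using hypercentral_lower_central[OF K, of c c] by simp
next
  assume "hypercentral K K"
  then show "nilpotent_group (G\<lparr>carrier := K\<rparr>)"
    using lower_central_le_hypercentral[OF K, of K 0] by (auto simp: nilpotent_group_def)
qed

section \<open>Unipotent action on an abelian section\<close>

context
  fixes t U V
  assumes U: "subgroup U G" and V: "subgroup V G" and VU: "V \<subseteq> U"
    and abelian: "\<And>x y. x \<in> U \<Longrightarrow> y \<in> U \<Longrightarrow> commutator x y \<in> V"
    and tU: "t \<in> normalizer U" and tV: "t \<in> normalizer V"
begin

interpretation U: subgroup U G by (rule U)
interpretation V: subgroup V G by (rule V)

lemma t_closed: "t \<in> carrier G"
  using tU normalizer_subset by auto

text \<open>On the abelian section \<open>U/V\<close> the map \<open>u \<mapsto> [t, u]\<close> is the operator \<open>\<phi> - 1\<close> for \<open>\<phi>\<close> conjugation by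
  \<open>t\<close>; this is the preimage in \<open>U\<close> of the kernel of its \<open>l\<close>-th power.\<close>
definition unipotent_part :: "nat \<Rightarrow> 'a set" where
  "unipotent_part l = {u \<in> U. (commutator t ^^ l) u \<in> V}"

lemma commutator_in_U: "u \<in> U \<Longrightarrow> commutator t u \<in> U"
  using normalizerD[OF tU, of u] t_closed by (auto simp: commutator_eq_conjugate)

lemma commutator_in_V: "v \<in> V \<Longrightarrow> commutator t v \<in> V"
  using normalizerD[OF tV, of v] t_closed by (auto simp: commutator_eq_conjugate)

lemma unipotent_part_0: "unipotent_part 0 = V"
  using VU by (auto simp: unipotent_part_def)

lemma unipotent_part_Suc: "unipotent_part (Suc l) = {u \<in> U. commutator t u \<in> unipotent_part l}"
  using commutator_in_U by (auto simp: unipotent_part_def funpow_swap1)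

lemma unipotent_part_mono: "unipotent_part l \<subseteq> unipotent_part (Suc l)"
  using commutator_in_V by (auto simp: unipotent_part_def)

lemma V_subset_unipotent_part: "V \<subseteq> unipotent_part l"
  by (induction l) (use unipotent_part_0 unipotent_part_mono in blast)+

lemma subgroup_unipotent_part: "subgroup (unipotent_part l) G"
proof (induction l)
  case (Suc l)
  then interpret W: subgroup "unipotent_part l" G .
  let ?W = "unipotent_part l"
  have conj: "conjugate x w \<in> ?W" if "x \<in> U" "w \<in> ?W" for x w
  proof -
    have w: "w \<in> U" using that by (auto simp: unipotent_part_def)
    then have "commutator x w \<in> ?W" using abelian that V_subset_unipotent_part by blast
    then show ?thesis using that w by (simp add: conjugate_eq_commutator)
  qed
  show ?case
    unfolding unipotent_part_Suc
  proof (rule subgroupI)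
    show "{u \<in> U. commutator t u \<in> ?W} \<noteq> {}" using t_closed by (intro ex_in_conv[THEN iffD1] exI[of _ \<one>]) auto
  next
    fix x assume "x \<in> {u \<in> U. commutator t u \<in> ?W}"
    then show "inv x \<in> {u \<in> U. commutator t u \<in> ?W}"
      using t_closed conj[of "inv x" "inv (commutator t x)"] by (simp add: commutator_inv_right)
  next
    fix x y assume "x \<in> {u \<in> U. commutator t u \<in> ?W}" "y \<in> {u \<in> U. commutator t u \<in> ?W}"
    then show "x \<otimes> y \<in> {u \<in> U. commutator t u \<in> ?W}"
      using t_closed conj[of x "commutator t y"] by (simp add: commutator_mult_right)
  qed auto
qed (use unipotent_part_0 V in simp)

text \<open>Let \<open>M\<close> act trivially on \<open>U/V\<close>. Commutators with \<open>t\<close> lead from each unipotent part into the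
  previous one and commutators with \<open>M\<close> lead into \<open>V\<close>, so the unipotent parts continue the chain below \<open>V\<close>
  upwards.\<close>
lemma hypercentral_unipotent_part:
  fixes M defines "K \<equiv> generate G (insert t M)"
  assumes M: "M \<subseteq> carrier G" and UM: "\<And>u m. u \<in> U \<Longrightarrow> m \<in> M \<Longrightarrow> commutator u m \<in> V"
    and KV: "K \<subseteq> normalizer V" and hyp: "hypercentral K V"
  shows "hypercentral K (unipotent_part l) \<and> K \<subseteq> normalizer (unipotent_part l)"
proof (induction l)
  case 0
  then show ?case using unipotent_part_0 KV hyp by simp
next
  case (Suc l)
  interpret W: subgroup "unipotent_part l" G by (rule subgroup_unipotent_part)
  interpret W': subgroup "unipotent_part (Suc l)" G by (rule subgroup_unipotent_part)
  have gen: "insert t M \<subseteq> carrier G" using M t_closed by auto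
  have K: "subgroup K G" unfolding K_def by (rule generate_is_subgroup[OF gen])
  then interpret K: subgroup K G .
  have WU: "z \<in> U" if "z \<in> unipotent_part (Suc l)" for z
    using that by (simp add: unipotent_part_def)
  have comm: "commutator z k \<in> unipotent_part l" if z: "z \<in> unipotent_part (Suc l)" and k: "k \<in> K" for z k
  proof (rule commutator_generate[OF W.is_subgroup gen _ _ _ k[unfolded K_def]])
    show "generate G (insert t M) \<subseteq> normalizer (unipotent_part l)" using Suc K_def by simp
    show "z \<in> carrier G" using z W'.subset by blast
    fix s assume "s \<in> insert t M"
    then consider "s = t" | "s \<in> M" by blast
    then show "commutator z s \<in> unipotent_part l"
    proof cases
      case 1
      have "commutator t z \<in> unipotent_part l" using z unipotent_part_Suc by blast
      then have "inv (commutator t z) \<in> unipotent_part l" by blast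
      then show ?thesis using 1 z t_closed by (simp add: inv_commutator)
    next
      case 2
      then show ?thesis using UM WU[OF z] V_subset_unipotent_part by blast
    qed
  qed
  then have hyp: "hypercentral K (unipotent_part (Suc l))"
    using Suc hypercentral.step[of K "unipotent_part l"] W.is_subgroup by blast
  have conj: "conjugate k z \<in> unipotent_part (Suc l)" if "k \<in> K" "z \<in> unipotent_part (Suc l)" for k z
  proof -
    have kz: "k \<in> carrier G" "z \<in> carrier G" using that K.subset W'.subset by blast+
    have "inv (commutator z k) \<in> unipotent_part (Suc l)"
      using comm[OF that(2,1)] unipotent_part_mono by blast
    then show ?thesis using kz that by (simp add: conjugate_eq_commutator inv_commutator)
  qed
  have "K \<subseteq> normalizer (unipotent_part (Suc l))"
  proof
    fix k assume k: "k \<in> K"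
    show "k \<in> normalizer (unipotent_part (Suc l))"
      by (rule normalizerI) (use k conj W'.subset in auto)
  qed
  with hyp show ?case by blast
qed

end

end

section \<open>Uniformly recurrent conjugates\<close>

context group begin

text \<open>The function \<open>s \<mapsto> s\<^sup>k a s\<^sup>-\<^sup>k\<close>. It is recorded as a function on all of \<open>G\<close> because the next
  definition asks for relations that hold for all \<open>s\<close> at once.\<close>
definition conj_fun :: "'a \<Rightarrow> nat \<Rightarrow> 'a \<Rightarrow> 'a" where
  "conj_fun a k = (\<lambda>s\<in>carrier G. conjugate (s [^] k) a)"

definition conj_recurrent :: "'a \<Rightarrow> bool" where
  "conj_recurrent a \<longleftrightarrow>
     (\<exists>d. conj_fun a d \<in> generate (product_group (carrier G) (\<lambda>_. G)) (conj_fun a ` {..<d}))"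

text \<open>Evaluate the relation between the functions \<open>s \<mapsto> s\<^sup>k a s\<^sup>-\<^sup>k\<close> at \<open>s = t\<^sup>j\<close> and reduce modulo \<open>V\<close>. In the
  abelian group \<open>A = U/V\<close>, with \<open>\<psi>\<close> induced by conjugation by \<open>t\<close>, it becomes a system to which
  \<open>vandermonde_elimination\<close> applies: for every \<open>g\<close> in the subgroup generated by the first \<open>d\<close> functions there
  are \<open>b\<^sub>0, \<dots>, b\<^sub>d\<^sub>-\<^sub>1 \<in> A\<close> with \<open>g (t\<^sup>j) = \<Sum>\<^sub>k \<psi>\<^sup>k\<^sup>j b\<^sub>k\<close> modulo \<open>V\<close> for all \<open>j\<close>. This property is
  closed under products, which spares the bookkeeping of exponents.\<close>
lemma unipotent_of_recurrent:
  assumes U: "subgroup U G" and V: "subgroup V G" and VU: "V \<subseteq> U"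
    and abelian: "\<And>x y. x \<in> U \<Longrightarrow> y \<in> U \<Longrightarrow> commutator x y \<in> V"
    and tU: "t \<in> normalizer U" and tV: "t \<in> normalizer V"
    and a: "a \<in> U" and rec: "conj_recurrent a"
  shows "\<exists>d. \<forall>m. (\<forall>i\<in>{1..d}. i dvd m) \<longrightarrow> (commutator (t [^] m) ^^ d) a \<in> V"
proof -
  interpret U: subgroup U G by (rule U)
  interpret V: subgroup V G by (rule V)
  let ?GU = "G\<lparr>carrier := U\<rparr>"
  have tc: "t \<in> carrier G" using tU normalizer_subset by auto
  have UV: "U \<subseteq> normalizer V"
  proof
    fix u assume u: "u \<in> U"
    have "conjugate x v \<in> V" if "x \<in> U" "v \<in> V" for x v
      using abelian[of x v] that VU by (auto simp: conjugate_eq_commutator)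
    then show "u \<in> normalizer V" using u by (intro normalizerI) auto
  qed
  then have Vn: "V \<lhd> ?GU" using normal_iff_normalizer[OF V U VU] by simp
  interpret GU: group ?GU by (rule subgroup_imp_group[OF U])
  interpret VN: normal V ?GU by (rule Vn)
  define A where "A = ?GU Mod V"
  define p where "p u = V #> u" for u
  have p_eq: "p x = p y \<longleftrightarrow> x \<otimes> inv y \<in> V" if "x \<in> U" "y \<in> U" for x y
    unfolding p_def using that by (intro r_coset_eq_iff[OF V]) auto
  have carA: "carrier A = p ` U"
    by (simp add: A_def carrier_FactGroup p_def)
  have pm: "p x \<otimes>\<^bsub>A\<^esub> p y = p (x \<otimes> y)" if "x \<in> U" "y \<in> U" for x y
    using VN.rcos_sum[of x y] that by (simp add: A_def p_def)
  have oneA: "\<one>\<^bsub>A\<^esub> = p \<one>"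
    using V.subset by (simp add: A_def p_def)
  have "group A" unfolding A_def by (rule VN.factorgroup_is_group)
  then interpret A: comm_group A
  proof (rule group.group_comm_groupI)
    fix x y assume "x \<in> carrier A" "y \<in> carrier A"
    then obtain u v where uv: "u \<in> U" "v \<in> U" "x = p u" "y = p v" using carA by auto
    have "u \<otimes> v \<otimes> inv (v \<otimes> u) \<in> V"
      using abelian[OF uv(1,2)] uv by (simp add: commutator_def m_assoc inv_mult_group)
    then show "x \<otimes>\<^bsub>A\<^esub> y = y \<otimes>\<^bsub>A\<^esub> x" using uv by (simp add: pm p_eq)
  qed
  have pc: "p u \<in> carrier A" if "u \<in> U" for u using that carA by blast
  have pinv: "inv\<^bsub>A\<^esub> (p u) = p (inv u)" if "u \<in> U" for u
    using that by (intro A.inv_equality) (auto simp: pm oneA pc)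
  have cU: "conjugate g u \<in> U \<longleftrightarrow> u \<in> U" if "g \<in> normalizer U" "u \<in> carrier G" for g u
    using normalizerD[OF that] .
  define \<psi> where "\<psi> C = conjugate t ` C" for C
  have \<psi>p: "\<psi> (p u) = p (conjugate t u)" if "u \<in> U" for u
  proof (intro Set.set_eqI iffI)
    fix z assume "z \<in> \<psi> (p u)"
    then obtain v where "v \<in> V" "z = conjugate t (v \<otimes> u)" by (auto simp: \<psi>_def p_def r_coset_def)
    then have "z = conjugate t v \<otimes> conjugate t u" "conjugate t v \<in> V"
      using that tc normalizerD[OF tV, of v] by (auto simp: conjugate_mult)
    then show "z \<in> p (conjugate t u)" by (auto simp: p_def r_coset_def)
  next
    fix z assume "z \<in> p (conjugate t u)"
    then obtain v where v: "v \<in> V" "z = v \<otimes> conjugate t u" by (auto simp: p_def r_coset_def)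
    let ?w = "conjugate (inv t) v"
    have "?w \<in> V" using v tc normalizerD[OF tV, of ?w] by auto
    moreover have "z = conjugate t (?w \<otimes> u)" using v that tc by (simp add: conjugate_mult)
    ultimately show "z \<in> \<psi> (p u)" by (auto simp: \<psi>_def p_def r_coset_def)
  qed
  have tk: "t [^] (k::nat) \<in> normalizer U" for k
    by (induction k) (use tU subgroup.m_closed[OF subgroup_normalizer] subgroup.one_closed[OF subgroup_normalizer] in auto)
  have \<psi>k: "(\<psi> ^^ k) (p u) = p (conjugate (t [^] k) u)" if "u \<in> U" for u k
  proof (induction k)
    case (Suc k)
    have "conjugate (t [^] k) u \<in> U" using cU[OF tk] that by auto
    then have "(\<psi> ^^ Suc k) (p u) = p (conjugate t (conjugate (t [^] k) u))"
      using Suc \<psi>p by simp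
    also have "\<dots> = p (conjugate (t [^] Suc k) u)"
      using tc that by (simp only: conjugate_conjugate nat_pow_closed U.mem_carrier nat_pow_Suc2)
    finally show ?case .
  qed (use that in simp)
  have \<psi>h: "\<psi> \<in> hom A A"
  proof (rule homI)
    fix x assume "x \<in> carrier A"
    then show "\<psi> x \<in> carrier A" using carA cU[OF tU] by (auto simp: \<psi>p)
  next
    fix x y assume "x \<in> carrier A" "y \<in> carrier A"
    then show "\<psi> (x \<otimes>\<^bsub>A\<^esub> y) = \<psi> x \<otimes>\<^bsub>A\<^esub> \<psi> y"
      using carA cU[OF tU] tc by (auto simp: \<psi>p pm conjugate_mult)
  qed
  have \<psi>i: "inj_on \<psi> (carrier A)"
  proof (rule inj_onI)
    fix x y assume xy: "x \<in> carrier A" "y \<in> carrier A" "\<psi> x = \<psi> y"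
    then obtain u v where uv: "u \<in> U" "v \<in> U" "x = p u" "y = p v" using carA by auto
    with xy have "conjugate t u \<otimes> inv (conjugate t v) \<in> V"
      using p_eq[of "conjugate t u" "conjugate t v"] cU[OF tU] by (simp add: \<psi>p)
    then have "conjugate t (u \<otimes> inv v) \<in> V"
      using uv tc by (simp add: conjugate_mult conjugate_inv)
    then show "x = y" using uv p_eq normalizerD[OF tV, of "u \<otimes> inv v"] by simp
  qed
  let ?P = "product_group (carrier G) (\<lambda>_. G)"
  interpret P: group ?P by simp
  obtain d where d: "conj_fun a d \<in> generate ?P (conj_fun a ` {..<d})"
    using rec by (auto simp: conj_recurrent_def)
  have closed_pow: "(\<psi> ^^ n) x \<in> carrier A" if "x \<in> carrier A" for n x
    using A.funpow_closed[OF \<psi>h that] .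
  have one_pow: "(\<psi> ^^ n) \<one>\<^bsub>A\<^esub> = \<one>\<^bsub>A\<^esub>" for n
    by (rule hom_one[OF A.funpow_hom[OF \<psi>h] A.is_group A.is_group])
  have cf: "conj_fun a k \<in> carrier ?P" for k
    using a by (auto simp: conj_fun_def)
  let ?Q = "\<lambda>g b. b \<in> {..<d} \<rightarrow> carrier A \<and>
      (\<forall>j::nat. g (t [^] j) \<in> U \<and> p (g (t [^] j)) = finprod A (\<lambda>k. (\<psi> ^^ (k * j)) (b k)) {..<d})"
  \<comment> \<open>covers a generator (\<open>c = a\<close>) and the inverse of one (\<open>c = inv a\<close>)\<close>
  have letter: "\<exists>b. ?Q g b" if k: "k < d" and c: "c \<in> U"
    and g: "\<And>j::nat. g (t [^] j) = conjugate ((t [^] j) [^] k) c" for g k c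
  proof -
    define b where "b i = (if k = i then p c else \<one>\<^bsub>A\<^esub>)" for i
    have "finprod A (\<lambda>i. (\<psi> ^^ (i * j)) (b i)) {..<d} = p (g (t [^] j))" for j
    proof -
      have "finprod A (\<lambda>i. (\<psi> ^^ (i * j)) (b i)) {..<d} =
          finprod A (\<lambda>i. if k = i then (\<psi> ^^ (i * j)) (p c) else \<one>\<^bsub>A\<^esub>) {..<d}"
        by (rule A.finprod_cong') (auto simp: b_def one_pow closed_pow pc c)
      also have "\<dots> = (\<psi> ^^ (k * j)) (p c)"
        using k by (intro A.finprod_singleton) (auto simp: closed_pow pc c)
      also have "\<dots> = p (g (t [^] j))"
        using c tc by (simp add: \<psi>k g nat_pow_pow mult.commute)
      finally show ?thesis .
    qed
    moreover have "g (t [^] j) \<in> U" for j :: nat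
      using c tc cU[OF tk] by (simp add: g nat_pow_pow)
    ultimately show ?thesis
      by (intro exI[of _ b]) (auto simp: b_def pc c)
  qed
  have gen: "\<exists>b. ?Q g b" if "g \<in> generate ?P (conj_fun a ` {..<d})" for g
    using that
  proof induction
    case one
    show ?case
      using tc by (intro exI[of _ "\<lambda>_. \<one>\<^bsub>A\<^esub>"]) (auto simp: one_pow oneA[symmetric])
  next
    case (incl g)
    then obtain k where "k < d" "g = conj_fun a k" by auto
    then show ?case using a tc by (intro letter[of k a g]) (auto simp: conj_fun_def)
  next
    case (inv g)
    then obtain k where k: "k < d" "g = conj_fun a k" by auto
    have "(inv\<^bsub>?P\<^esub> g) s = inv (g s)" if "s \<in> carrier G" for s
      using that cf k inv_product_group[of "conj_fun a k" "carrier G" "\<lambda>_. G"] by simp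
    then show ?case
      using a tc k by (intro letter[of k "inv a" "inv\<^bsub>?P\<^esub> g"]) (auto simp: conj_fun_def conjugate_inv)
  next
    case (eng g h)
    then obtain b c where b: "?Q g b" and c: "?Q h c" by blast
    have "?Q (g \<otimes>\<^bsub>?P\<^esub> h) (\<lambda>k. b k \<otimes>\<^bsub>A\<^esub> c k)"
    proof (intro conjI allI)
      show "(\<lambda>k. b k \<otimes>\<^bsub>A\<^esub> c k) \<in> {..<d} \<rightarrow> carrier A" using b c by auto
      fix j :: nat
      have gh: "(g \<otimes>\<^bsub>?P\<^esub> h) (t [^] j) = g (t [^] j) \<otimes> h (t [^] j)" using tc by simp
      then show "(g \<otimes>\<^bsub>?P\<^esub> h) (t [^] j) \<in> U" using b c by simp
      have "finprod A (\<lambda>k. (\<psi> ^^ (k * j)) (b k \<otimes>\<^bsub>A\<^esub> c k)) {..<d} =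
          finprod A (\<lambda>k. (\<psi> ^^ (k * j)) (b k) \<otimes>\<^bsub>A\<^esub> (\<psi> ^^ (k * j)) (c k)) {..<d}"
        using b c by (intro A.finprod_cong') (auto simp: A.funpow_mult_hom[OF \<psi>h] Pi_iff closed_pow)
      also have "\<dots> = finprod A (\<lambda>k. (\<psi> ^^ (k * j)) (b k)) {..<d} \<otimes>\<^bsub>A\<^esub>
          finprod A (\<lambda>k. (\<psi> ^^ (k * j)) (c k)) {..<d}"
        using b c by (intro A.finprod_multf) (auto simp: Pi_iff closed_pow)
      also have "\<dots> = p ((g \<otimes>\<^bsub>?P\<^esub> h) (t [^] j))"
        using b c pm gh by metis
      finally show "p ((g \<otimes>\<^bsub>?P\<^esub> h) (t [^] j)) =
          finprod A (\<lambda>k. (\<psi> ^^ (k * j)) (b k \<otimes>\<^bsub>A\<^esub> c k)) {..<d}" ..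
    qed
    then show ?case by blast
  qed
  obtain b where b: "?Q (conj_fun a d) b" using gen[OF d] by blast
  \<comment> \<open>move \<open>\<psi>\<^sup>d\<^sup>j a\<close> to the other side: the last unknown is \<open>-a\<close>\<close>
  define b' where "b' = b(d := inv\<^bsub>A\<^esub> (p a))"
  have b': "b' \<in> {..d} \<rightarrow> carrier A"
    using b a by (auto simp: b'_def pc le_less)
  have rel: "finprod A (\<lambda>k. (\<psi> ^^ (k * j)) (b' k)) {..d} = \<one>\<^bsub>A\<^esub>" for j
  proof -
    have ins: "{..d} = insert d {..<d}" by auto
    have "finprod A (\<lambda>k. (\<psi> ^^ (k * j)) (b' k)) {..d} =
        (\<psi> ^^ (d * j)) (inv\<^bsub>A\<^esub> (p a)) \<otimes>\<^bsub>A\<^esub> finprod A (\<lambda>k. (\<psi> ^^ (k * j)) (b' k)) {..<d}"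
      unfolding ins using b a
      by (subst A.finprod_insert) (auto simp: b'_def closed_pow pc Pi_iff)
    also have "finprod A (\<lambda>k. (\<psi> ^^ (k * j)) (b' k)) {..<d} = finprod A (\<lambda>k. (\<psi> ^^ (k * j)) (b k)) {..<d}"
      using b by (intro A.finprod_cong') (auto simp: b'_def Pi_iff closed_pow)
    also have "\<dots> = p (conj_fun a d (t [^] j))" using b by metis
    also have "\<dots> = (\<psi> ^^ (d * j)) (p a)"
      using a tc by (simp add: \<psi>k conj_fun_def nat_pow_pow mult.commute)
    finally show ?thesis
      using a by (simp add: A.funpow_inv_hom[OF \<psi>h] pc closed_pow)
  qed
  have D: "(A.power_diff \<psi> m ^^ l) (p u) = p ((commutator (t [^] m) ^^ l) u) \<and>
      (commutator (t [^] m) ^^ l) u \<in> U" if "u \<in> U" for m l u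
  proof (induction l)
    case (Suc l)
    let ?v = "(commutator (t [^] m) ^^ l) u"
    have v: "?v \<in> U" "conjugate (t [^] m) ?v \<in> U" using Suc cU[OF tk] by auto
    then show ?case
      using Suc tc by (simp add: A.power_diff_eq pc \<psi>k pinv pm commutator_eq_conjugate)
  qed (use that in auto)
  show ?thesis
  proof (intro exI allI impI)
    fix m assume m: "\<forall>i\<in>{1..d}. i dvd m"
    have "(A.power_diff \<psi> m ^^ d) (b' d) = \<one>\<^bsub>A\<^esub>"
      by (rule A.vandermonde_elimination[OF \<psi>h \<psi>i b' rel]) (use m in auto)
    then have "p ((commutator (t [^] m) ^^ d) (inv a)) = \<one>\<^bsub>A\<^esub>"
      using D[of "inv a" d m] a by (simp add: b'_def pinv)
    moreover have h: "A.power_diff \<psi> m ^^ d \<in> hom A A" by (rule A.power_diff_funpow_hom[OF \<psi>h])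
    ultimately have "inv\<^bsub>A\<^esub> ((A.power_diff \<psi> m ^^ d) (p a)) = \<one>\<^bsub>A\<^esub>"
      using D[of "inv a" d m] a pc group_hom.hom_inv[of A A "A.power_diff \<psi> m ^^ d" "p a"]
      by (simp add: pinv group_hom_def group_hom_axioms_def)
    then have "(A.power_diff \<psi> m ^^ d) (p a) = \<one>\<^bsub>A\<^esub>"
      using hom_in_carrier[OF h pc[OF a]] by simp
    then show "(commutator (t [^] m) ^^ d) a \<in> V"
      using D[OF a, of d m] p_eq[of "(commutator (t [^] m) ^^ d) a" \<one>] oneA by simp
  qed
qed

end

section \<open>Polycyclic groups with recurrent conjugates are nilpotent-by-finite\<close>

context group begin

lemma nat_pow_normalizer: "t \<in> normalizer U \<Longrightarrow> t [^] (k::nat) \<in> normalizer U"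
  by (induction k)
    (auto intro: subgroup.m_closed[OF subgroup_normalizer] subgroup.one_closed[OF subgroup_normalizer])

text \<open>Here \<open>P\<close> stands for a group of functions with evaluations \<open>ev s\<close>, where \<open>X\<close> is the identity function and
  \<open>c\<close> the constant \<open>a\<close>. The subgroups generated by the first \<open>d\<close> of the elements \<open>X\<^sup>k c X\<^sup>-\<^sup>k\<close>
  form an ascending chain in \<open>P\<close>; where it stops, the next element is a word in the previous ones.\<close>
lemma conj_recurrent_of_noetherian:
  assumes P: "group P" "noetherian_group P"
    and ev: "\<And>s. s \<in> carrier G \<Longrightarrow> ev s \<in> hom P G"
    and X: "X \<in> carrier P" "\<And>s. s \<in> carrier G \<Longrightarrow> ev s X = s"
    and c: "c \<in> carrier P" "\<And>s. s \<in> carrier G \<Longrightarrow> ev s c = a"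
  shows "conj_recurrent a"
proof -
  interpret P: group P by (rule P(1))
  let ?Q = "product_group (carrier G) (\<lambda>_. G)"
  define f where "f k = P.conjugate (X [^]\<^bsub>P\<^esub> k) c" for k :: nat
  define F where "F d = generate P (f ` {..<d})" for d
  have f: "f k \<in> carrier P" for k using X c by (simp add: f_def)
  then have fS: "f ` S \<subseteq> carrier P" for S by blast
  have "range F \<noteq> {}" "range F \<subseteq> {H. subgroup H P}"
    using P.generate_is_subgroup[OF fS] by (auto simp: F_def)
  then obtain d where d: "\<forall>H\<in>range F. F d \<subseteq> H \<longrightarrow> H = F d"
    using P.max_condD[OF P(2)[unfolded P.noetherian_iff_max_cond]] by blast
  have "F d \<subseteq> F (Suc d)" unfolding F_def by (rule P.mono_generate) auto
  then have "F (Suc d) = F d" using d by blast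
  moreover have "f d \<in> F (Suc d)" by (auto simp: F_def intro!: generate.incl)
  ultimately have fd: "f d \<in> F d" by simp
  define h where "h y = (\<lambda>s\<in>carrier G. ev s y)" for y
  have "h \<in> hom P ?Q"
    by (rule homI) (auto simp: h_def hom_in_carrier[OF ev] hom_mult[OF ev])
  then interpret h: group_hom P ?Q h
    by (simp add: group_hom_def group_hom_axioms_def)
  have hf: "h (f k) = conj_fun a k" for k
  proof -
    have "ev s (f k) = conjugate (s [^] k) a" if s: "s \<in> carrier G" for s
    proof -
      interpret e: group_hom P G "ev s"
        using ev[OF s] by (simp add: group_hom_def group_hom_axioms_def)
      show ?thesis
        using X c s by (simp add: f_def P.conjugate_def conjugate_def e.hom_nat_pow)
    qed
    then show ?thesis by (auto simp: h_def conj_fun_def)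
  qed
  have "h (f d) \<in> generate ?Q (h ` f ` {..<d})"
    using fd h.generate_img[OF fS, of "{..<d}"] unfolding F_def by blast
  then show ?thesis
    unfolding conj_recurrent_def by (auto simp: hf image_image)
qed

context
  assumes noeth: "noetherian_group G"
    and rec: "\<And>a. a \<in> carrier G \<Longrightarrow> conj_recurrent a"
begin

text \<open>A single exponent has to serve all elements of \<open>U\<close>, and later all factors of a series. Taking
  \<open>(\<phi>\<^sup>m - 1)\<^sup>D\<close> with \<open>m = D!\<close> makes the condition for one element hold for all large \<open>D\<close>, so that
  finitely many such conditions can be met together.\<close>
lemma eventually_unipotent:
  assumes U: "subgroup U G" and V: "subgroup V G" and VU: "V \<subseteq> U"
    and abelian: "\<And>x y. x \<in> U \<Longrightarrow> y \<in> U \<Longrightarrow> commutator x y \<in> V"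
    and tU: "t \<in> normalizer U" and tV: "t \<in> normalizer V"
  shows "eventually (\<lambda>D. U \<subseteq> unipotent_part (t [^] (fact D :: nat)) U V D) sequentially"
proof -
  obtain S where S: "finite S" "S \<subseteq> U" "generate G S = U"
    using noetherian_imp_finitely_generated[OF noeth U] .
  note tk = U V VU abelian nat_pow_normalizer[OF tU] nat_pow_normalizer[OF tV]
  have "eventually (\<lambda>D. a \<in> unipotent_part (t [^] (fact D :: nat)) U V D) sequentially" if a: "a \<in> S" for a
  proof -
    have aU: "a \<in> U" using a S by blast
    then obtain d where d: "\<And>m. (\<forall>i\<in>{1..d}. i dvd m) \<Longrightarrow> (commutator (t [^] m) ^^ d) a \<in> V"
      using unipotent_of_recurrent[OF U V VU abelian tU tV aU] rec subgroup.mem_carrier[OF U] by blast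
    have "a \<in> unipotent_part (t [^] (fact D :: nat)) U V D" if "D \<ge> d" for D
    proof -
      have "\<forall>i\<in>{1..d}. i dvd fact D" using that by (auto intro!: dvd_fact)
      then have "a \<in> unipotent_part (t [^] (fact D :: nat)) U V d"
        using d[of "fact D"] aU by (simp add: unipotent_part_def[OF tk])
      also have "\<dots> \<subseteq> unipotent_part (t [^] (fact D :: nat)) U V D"
        by (rule lift_Suc_mono_le[OF _ that]) (rule unipotent_part_mono[OF tk])
      finally show ?thesis .
    qed
    then show ?thesis by (auto simp: eventually_sequentially)
  qed
  then have "eventually (\<lambda>D. \<forall>a\<in>S. a \<in> unipotent_part (t [^] (fact D :: nat)) U V D) sequentially"
    using S(1) by (simp add: eventually_ball_finite)
  then show ?thesis
  proof (rule eventually_mono)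
    fix D assume "\<forall>a\<in>S. a \<in> unipotent_part (t [^] (fact D :: nat)) U V D"
    then have "generate G S \<subseteq> unipotent_part (t [^] (fact D :: nat)) U V D"
      by (intro generate_subgroup_incl subgroup_unipotent_part[OF tk]) auto
    then show "U \<subseteq> unipotent_part (t [^] (fact D :: nat)) U V D" using S(3) by simp
  qed
qed

text \<open>Choose \<open>s = t\<^sup>m\<close> unipotent on every factor of the lower central series of \<open>M\<close>. Refining each factor by
  the unipotent parts of \<open>s\<close> gives a central chain for \<open>K = \<langle>M, s\<rangle>\<close> from \<open>M\<close> down to the trivial group, and
  \<open>[K, K] \<le> M\<close> since \<open>K/M\<close> is cyclic.\<close>
lemma nilpotent_cyclic_extension:
  assumes M: "subgroup M G" and nil: "hypercentral M M" and t: "t \<in> normalizer M"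
  obtains m :: nat where "m > 0"
    "hypercentral (generate G (insert (t [^] m) M)) (generate G (insert (t [^] m) M))"
proof -
  interpret M: subgroup M G by fact
  define \<gamma> where "\<gamma> i = lower_central (G\<lparr>carrier := M\<rparr>) i" for i
  have \<gamma>: "subgroup (\<gamma> i) G" "\<gamma> i \<subseteq> M" for i
    unfolding \<gamma>_def using lower_central_subgroup[OF M] by auto
  have N\<gamma>: "s \<in> normalizer (\<gamma> i)" if "s \<in> normalizer M" for s i
    unfolding \<gamma>_def by (rule normalizer_lower_central[OF M that])
  have comm: "commutator x y \<in> \<gamma> (Suc i)" if "x \<in> \<gamma> i" "y \<in> M" for x y i
    using commutator_in_lower_central[OF M] that unfolding \<gamma>_def by blast
  have anti: "\<gamma> (Suc i) \<subseteq> \<gamma> i" for i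
    unfolding \<gamma>_def by (rule lower_central_decreasing[OF M])
  obtain c where c: "\<gamma> c = {\<one>}"
    using nil nilpotent_iff_hypercentral[OF M] by (auto simp: \<gamma>_def nilpotent_group_def)
  have abelian: "commutator x y \<in> \<gamma> (Suc i)" if "x \<in> \<gamma> i" "y \<in> \<gamma> i" for x y i
    using comm that \<gamma>(2) by blast
  have "eventually (\<lambda>D. \<forall>i\<in>{..<c}. \<gamma> i \<subseteq> unipotent_part (t [^] (fact D :: nat)) (\<gamma> i) (\<gamma> (Suc i)) D) sequentially"
    using eventually_unipotent[OF \<gamma>(1) \<gamma>(1) anti abelian N\<gamma>[OF t] N\<gamma>[OF t]]
    by (intro eventually_ball_finite) auto
  then obtain D where D: "\<And>i. i < c \<Longrightarrow> \<gamma> i \<subseteq> unipotent_part (t [^] (fact D :: nat)) (\<gamma> i) (\<gamma> (Suc i)) D"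
    unfolding eventually_sequentially by auto
  define s where "s = t [^] (fact D :: nat)"
  have s: "s \<in> normalizer M"
    unfolding s_def using t by (rule nat_pow_normalizer)
  have sc: "s \<in> carrier G" using s normalizer_subset by auto
  define K where "K = generate G (insert s M)"
  have gen: "insert s M \<subseteq> carrier G" using sc by auto
  have KM: "K \<subseteq> normalizer M"
    unfolding K_def using s subgroup_le_normalizer[OF M]
    by (intro generate_subgroup_incl[OF _ subgroup_normalizer]) auto
  have K: "subgroup K G" unfolding K_def by (rule generate_is_subgroup[OF gen])
  interpret K: subgroup K G by (rule K)
  have descend: "hypercentral K (\<gamma> (c - i))" for i
  proof (induction i)
    case 0
    then show ?case using c hypercentral.trivial by simp
  next
    case (Suc i)
    show ?case
    proof (cases "c - Suc i = c - i")
      case False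
      define j where "j = c - Suc i"
      have j: "j < c" "c - i = Suc j" using False by (auto simp: j_def)
      note ctx = \<gamma>(1)[of j] \<gamma>(1)[of "Suc j"] anti[of j] abelian[of _ j] N\<gamma>[OF s, of j] N\<gamma>[OF s, of "Suc j"]
      have "hypercentral K (unipotent_part s (\<gamma> j) (\<gamma> (Suc j)) D)"
        unfolding K_def
        by (rule conjunct1[OF hypercentral_unipotent_part[OF ctx]])
          (use comm KM N\<gamma> Suc.IH j(2) in \<open>auto simp: K_def\<close>)
      moreover have "unipotent_part s (\<gamma> j) (\<gamma> (Suc j)) D = \<gamma> j"
        using D[OF j(1)] unfolding s_def[symmetric] by (auto simp: unipotent_part_def[OF ctx])
      ultimately show ?thesis by (simp add: j_def)
    qed (use Suc in simp)
  qed
  then have hM: "hypercentral K M" using descend[of c] by (simp add: \<gamma>_def)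
  have gens: "commutator x y \<in> M" if xy: "x \<in> insert s M" "y \<in> insert s M" for x y
  proof -
    have *: "commutator x m \<in> M" if "x \<in> insert s M" "m \<in> M" for x m
    proof -
      have "x \<in> normalizer M" using that s subgroup_le_normalizer[OF M] by blast
      moreover have "x \<in> carrier G" "m \<in> carrier G" using that gen by blast+
      ultimately show ?thesis
        using that(2) normalizerD[of x M m] by (simp add: commutator_eq_conjugate)
    qed
    consider "y \<in> M" | "x \<in> M" | "x = s" "y = s" using xy by blast
    then show ?thesis
    proof cases
      case 1
      then show ?thesis using * xy by blast
    next
      case 2
      then have "inv (commutator y x) \<in> M" using *[of y x] xy by blast
      moreover have "x \<in> carrier G" "y \<in> carrier G" using xy gen by blast+
      ultimately show ?thesis by (simp add: inv_commutator)
    next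
      case 3
      then show ?thesis using sc by (simp add: commutator_eq_conjugate conjugate_def m_assoc)
    qed
  qed
  have half: "commutator x k \<in> M" if "x \<in> insert s M" "k \<in> K" for x k
    by (rule commutator_generate[OF M gen _ _ gens[OF that(1)] that(2)[unfolded K_def]])
      (use KM that gen in \<open>auto simp: K_def\<close>)
  have "commutator k k' \<in> M" if k: "k \<in> K" "k' \<in> K" for k k'
  proof (rule commutator_generate[OF M gen _ _ _ k(2)[unfolded K_def]])
    show "generate G (insert s M) \<subseteq> normalizer M" using KM K_def by simp
    show "k \<in> carrier G" using k K.subset by blast
    fix x assume x: "x \<in> insert s M"
    have "inv (commutator x k) \<in> M" using half[OF x k(1)] by blast
    moreover have "x \<in> carrier G" "k \<in> carrier G" using x gen k K.subset by blast+
    ultimately show "commutator k x \<in> M" by (simp add: inv_commutator)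
  qed
  then have "hypercentral K K" by (intro hypercentral.step[OF hM M])
  then show thesis using that[of "fact D"] by (simp add: K_def s_def)
qed

text \<open>Virtual nilpotency is carried through a cyclic extension of \<open>N\<close> by \<open>t\<close> as follows. Some power subgroup
  \<open>M\<close> of \<open>N\<close> is nilpotent, of finite index, and normalised by \<open>t\<close>; then \<open>\<langle>M, t\<^sup>m\<rangle>\<close> is nilpotent
  for some \<open>m > 0\<close> and has finite index in \<open>\<langle>N, t\<rangle>\<close>. Passing to a power subgroup once more at the end
  makes the nilpotent subgroup normal in \<open>G\<close>.\<close>
theorem nilpotent_by_finite_of_recurrent:
  assumes solv: "solvable G"
  shows "nilpotent_by_finite G"
proof -
  define vn where "vn H \<longleftrightarrow> (\<exists>B. subgroup B G \<and> B \<subseteq> H \<and> hypercentral B B \<and> finite_index_in B H)" for H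
  have core: "\<exists>k>0. hypercentral (power_subgroup k H) (power_subgroup k H)"
    if H: "subgroup H G" and vn: "vn H" for H
  proof -
    obtain B where B: "subgroup B G" "B \<subseteq> H" "hypercentral B B" "finite_index_in B H"
      using vn by (auto simp: vn_def)
    obtain k :: nat where k: "k > 0" "\<And>h. h \<in> H \<Longrightarrow> h [^] k \<in> B"
      using finite_index_imp_power[OF B(1) H B(4)] by metis
    have sub: "power_subgroup k H \<subseteq> B"
      unfolding power_subgroup_def using k by (intro generate_subgroup_incl[OF _ B(1)]) auto
    have "power_subgroup k H \<noteq> {}"
      using subgroup.one_closed[OF subgroup_power_subgroup[OF solv noeth H k(1)]] by blast
    then have "hypercentral B (power_subgroup k H)"
      using hypercentral_subset_right[OF B(3) subgroup.subset[OF B(1)] sub] by blast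
    then show ?thesis using hypercentral_subset_left[OF _ sub] k(1) by blast
  qed
  have "vn (carrier G)"
    using solv noeth
  proof (induction rule: polycyclic_induct)
    case trivial
    have "subgroup {\<one>} G" using one_is_normal normal_imp_subgroup by blast
    then show ?case
      unfolding vn_def by (intro exI[of _ "{\<one>}"]) (simp add: hypercentral.trivial finite_index_in_def)
  next
    case (cyclic_extension N t)
    note N = cyclic_extension(1) and t = cyclic_extension(2)
    have tc: "t \<in> carrier G" using t normalizer_subset by auto
    obtain k where k: "k > 0" "hypercentral (power_subgroup k N) (power_subgroup k N)"
      using core[OF N cyclic_extension(3)] by blast
    let ?M = "power_subgroup k N"
    note pow = power_subgroup_properties[OF solv noeth N k(1)]
    have tM: "t \<in> normalizer ?M" using pow(3) t by blast
    obtain m :: nat where m: "m > 0"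
      "hypercentral (generate G (insert (t [^] m) ?M)) (generate G (insert (t [^] m) ?M))"
      using nilpotent_cyclic_extension[OF pow(1) k(2) tM] .
    let ?K = "generate G (insert (t [^] m) ?M)" and ?H = "generate G (insert t N)"
    have gen: "insert (t [^] m) ?M \<subseteq> carrier G" "insert t N \<subseteq> carrier G"
      using tc subgroup.subset[OF pow(1)] subgroup.subset[OF N] by auto
    have K: "subgroup ?K G" and H: "subgroup ?H G"
      using generate_is_subgroup gen by blast+
    have "t \<in> ?H" by (auto intro: generate.incl)
    then have "t [^] i \<in> ?H" for i :: nat
      by (induction i) (use subgroup.m_closed[OF H] subgroup.one_closed[OF H] in auto)
    moreover have "?M \<subseteq> ?H" using pow(2) by (auto intro: generate.incl)
    ultimately have KH: "?K \<subseteq> ?H" by (intro generate_subgroup_incl[OF _ H]) auto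
    have tK: "t \<in> normalizer ?K"
    proof (rule generate_normalizer[OF gen(1) tc])
      have conj: "conjugate g x \<in> ?K"
        if g: "g \<in> normalizer ?M" "conjugate g (t [^] m) = t [^] m" and x: "x \<in> insert (t [^] m) ?M" for g x
      proof (cases "x \<in> ?M")
        case True
        then have "conjugate g x \<in> ?M"
          using normalizerD[OF g(1), of x] gen(1) by blast
        then show ?thesis by (auto intro: generate.incl)
      qed (use x g in \<open>auto intro: generate.incl\<close>)
      have commutes: "conjugate t (t [^] m) = t [^] m"
        using tc by (simp add: conjugate_def m_assoc flip: nat_pow_Suc2)
      moreover from this have "conjugate (inv t) (t [^] m) = t [^] m"
        using conjugate_inv_cancel(1)[OF tc, of "t [^] m"] tc by simp
      moreover have "inv t \<in> normalizer ?M"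
        using subgroup.m_inv_closed[OF subgroup_normalizer tM] .
      ultimately show "conjugate t x \<in> ?K" "conjugate (inv t) x \<in> ?K"
        if "x \<in> insert (t [^] m) ?M" for x
        using conj that tM by blast+
    qed
    have "?M \<subseteq> ?K" "t [^] m \<in> ?K" by (auto intro: generate.incl)
    then have "finite_index_in ?K N"
      using finite_index_in_mono[OF pow(4) pow(1) K] subgroup.subset[OF N] by blast
    then have "finite_index_in ?K ?H"
      by (rule finite_index_cyclic_extension[OF N t K tK \<open>t [^] m \<in> ?K\<close> m(1)])
    then show ?case using K KH m(2) unfolding vn_def by blast
  qed
  then obtain k where k: "k > 0" "hypercentral (power_subgroup k (carrier G)) (power_subgroup k (carrier G))"
    using core[OF subgroup_self] by blast
  let ?N = "power_subgroup k (carrier G)"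
  note pow = power_subgroup_properties[OF solv noeth subgroup_self k(1)]
  have "?N \<lhd> G"
    using normal_iff_normalizer[OF pow(1) subgroup_self pow(2)] pow(3) by (simp add: normalizer_carrier)
  moreover have "nilpotent_group (G\<lparr>carrier := ?N\<rparr>)"
    using nilpotent_iff_hypercentral[OF pow(1)] k(2) by simp
  moreover have "finite (rcosets ?N)" using pow(4) finite_index_in_carrier by simp
  ultimately show ?thesis unfolding nilpotent_by_finite_def by blast
qed

end

end

section \<open>Finitely generated nilpotent-by-finite groups are Noetherian\<close>

context group begin

lemma max_cond_image:
  assumes "max_cond F" "C \<noteq> {}" "\<And>L. L \<in> C \<Longrightarrow> f L \<in> F"
  obtains M where "M \<in> C" "\<And>L. L \<in> C \<Longrightarrow> f M \<subseteq> f L \<Longrightarrow> f L = f M"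
proof -
  have "\<exists>K\<in>f ` C. \<forall>H\<in>f ` C. K \<subseteq> H \<longrightarrow> H = K"
    using assms by (intro max_condD[of F]) auto
  then show thesis using that by auto
qed

lemma subgroup_set_mult_normalizer:
  assumes N: "subgroup N G" and L: "subgroup L G" and LN: "L \<subseteq> normalizer N"
  shows "subgroup (N <#> L) G"
proof -
  interpret N: subgroup N G by (rule N)
  interpret L: subgroup L G by (rule L)
  have conj: "conjugate l n \<in> N" if "l \<in> L" "n \<in> N" for l n
    using normalizerD[of l N n] that LN by auto
  show ?thesis
  proof (rule subgroupI)
    show "N <#> L \<subseteq> carrier G" by (auto simp: set_mult_def)
    have "\<one> \<otimes> \<one> \<in> N <#> L" using N.one_closed L.one_closed unfolding set_mult_def by blast
    then show "N <#> L \<noteq> {}" by blast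
  next
    fix x assume "x \<in> N <#> L"
    then obtain n l where nl: "n \<in> N" "l \<in> L" "x = n \<otimes> l" by (auto simp: set_mult_def)
    then have "inv x = conjugate (inv l) (inv n) \<otimes> inv l"
      by (simp add: conjugate_def m_assoc inv_mult_group)
    then show "inv x \<in> N <#> L" using nl conj by (auto simp: set_mult_def)
  next
    fix x y assume "x \<in> N <#> L" "y \<in> N <#> L"
    then obtain n l n' l' where nl: "n \<in> N" "l \<in> L" "x = n \<otimes> l" "n' \<in> N" "l' \<in> L" "y = n' \<otimes> l'"
      by (auto simp: set_mult_def)
    then have "x \<otimes> y = (n \<otimes> conjugate l n') \<otimes> (l \<otimes> l')"
      by (simp add: conjugate_def m_assoc)
    moreover have "n \<otimes> conjugate l n' \<in> N" "l \<otimes> l' \<in> L" using nl conj by auto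
    ultimately show "x \<otimes> y \<in> N <#> L" by (auto simp: set_mult_def)
  qed
qed

text \<open>A subgroup \<open>L \<le> H\<close> is controlled by \<open>L \<inter> N\<close> and \<open>NL\<close>: if \<open>M \<le> L\<close> agree in both, then \<open>M = L\<close> by the
  modular law. So first maximise \<open>L \<inter> N\<close>, then \<open>NL\<close>.\<close>
theorem noetherian_extension:
  assumes N: "subgroup N G" and H: "subgroup H G" and NH: "N \<subseteq> H" and HN: "H \<subseteq> normalizer N"
    and noeth: "noetherian_group (G\<lparr>carrier := N\<rparr>)"
    and quot: "max_cond {L. subgroup L G \<and> N \<subseteq> L \<and> L \<subseteq> H}"
  shows "noetherian_group (G\<lparr>carrier := H\<rparr>)"
  unfolding noetherian_subgroup_iff[OF H] max_cond_def
proof (intro allI impI, elim conjE)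
  interpret N: subgroup N G by (rule N)
  interpret H: subgroup H G by (rule H)
  fix C :: "'a set set" assume ne: "C \<noteq> {}" and C: "C \<subseteq> {L. subgroup L G \<and> L \<subseteq> H}"
  have sub: "subgroup L G" "L \<subseteq> H" if "L \<in> C" for L using that C by auto
  have "L \<inter> N \<in> {L. subgroup L G \<and> L \<subseteq> N}" if "L \<in> C" for L
    using sub(1)[OF that] N by (auto intro: subgroups_Inter_pair)
  from max_cond_image[OF noeth[unfolded noetherian_subgroup_iff[OF N]] ne this]
  obtain M0 where M0: "M0 \<in> C" "\<And>L. L \<in> C \<Longrightarrow> M0 \<inter> N \<subseteq> L \<inter> N \<Longrightarrow> L \<inter> N = M0 \<inter> N"
    by metis
  define D where "D = M0 \<inter> N"
  define C' where "C' = {L \<in> C. L \<inter> N = D}"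
  have "N <#> L \<in> {L. subgroup L G \<and> N \<subseteq> L \<and> L \<subseteq> H}" if L: "L \<in> C'" for L
  proof -
    have L': "subgroup L G" "L \<subseteq> H" using L sub by (auto simp: C'_def)
    have "N \<subseteq> N <#> L"
    proof
      fix n assume n: "n \<in> N"
      then have "n \<otimes> \<one> \<in> N <#> L"
        using subgroup.one_closed[OF L'(1)] unfolding set_mult_def by blast
      then show "n \<in> N <#> L" using n by simp
    qed
    moreover have "N <#> L \<subseteq> H" using L' NH by (auto simp: set_mult_def subset_iff)
    ultimately show ?thesis
      using L' HN subgroup_set_mult_normalizer[OF N, of L] by auto
  qed
  note quot_sub = this
  have "C' \<noteq> {}" using M0(1) by (auto simp: C'_def D_def)
  from max_cond_image[OF quot this quot_sub] obtain M where M: "M \<in> C'" "\<And>L. L \<in> C' \<Longrightarrow> N <#> M \<subseteq> N <#> L \<Longrightarrow> N <#> L = N <#> M"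
    by metis
  have "L = M" if L: "L \<in> C" "M \<subseteq> L" for L
  proof -
    interpret L: subgroup L G by (rule sub[OF L(1)])
    have "D \<subseteq> L \<inter> N" using M(1) L by (auto simp: C'_def)
    then have LD: "L \<inter> N = D" unfolding D_def by (rule M0(2)[OF L(1)])
    then have "L \<in> C'" using L by (simp add: C'_def)
    moreover have "N <#> M \<subseteq> N <#> L" using L(2) by (auto simp: set_mult_def)
    ultimately have eq: "N <#> L = N <#> M" by (rule M(2))
    have "l \<in> M" if l: "l \<in> L" for l
    proof -
      have "\<one> \<otimes> l \<in> N <#> L" using l N.one_closed unfolding set_mult_def by blast
      then have "l \<in> N <#> M" using eq l by simp
      then obtain n m where nm: "n \<in> N" "m \<in> M" "l = n \<otimes> m"
        unfolding set_mult_def by blast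
      then have mL: "m \<in> L" using L by blast
      have n: "n = l \<otimes> inv m" using nm mL by (simp add: m_assoc)
      have "l \<otimes> inv m \<in> L" using l mL by simp
      then have "n \<in> L \<inter> N" using nm(1) n by simp
      then have "n \<in> M" using LD M(1) by (auto simp: C'_def)
      then show ?thesis using nm sub(1)[of M] M(1) by (auto simp: C'_def intro: subgroup.m_closed)
    qed
    then show ?thesis using L by blast
  qed
  then show "\<exists>M\<in>C. \<forall>L\<in>C. M \<subseteq> L \<longrightarrow> L = M" using M(1) by (auto simp: C'_def)
qed

text \<open>Subgroups containing \<open>N\<close> correspond to subgroups of the integers, \<open>L\<close> to the set of \<open>j\<close> with
  \<open>t\<^sup>j \<in> L\<close>. A member of the family with the least positive such \<open>j\<close> is maximal; if there is none, all
  members equal \<open>N\<close>.\<close>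
lemma noetherian_cyclic_extension:
  assumes N: "subgroup N G" and t: "t \<in> normalizer N" and noeth: "noetherian_group (G\<lparr>carrier := N\<rparr>)"
  shows "noetherian_group (G\<lparr>carrier := generate G (insert t N)\<rparr>)"
proof -
  let ?H = "generate G (insert t N)"
  have tc: "t \<in> carrier G" using t normalizer_subset by auto
  interpret N: subgroup N G by (rule N)
  have gen: "insert t N \<subseteq> carrier G" using tc by auto
  have H: "subgroup ?H G" by (rule generate_is_subgroup[OF gen])
  have HN: "?H \<subseteq> normalizer N"
    using t subgroup_le_normalizer[OF N] by (intro generate_subgroup_incl[OF _ subgroup_normalizer]) auto
  have "max_cond {L. subgroup L G \<and> N \<subseteq> L \<and> L \<subseteq> ?H}"
    unfolding max_cond_def
  proof (intro allI impI, elim conjE)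
    fix C :: "'a set set" assume ne: "C \<noteq> {}" and C: "C \<subseteq> {L. subgroup L G \<and> N \<subseteq> L \<and> L \<subseteq> ?H}"
    have sub: "subgroup L G" "N \<subseteq> L" "L \<subseteq> ?H" if "L \<in> C" for L using that C by auto
    have repr: "\<exists>j::int. \<exists>x\<in>N. l = t [^] j \<otimes> x \<and> t [^] j \<in> L" if L: "L \<in> C" "l \<in> L" for L l
    proof -
      interpret L: subgroup L G by (rule sub[OF L(1)])
      obtain j x where jx: "x \<in> N" "l = t [^] (j::int) \<otimes> x"
        using generate_insert_normalizer[OF N t, of l] sub(3)[OF L(1)] L(2) by blast
      then have tj: "t [^] j = l \<otimes> inv x" using tc by (simp add: m_assoc)
      have "x \<in> L" using jx sub(2)[OF L(1)] by blast
      then have "t [^] j \<in> L" unfolding tj using L(2) by simp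
      then show ?thesis using jx by blast
    qed
    define J where "J j \<longleftrightarrow> j > 0 \<and> (\<exists>L\<in>C. t [^] j \<in> L)" for j :: nat
    show "\<exists>M\<in>C. \<forall>L\<in>C. M \<subseteq> L \<longrightarrow> L = M"
    proof (cases "\<exists>j. J j")
      case False
      obtain M where M: "M \<in> C" using ne by blast
      have "L \<subseteq> M" if L: "L \<in> C" for L
      proof
        interpret L: subgroup L G by (rule sub[OF L])
        fix l assume "l \<in> L"
        then obtain j x where jx: "x \<in> N" "l = t [^] (j::int) \<otimes> x" "t [^] j \<in> L" using repr L by blast
        have "inv (t [^] j) \<in> L" using jx by blast
        then have "t [^] (- j) \<in> L" using tc by (simp add: int_pow_neg)
        moreover have "t [^] (nat \<bar>j\<bar>) = t [^] \<bar>j\<bar>"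
          by (simp flip: int_pow_int)
        ultimately have "t [^] (nat \<bar>j\<bar>) \<in> L"
          using jx(3) by (cases "0 \<le> j") simp_all
        then have ex: "\<exists>L\<in>C. t [^] (nat \<bar>j\<bar>) \<in> L" using L by (rule bexI)
        have "\<not> J (nat \<bar>j\<bar>)" using False by simp
        with ex have "\<not> 0 < nat \<bar>j\<bar>" by (simp only: J_def simp_thms)
        then have "j = 0" by simp
        then show "l \<in> M" using jx sub(2)[OF M] by auto
      qed
      then show ?thesis using M by blast
    next
      case True
      define j where "j = (LEAST j. J j)"
      have j: "J j" unfolding j_def using True by (rule LeastI_ex)
      have least: "j \<le> i" if "J i" for i unfolding j_def using that by (rule Least_le)
      obtain M where M: "M \<in> C" "t [^] j \<in> M" and j0: "j > 0" using j by (auto simp: J_def)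
      interpret M: subgroup M G by (rule sub[OF M(1)])
      have "L \<subseteq> M" if L: "L \<in> C" "M \<subseteq> L" for L
      proof
        interpret L: subgroup L G by (rule sub[OF L(1)])
        fix l assume "l \<in> L"
        then obtain i x where ix: "x \<in> N" "l = t [^] (i::int) \<otimes> x" "t [^] i \<in> L" using repr L by blast
        define q where "q = (t [^] j) [^] (i div int j)"
        have q: "q \<in> M" unfolding q_def by (rule subgroup_int_pow_closed[OF M.is_subgroup M(2)])
        have q': "q = t [^] (int j * (i div int j))"
          using tc int_pow_pow[of t "int j"] by (simp add: q_def int_pow_int)
        define r where "r = nat (i mod int j)"
        have r: "int r = i mod int j" "r < j" using j0 by (auto simp: r_def nat_less_iff)
        have "t [^] int r = t [^] i \<otimes> inv q"
          unfolding r(1) q' using tc int_pow_diff[of t i "int j * (i div int j)"]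
          by (simp add: minus_mult_div_eq_mod)
        also have "\<dots> \<in> L" using ix(3) q L(2) by auto
        finally have "t [^] r \<in> L" by (simp add: int_pow_int)
        then have "\<exists>L\<in>C. t [^] r \<in> L" using L(1) by (rule bexI)
        then have "r = 0" using least[of r] r(2) unfolding J_def by linarith
        then have "i = int j * (i div int j)" using r(1) by (simp add: minus_mult_div_eq_mod[symmetric])
        then have "t [^] i = q" using q' by simp
        then show "l \<in> M" using ix q sub(2)[OF M(1)] by auto
      qed
      then show ?thesis using M by blast
    qed
  qed
  moreover have "N \<subseteq> ?H" by (auto intro: generate.incl)
  ultimately show ?thesis using noetherian_extension[OF N H _ HN noeth] by blast
qed

text \<open>A subgroup containing \<open>N\<close> is a union of cosets of \<open>N\<close>, so there are only finitely many.\<close>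
lemma noetherian_finite_index:
  assumes N: "N \<lhd> G" and fin: "finite (rcosets N)" and noeth: "noetherian_group (G\<lparr>carrier := N\<rparr>)"
  shows "noetherian_group G"
proof -
  interpret N: normal N G by (rule N)
  let ?F = "{L. subgroup L G \<and> N \<subseteq> L \<and> L \<subseteq> carrier G}"
  let ?f = "\<lambda>L. (\<lambda>h. N #> h) ` L"
  have Un: "\<Union>(?f L) = L" if L: "L \<in> ?F" for L
  proof -
    interpret L: subgroup L G using L by blast
    have "h \<in> N #> h" if "h \<in> L" for h using rcos_self[OF L.mem_carrier[OF that] N.is_subgroup] .
    moreover have "N #> h \<subseteq> L" if "h \<in> L" for h using that L by (auto simp: r_coset_def)
    ultimately show ?thesis by blast
  qed
  have "inj_on ?f ?F" using Un by (metis (lifting) inj_onI)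
  moreover have "?f ` ?F \<subseteq> Pow (rcosets N)" by (auto simp: RCOSETS_def)
  then have "finite (?f ` ?F)" using fin finite_subset by blast
  ultimately have "finite ?F" using finite_imageD by blast
  then have "max_cond ?F"
    unfolding max_cond_def using finite_has_maximal finite_subset by (metis (lifting))
  moreover have "carrier G \<subseteq> normalizer N"
    using normal_iff_normalizer[OF N.is_subgroup subgroup_self N.subset] N by simp
  ultimately show ?thesis
    using noetherian_extension[OF N.is_subgroup subgroup_self N.subset _ noeth] by simp
qed

text \<open>Schreier's lemma. For a finite set \<open>T\<close> of representatives, the elements \<open>t x t'\<inverse>\<close> that lie in
  \<open>B\<close>, with \<open>x\<close> a generator or its inverse, allow a word to be read from left to right while keeping the form
  \<open>y t\<close> with \<open>y \<in> \<langle>Y\<rangle>\<close> and \<open>t \<in> T\<close>.\<close>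
theorem finite_index_finitely_generated:
  assumes B: "subgroup B G" and fin: "finite (rcosets B)" and fg: "finitely_generated_group G"
  obtains Y where "finite Y" "Y \<subseteq> B" "generate G Y = B"
proof -
  interpret B: subgroup B G by (rule B)
  obtain X where X: "finite X" "X \<subseteq> carrier G" "generate G X = carrier G"
    using fg by (auto simp: finitely_generated_group_def)
  have "finite ((\<lambda>h. B #> h) ` carrier G)"
    using fin finite_index_in_carrier finite_index_in_def by auto
  then obtain T0 where T0: "T0 \<subseteq> carrier G" "finite T0" "(\<lambda>h. B #> h) ` carrier G = (\<lambda>h. B #> h) ` T0"
    using finite_subset_image[OF _ subset_refl] by metis
  define T where "T = insert \<one> T0"
  have T: "T \<subseteq> carrier G" "finite T" "\<one> \<in> T" using T0 by (auto simp: T_def)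
  have rep: "\<exists>t\<in>T. g \<otimes> inv t \<in> B" if g: "g \<in> carrier G" for g
  proof -
    obtain t where "t \<in> T0" "B #> g = B #> t" using g T0(3) by blast
    then show ?thesis using r_coset_eq_iff[OF B g, of t] T0(1) by (auto simp: T_def)
  qed
  define X' where "X' = X \<union> m_inv G ` X"
  have X': "finite X'" "X' \<subseteq> carrier G" using X by (auto simp: X'_def)
  \<comment> \<open>\<open>T \<inter> B\<close> is included since \<open>T\<close> may contain several representatives of \<open>B\<close> itself\<close>
  define Y where "Y = (((\<lambda>(t, x, t'). t \<otimes> x \<otimes> inv t') ` (T \<times> X' \<times> T)) \<union> T) \<inter> B"
  have Y: "finite Y" "Y \<subseteq> B" using X' T by (auto simp: Y_def)
  have Yc: "Y \<subseteq> carrier G" using Y B.subset by blast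
  have letter: "\<exists>y'\<in>generate G Y. \<exists>t'\<in>T. y \<otimes> t \<otimes> x = y' \<otimes> t'"
    if y: "y \<in> generate G Y" and t: "t \<in> T" and x: "x \<in> X'" for y t x
  proof -
    have c: "t \<in> carrier G" "x \<in> carrier G" "y \<in> carrier G"
      using t x y T X' generate_in_carrier[OF Yc] by auto
    obtain t' where t': "t' \<in> T" "t \<otimes> x \<otimes> inv t' \<in> B" using rep[of "t \<otimes> x"] c by auto
    then have "t \<otimes> x \<otimes> inv t' \<in> Y" using t x by (force simp: Y_def)
    then have "y \<otimes> (t \<otimes> x \<otimes> inv t') \<in> generate G Y" using y by (auto intro: generate.intros)
    moreover have "y \<otimes> t \<otimes> x = y \<otimes> (t \<otimes> x \<otimes> inv t') \<otimes> t'" 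
      using c t' T by (simp add: m_assoc subset_iff)
    ultimately show ?thesis using t' by blast
  qed
  have closed: "\<exists>y'\<in>generate G Y. \<exists>t'\<in>T. y \<otimes> t \<otimes> g = y' \<otimes> t'"
    if "g \<in> generate G X" "y \<in> generate G Y" "t \<in> T" for g y t
    using that
  proof (induction arbitrary: y t)
    case one
    then show ?case using T generate_in_carrier[OF Yc] by (metis m_closed r_one subsetD)
  next
    case (incl x)
    then show ?case by (intro letter) (auto simp: X'_def)
  next
    case (inv x)
    then show ?case by (intro letter) (auto simp: X'_def)
  next
    case (eng g h)
    obtain y' t' where yt: "y' \<in> generate G Y" "t' \<in> T" "y \<otimes> t \<otimes> g = y' \<otimes> t'"
      using eng.IH(1)[OF eng.prems] by blast
    have "g \<in> carrier G" "h \<in> carrier G" "y \<in> carrier G" "t \<in> carrier G"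
      using eng T generate_in_carrier[OF Yc] generate_in_carrier[OF X(2)] by blast+
    then have "y \<otimes> t \<otimes> (g \<otimes> h) = y' \<otimes> t' \<otimes> h"
      by (simp add: m_assoc flip: yt(3))
    then show ?case using eng.IH(2)[OF yt(1,2)] by simp
  qed
  have "b \<in> generate G Y" if b: "b \<in> B" for b
  proof -
    have bc: "b \<in> carrier G" using B.mem_carrier[OF b] .
    obtain y t where yt: "y \<in> generate G Y" "t \<in> T" "\<one> \<otimes> \<one> \<otimes> b = y \<otimes> t"
      using closed[of b \<one> \<one>] bc X(3) T(3) generate.one by metis
    have yB: "y \<in> B" using yt(1) generate_subgroup_incl[OF Y(2) B] by blast
    have tc: "t \<in> carrier G" using yt T by blast
    then have "t = inv y \<otimes> b" using yt(3) yB bc by simp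
    then have "t \<in> B" using yB b by simp
    then have "t \<in> Y" using yt by (simp add: Y_def)
    moreover have "b = y \<otimes> t" using yt(3) bc by simp
    ultimately show ?thesis using yt by (auto intro: generate.intros)
  qed
  then have "generate G Y = B" using generate_subgroup_incl[OF Y(2) B] by blast
  with Y show thesis by (rule that)
qed

text \<open>Modulo \<open>\<gamma>\<^sub>i\<^sub>+\<^sub>2\<close> the commutator is bilinear on \<open>\<gamma>\<^sub>i \<times> G\<close>, so commutators of generators of \<open>\<gamma>\<^sub>i\<close> modulo
  \<open>\<gamma>\<^sub>i\<^sub>+\<^sub>1\<close> with generators of \<open>G\<close> generate \<open>\<gamma>\<^sub>i\<^sub>+\<^sub>1\<close> modulo \<open>\<gamma>\<^sub>i\<^sub>+\<^sub>2\<close>. Hence every factor of the lower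
  central series is finitely generated. Adjoining these generators one at a time from the bottom, each step
  is a cyclic extension, since a subgroup between \<open>\<gamma>\<^sub>i\<^sub>+\<^sub>1\<close> and \<open>\<gamma>\<^sub>i\<close> is normal.\<close>
theorem finitely_generated_nilpotent_noetherian:
  assumes fg: "finitely_generated_group G" and nil: "nilpotent_group G"
  shows "noetherian_group G"
proof -
  define \<gamma> where "\<gamma> = lower_central G"
  note K = subgroup_self
  obtain X where X: "finite X" "X \<subseteq> carrier G" "generate G X = carrier G"
    using fg by (auto simp: finitely_generated_group_def)
  obtain c where c: "\<gamma> c = {\<one>}" using nil by (auto simp: nilpotent_group_def \<gamma>_def)
  have sub: "subgroup (\<gamma> i) G" for i
    using lower_central_subgroup[OF K] by (simp add: \<gamma>_def)
  have \<gamma>c: "\<gamma> i \<subseteq> carrier G" for i by (rule subgroup.subset[OF sub])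
  have Suc_eq: "\<gamma> (Suc i) = generate G {commutator x y | x y. x \<in> \<gamma> i \<and> y \<in> carrier G}" for i
    using lower_central_Suc_subgroup[OF K, of i] \<gamma>c by (simp add: \<gamma>_def)
  have comm: "commutator x y \<in> \<gamma> (Suc i)" if "x \<in> \<gamma> i" "y \<in> carrier G" for x y i
    unfolding Suc_eq using that by (auto intro!: generate.incl)
  have between: "g \<in> normalizer W"
    if W: "subgroup W G" "\<gamma> (Suc i) \<subseteq> W" "W \<subseteq> \<gamma> i" and g: "g \<in> carrier G" for W i g
  proof -
    interpret W: subgroup W G by (rule W)
    have "conjugate h w \<in> W" if "h \<in> carrier G" "w \<in> W" for h w
    proof -
      have wc: "w \<in> carrier G" using W.mem_carrier[OF that(2)] .
      have "commutator w h \<in> W" using comm[of w i h] that W by blast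
      then have "inv (commutator w h) \<in> W" by blast
      then show ?thesis using that wc by (simp add: conjugate_eq_commutator inv_commutator)
    qed
    then show ?thesis using g by (intro normalizerI) auto
  qed
  have anti: "\<gamma> (Suc i) \<subseteq> \<gamma> i" for i
    using lower_central_decreasing[OF K, of i] by (simp add: \<gamma>_def)
  have layer: "\<exists>S. finite S \<and> S \<subseteq> \<gamma> i \<and> \<gamma> i \<subseteq> generate G (S \<union> \<gamma> (Suc i))" for i
  proof (induction i)
    case 0
    have "generate G X \<subseteq> generate G (X \<union> \<gamma> (Suc 0))" by (rule mono_generate) simp
    then show ?case using X by (intro exI[of _ X]) (simp add: \<gamma>_def)
  next
    case (Suc i)
    then obtain S where S: "finite S" "S \<subseteq> \<gamma> i" "\<gamma> i \<subseteq> generate G (S \<union> \<gamma> (Suc i))" by blast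
    define S' where "S' = (\<lambda>(s, x). commutator s x) ` (S \<times> X)"
    define Q where "Q = generate G (S' \<union> \<gamma> (Suc (Suc i)))"
    have S': "finite S'" using S(1) X(1) by (simp add: S'_def)
    have S'2: "S' \<subseteq> \<gamma> (Suc i)"
      using S(2) X(2) by (auto simp: S'_def intro!: comm)
    have gen: "S' \<union> \<gamma> (Suc (Suc i)) \<subseteq> \<gamma> (Suc i)" using S'2 anti[of "Suc i"] by (rule Un_least)
    have Q: "subgroup Q G" "Q \<subseteq> \<gamma> (Suc i)" "\<gamma> (Suc (Suc i)) \<subseteq> Q" "S' \<subseteq> Q"
      unfolding Q_def
      using generate_is_subgroup[OF subset_trans[OF gen \<gamma>c]] generate_subgroup_incl[OF gen sub]
      by (auto intro: generate.incl)
    interpret Q: subgroup Q G by (rule Q)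
    have QN: "generate G Z \<subseteq> normalizer Q" if "Z \<subseteq> carrier G" for Z
      using between[OF Q(1,3,2)] generate_in_carrier[OF that] by blast
    have sg: "commutator s g \<in> Q" if s: "s \<in> S" and g: "g \<in> carrier G" for s g
    proof (rule commutator_generate[OF Q(1) X(2) QN[OF X(2)]])
      show "s \<in> carrier G" using s S \<gamma>c by blast
      show "g \<in> generate G X" using g X by simp
      show "commutator s x \<in> Q" if "x \<in> X" for x
        using that s Q(4) by (auto simp: S'_def)
    qed
    have "commutator y g \<in> Q" if y: "y \<in> \<gamma> i" and g: "g \<in> carrier G" for y g
    proof -
      have Sc: "S \<union> \<gamma> (Suc i) \<subseteq> carrier G" using S \<gamma>c by blast
      have "commutator g y \<in> Q"
      proof (rule commutator_generate[OF Q(1) Sc QN[OF Sc] g])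
        show "y \<in> generate G (S \<union> \<gamma> (Suc i))" using y S by blast
        fix s assume s: "s \<in> S \<union> \<gamma> (Suc i)"
        then have "commutator s g \<in> Q" using sg comm[of s "Suc i" g] g Q(3) by blast
        then have "inv (commutator s g) \<in> Q" by blast
        moreover have "s \<in> carrier G" using s Sc by blast
        ultimately show "commutator g s \<in> Q" using g by (simp add: inv_commutator)
      qed
      then have "inv (commutator g y) \<in> Q" by blast
      moreover have "y \<in> carrier G" using y \<gamma>c by blast
      ultimately show ?thesis using g by (simp add: inv_commutator)
    qed
    then have "\<gamma> (Suc i) \<subseteq> Q"
      unfolding Suc_eq[of i] by (intro generate_subgroup_incl[OF _ Q(1)]) auto
    then show ?case using S' S'2 unfolding Q_def by (intro exI[of _ S'] conjI)
  qed
  have "noetherian_group (G\<lparr>carrier := \<gamma> (c - i)\<rparr>)" for i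
  proof (induction i)
    case 0
    have "noetherian_group (G\<lparr>carrier := \<gamma> c\<rparr>)"
      unfolding noetherian_subgroup_iff[OF sub] max_cond_def
    proof (intro allI impI, elim conjE)
      fix C assume ne: "C \<noteq> {}" and C: "C \<subseteq> {L. subgroup L G \<and> L \<subseteq> \<gamma> c}"
      have "L = {\<one>}" if "L \<in> C" for L
        using that C c subgroup.one_closed by blast
      then show "\<exists>M\<in>C. \<forall>L\<in>C. M \<subseteq> L \<longrightarrow> L = M" using ne by blast
    qed
    then show ?case by simp
  next
    case (Suc i)
    show ?case
    proof (cases "c - Suc i = c - i")
      case False
      define j where "j = c - Suc i"
      have j: "c - i = Suc j" using False by (auto simp: j_def)
      obtain S where S: "finite S" "S \<subseteq> \<gamma> j" "\<gamma> j \<subseteq> generate G (S \<union> \<gamma> (Suc j))"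
        using layer by blast
      have "noetherian_group (G\<lparr>carrier := generate G (R \<union> \<gamma> (Suc j))\<rparr>)" if "finite R" "R \<subseteq> S" for R
        using that
      proof (induction R)
        case empty
        have "generate G (\<gamma> (Suc j)) = \<gamma> (Suc j)"
          by (rule subset_antisym) (auto intro: generate.incl dest: generate_subgroup_incl[OF subset_refl sub, THEN subsetD])
        then show ?case using Suc.IH j by simp
      next
        case (insert r R)
        let ?L = "generate G (R \<union> \<gamma> (Suc j))"
        have Rj: "R \<union> \<gamma> (Suc j) \<subseteq> \<gamma> j" "insert r R \<union> \<gamma> (Suc j) \<subseteq> \<gamma> j" using insert.prems S anti[of j] by auto
        have Rc: "R \<union> \<gamma> (Suc j) \<subseteq> carrier G" "insert r R \<union> \<gamma> (Suc j) \<subseteq> carrier G" using Rj \<gamma>c by blast+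
        have L: "subgroup ?L G" by (rule generate_is_subgroup[OF Rc(1)])
        have "?L \<subseteq> \<gamma> j" by (rule generate_subgroup_incl[OF Rj(1) sub])
        then have "r \<in> normalizer ?L"
          using between[OF L, of j r] Rc by (auto intro: generate.incl)
        then have "noetherian_group (G\<lparr>carrier := generate G (insert r ?L)\<rparr>)"
          using insert by (intro noetherian_cyclic_extension[OF L]) auto
        moreover have "generate G (insert r ?L) = generate G (insert r R \<union> \<gamma> (Suc j))"
        proof (rule subset_antisym)
          have "?L \<subseteq> generate G (insert r R \<union> \<gamma> (Suc j))" by (rule mono_generate) auto
          then show "generate G (insert r ?L) \<subseteq> generate G (insert r R \<union> \<gamma> (Suc j))"
            by (intro generate_subgroup_incl[OF _ generate_is_subgroup[OF Rc(2)]]) (auto intro: generate.incl)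
          show "generate G (insert r R \<union> \<gamma> (Suc j)) \<subseteq> generate G (insert r ?L)"
            by (rule mono_generate) (auto intro: generate.incl)
        qed
        ultimately show ?case by simp
      qed
      then have "noetherian_group (G\<lparr>carrier := generate G (S \<union> \<gamma> (Suc j))\<rparr>)" using S by blast
      moreover have "generate G (S \<union> \<gamma> (Suc j)) = \<gamma> j"
        using S anti[of j] generate_subgroup_incl[OF _ sub, of "S \<union> \<gamma> (Suc j)" j] by blast
      ultimately show ?thesis by (simp add: j_def)
    qed (use Suc in simp)
  qed
  from this[of c] show ?thesis by (simp add: \<gamma>_def)
qed

theorem noetherian_of_nilpotent_by_finite:
  assumes fg: "finitely_generated_group G" and nbf: "nilpotent_by_finite G"
  shows "noetherian_group G"
proof -
  obtain N where N: "N \<lhd> G" "nilpotent_group (G\<lparr>carrier := N\<rparr>)" "finite (rcosets N)"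
    using nbf by (auto simp: nilpotent_by_finite_def)
  then have sN: "subgroup N G" using normal_imp_subgroup by blast
  obtain Y where Y: "finite Y" "Y \<subseteq> N" "generate G Y = N"
    using finite_index_finitely_generated[OF sN N(3) fg] .
  then have "finitely_generated_group (G\<lparr>carrier := N\<rparr>)"
    using generate_consistent[OF Y(2) sN] by (auto simp: finitely_generated_group_def)
  then have "noetherian_group (G\<lparr>carrier := N\<rparr>)"
    using N(2) group.finitely_generated_nilpotent_noetherian[OF subgroup_imp_group[OF sN]] by blast
  then show ?thesis by (rule noetherian_finite_index[OF N(1,3)])
qed

end

lemma (in group_hom) noetherian_image:
  assumes surj: "h ` carrier G = carrier H" and noeth: "noetherian_group G"
  shows "noetherian_group H"
  unfolding noetherian_group_def
proof (intro allI impI, elim conjE)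
  fix C assume ne: "C \<noteq> {}" and C: "\<forall>L\<in>C. subgroup L H"
  define pre where "pre L = {x \<in> carrier G. h x \<in> L}" for L
  have im: "h ` pre L = L" if "L \<in> C" for L
  proof -
    have "L \<subseteq> h ` carrier G" using that C surj subgroup.subset by blast
    then show ?thesis unfolding pre_def by blast
  qed
  have "subgroup (pre L) G" if L: "L \<in> C" for L
  proof -
    interpret L: subgroup L H using C L by blast
    show ?thesis
    proof (rule G.subgroupI)
      have "\<one>\<^bsub>G\<^esub> \<in> pre L" by (simp add: pre_def)
      then show "pre L \<noteq> {}" by blast
    qed (auto simp: pre_def)
  qed
  then obtain M where M: "M \<in> C" "\<And>L. L \<in> C \<Longrightarrow> pre M \<subseteq> pre L \<Longrightarrow> pre L = pre M"
    using G.max_cond_image[OF noeth[unfolded G.noetherian_iff_max_cond] ne, of pre] by auto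
  have "L = M" if "L \<in> C" "M \<subseteq> L" for L
  proof -
    have "pre M \<subseteq> pre L" using that by (auto simp: pre_def)
    then have "h ` pre L = h ` pre M" using M(2)[OF that(1)] by simp
    then show ?thesis by (simp only: im[OF that(1)] im[OF M(1)])
  qed
  then show "\<exists>M\<in>C. \<forall>L\<in>C. M \<subseteq> L \<longrightarrow> L = M" using M(1) by blast
qed

section \<open>Generators of the group of polynomial functions\<close>

lemma presented_monoid_generate:
  assumes "group (presented_monoid A R)"
  shows "carrier (presented_monoid A R) =
    generate (presented_monoid A R) ((\<lambda>a. word_class A R [a]) ` A)"
proof
  let ?M = "presented_monoid A R" and ?S = "(\<lambda>a. word_class A R [a]) ` A"
  interpret M: group ?M by (rule assms)
  show "generate ?M ?S \<subseteq> carrier ?M"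
    by (intro M.generate_incl) auto
  have "word_class A R w \<in> generate ?M ?S" if "set w \<subseteq> A" for w
    using that
  proof (induction w)
    case Nil
    then show ?case using generate.one[of ?M ?S] by (simp add: one_presented_monoid)
  next
    case (Cons a w)
    then have "word_class A R [a] \<in> generate ?M ?S" by (intro generate.incl) auto
    then have "word_class A R [a] \<otimes>\<^bsub>?M\<^esub> word_class A R w \<in> generate ?M ?S"
      using Cons by (intro generate.eng) auto
    then show ?case using Cons.prems by (simp add: mult_presented_monoid)
  qed
  then show "carrier ?M \<subseteq> generate ?M ?S" by auto
qed

lemma free_group_generate: "generate (free_group X) (free_gen X ` X) = carrier (free_group X)"
proof
  interpret F: group "free_group X" by (rule group_free_group)
  let ?S = "free_gen X ` X"
  let ?A = "X \<times> (UNIV :: bool set)" and ?R = "free_group_rels X"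
  have S: "?S \<subseteq> carrier (free_group X)" using free_gen_closed by auto
  show "generate (free_group X) ?S \<subseteq> carrier (free_group X)" by (rule F.generate_incl[OF S])
  have "word_class ?A ?R [(x, b)] \<in> generate (free_group X) ?S" if x: "x \<in> X" for x b
  proof (cases b)
    case True
    then show ?thesis using x by (auto simp: free_gen_def intro!: generate.incl)
  next
    case False
    have "word_cong ?A ?R [(x, False), (x, True)] []"
      using x word_cong.rel[of "[(x, False), (x, True)]" "[]" ?R ?A "[]" "[]"]
      by (auto simp: free_group_rels_def)
    then have "word_class ?A ?R [(x, False)] \<otimes>\<^bsub>free_group X\<^esub> free_gen X x = \<one>\<^bsub>free_group X\<^esub>"
      using x word_class_eq
      by (fastforce simp: free_gen_def free_group_def mult_presented_monoid one_presented_monoid)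
    then have "inv\<^bsub>free_group X\<^esub> (free_gen X x) = word_class ?A ?R [(x, False)]"
      using x free_gen_closed[OF x] by (intro F.inv_equality) (auto simp: free_group_def)
    moreover have "inv\<^bsub>free_group X\<^esub> (free_gen X x) \<in> generate (free_group X) ?S"
      using x by (intro generate.inv) auto
    ultimately show ?thesis using False by simp
  qed
  then have "(\<lambda>a. word_class ?A ?R [a]) ` ?A \<subseteq> generate (free_group X) ?S" by auto
  then have "generate (free_group X) ((\<lambda>a. word_class ?A ?R [a]) ` ?A) \<subseteq> generate (free_group X) ?S"
    by (rule F.generate_subgroup_incl[OF _ F.generate_is_subgroup[OF S]])
  then show "carrier (free_group X) \<subseteq> generate (free_group X) ?S"
    using presented_monoid_generate[of ?A ?R] group_free_group[of X] by (simp add: free_group_def)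
qed

lemma free_product_generate:
  assumes G: "group G" and H: "group H"
  shows "carrier (free_product G H) = generate (free_product G H)
    (free_product_inl G H ` carrier G \<union> free_product_inr G H ` carrier H)"
proof -
  have "(\<lambda>a. word_class (carrier G <+> carrier H) (free_product_rels G H) [a]) ` (carrier G <+> carrier H) =
      free_product_inl G H ` carrier G \<union> free_product_inr G H ` carrier H"
    by (auto simp: free_product_inl_def free_product_inr_def)
  then show ?thesis
    using presented_monoid_generate[of "carrier G <+> carrier H" "free_product_rels G H"]
      group_free_product[OF G H] by (simp add: free_product_def)
qed

definition poly_const :: "('a, 'b) monoid_scheme \<Rightarrow> nat \<Rightarrow> 'a \<Rightarrow> (nat \<Rightarrow> 'a) \<Rightarrow> 'a" where
  "poly_const G n g = poly_fun G n (free_product_inl G (free_group {1..n}) g)"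

definition poly_var :: "('a, 'b) monoid_scheme \<Rightarrow> nat \<Rightarrow> nat \<Rightarrow> (nat \<Rightarrow> 'a) \<Rightarrow> 'a" where
  "poly_var G n i =
     poly_fun G n (free_product_inr G (free_group {1..n}) (free_gen {1..n} i))"

context group begin

context fixes n :: nat begin

abbreviation "PF \<equiv> poly_fun_group G n"
abbreviation "PR \<equiv> product_group (tuples G n) (\<lambda>_. G)"

interpretation PF: group PF by (rule group_poly_fun_group[OF is_group])
interpretation PG: group "poly_group G n" by (rule group_poly_group[OF is_group])
interpretation PR: group PR by simp
interpretation ph: group_hom "poly_group G n" PR "poly_fun G n"
  using poly_fun_hom[OF is_group] by (simp add: group_hom_def group_hom_axioms_def)

lemma poly_const_apply:
  assumes "g \<in> carrier G" "t \<in> tuples G n" shows "poly_const G n g t = g"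
  using assms poly_subst_const[OF is_group assms(2,1)] by (simp add: poly_const_def poly_fun_def del: PiE_iff)

lemma poly_var_apply:
  assumes "i \<in> {1..n}" "t \<in> tuples G n" shows "poly_var G n i t = t i"
  using assms poly_subst_var[OF is_group assms(2,1)] by (simp add: poly_var_def poly_fun_def del: PiE_iff)

lemma carrier_PF: "carrier PF = poly_fun G n ` carrier (poly_group G n)"
  by (simp add: poly_fun_group_def)

lemma PF_subgroup: "subgroup (carrier PF) PR"
  unfolding carrier_PF by (rule ph.img_is_subgroup)

lemma PF_restrict: "PR\<lparr>carrier := carrier PF\<rparr> = PF"
  by (simp add: poly_fun_group_def)

lemma poly_const_hom: "poly_const G n \<in> hom G PF"
proof -
  have inl: "free_product_inl G (free_group {1..n}) \<in> hom G (poly_group G n)"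
    unfolding poly_group_def by (rule free_product_inl_hom[OF is_group group_free_group])
  show ?thesis
  proof (rule homI)
    fix x assume "x \<in> carrier G"
    then show "poly_const G n x \<in> carrier PF"
      unfolding carrier_PF poly_const_def using hom_in_carrier[OF inl] by blast
  next
    fix x y assume "x \<in> carrier G" "y \<in> carrier G"
    then have "poly_const G n (x \<otimes> y) = poly_const G n x \<otimes>\<^bsub>PR\<^esub> poly_const G n y"
      unfolding poly_const_def using hom_in_carrier[OF inl] hom_mult[OF inl]
      by (simp del: mult_product_group)
    then show "poly_const G n (x \<otimes> y) = poly_const G n x \<otimes>\<^bsub>PF\<^esub> poly_const G n y"
      by (simp add: poly_fun_group_def)
  qed
qed

lemma poly_var_closed:
  assumes "i \<in> {1..n}" shows "poly_var G n i \<in> carrier PF"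
  unfolding carrier_PF poly_var_def poly_group_def
  by (rule imageI, rule hom_in_carrier[OF free_product_inr_hom[OF is_group group_free_group]],
      rule free_gen_closed[OF assms])

lemma generators_closed:
  "S \<subseteq> carrier G \<Longrightarrow> poly_const G n ` S \<union> poly_var G n ` {1..n} \<subseteq> carrier PF"
  by (intro Un_least image_subsetI poly_var_closed) (auto intro: hom_in_carrier[OF poly_const_hom])

lemma eval_hom:
  assumes "t \<in> tuples G n" shows "group_hom PF G (\<lambda>f. f t)"
proof -
  have "f t \<in> carrier G" if "f \<in> carrier PF" for f
    using subgroup.mem_carrier[OF PF_subgroup that] assms by auto
  then have "(\<lambda>f. f t) \<in> hom PF G"
    using assms by (intro homI) (auto simp: poly_fun_group_def simp del: PiE_iff)
  then show ?thesis using PF.is_group is_group by (simp add: group_hom_def group_hom_axioms_def)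
qed

lemma poly_fun_ext:
  assumes "f \<in> carrier PF" "g \<in> carrier PF" "\<And>t. t \<in> tuples G n \<Longrightarrow> f t = g t"
  shows "f = g"
proof -
  have "f \<in> carrier PR" "g \<in> carrier PR"
    using assms subgroup.mem_carrier[OF PF_subgroup] by blast+
  then show ?thesis using assms(3) unfolding carrier_product_group by (rule PiE_ext)
qed

theorem poly_fun_group_generate:
  "generate PF (poly_const G n ` carrier G \<union> poly_var G n ` {1..n}) = carrier PF"
proof -
  let ?F = "free_group {1..n}"
  let ?l = "free_product_inl G ?F" and ?r = "free_product_inr G ?F"
  let ?S = "?l ` carrier G \<union> ?r ` free_gen {1..n} ` {1..n}"
  have l: "?l \<in> hom G (poly_group G n)" and r: "?r \<in> hom ?F (poly_group G n)"
    unfolding poly_group_def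
    by (rule free_product_inl_hom[OF is_group group_free_group] free_product_inr_hom[OF is_group group_free_group])+
  interpret r: group_hom ?F "poly_group G n" ?r
    using r group_free_group by (simp add: group_hom_def group_hom_axioms_def PG.is_group)
  have fg: "free_gen {1..n} ` {1..n} \<subseteq> carrier ?F"
    by (rule image_subsetI) (rule free_gen_closed)
  have S: "?S \<subseteq> carrier (poly_group G n)"
    by (intro Un_least image_subsetI, rule hom_in_carrier[OF l], assumption)
      (elim imageE, simp only:, intro hom_in_carrier[OF r] free_gen_closed)
  have "?r ` carrier ?F = generate (poly_group G n) (?r ` free_gen {1..n} ` {1..n})"
    using r.generate_img[OF fg] by (simp only: free_group_generate)
  also have "\<dots> \<subseteq> generate (poly_group G n) ?S"
    by (rule PG.mono_generate) simp
  finally have "?l ` carrier G \<union> ?r ` carrier ?F \<subseteq> generate (poly_group G n) ?S"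
    by (auto intro: generate.incl)
  then have "carrier (poly_group G n) \<subseteq> generate (poly_group G n) ?S"
    using PG.generate_subgroup_incl[OF _ PG.generate_is_subgroup[OF S]]
      free_product_generate[OF is_group group_free_group, of "{1..n}"] by (simp add: poly_group_def)
  then have "carrier (poly_group G n) = generate (poly_group G n) ?S"
    using PG.generate_incl[OF S] by blast
  then have "carrier PF = generate PR (poly_fun G n ` ?S)"
    unfolding carrier_PF using ph.generate_img[OF S] by simp
  moreover have "poly_fun G n ` ?S = poly_const G n ` carrier G \<union> poly_var G n ` {1..n}"
    by (simp add: image_Un image_image poly_const_def poly_var_def)
  moreover have "poly_const G n ` carrier G \<union> poly_var G n ` {1..n} \<subseteq> carrier PF"
    by (rule generators_closed) simp
  ultimately show ?thesis
    using PR.generate_consistent[OF _ PF_subgroup] unfolding PF_restrict by metis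
qed

section \<open>Properties inherited by the group of polynomial functions\<close>

lemma poly_fun_group_finitely_generated:
  assumes "finitely_generated_group G"
  shows "finitely_generated_group PF"
proof -
  obtain S where S: "finite S" "S \<subseteq> carrier G" "generate G S = carrier G"
    using assms by (auto simp: finitely_generated_group_def)
  interpret c: group_hom G PF "poly_const G n"
    using poly_const_hom by (simp add: group_hom_def group_hom_axioms_def PF.is_group)
  let ?T = "poly_const G n ` S \<union> poly_var G n ` {1..n}"
  have T: "?T \<subseteq> carrier PF"
    by (rule generators_closed[OF S(2)])
  have "poly_const G n ` carrier G \<subseteq> generate PF ?T"
    using c.generate_img[OF S(2)] PF.mono_generate[of "poly_const G n ` S" ?T] S(3) by simp
  then have "poly_const G n ` carrier G \<union> poly_var G n ` {1..n} \<subseteq> generate PF ?T"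
    by (auto intro: generate.incl)
  then have "carrier PF \<subseteq> generate PF ?T"
    using PF.generate_subgroup_incl[OF _ PF.generate_is_subgroup[OF T]] poly_fun_group_generate by blast
  then have "generate PF ?T = carrier PF" using PF.generate_incl[OF T] by blast
  moreover have "finite ?T" using S by simp
  ultimately show ?thesis using T unfolding finitely_generated_group_def by blast
qed

text \<open>Evaluation at a point maps the derived series of the polynomial functions into that of \<open>G\<close>.\<close>
lemma poly_fun_group_solvable:
  assumes "solvable G"
  shows "solvable PF"
proof -
  obtain k where k: "(derived G ^^ k) (carrier G) = {\<one>}"
    using assms solvable_iff_trivial_derived_seq by blast
  have sub: "subgroup ((derived PF ^^ k) (carrier PF)) PF"
    by (rule PF.exp_of_derived_is_subgroup[OF PF.subgroup_self])
  have "f = \<one>\<^bsub>PF\<^esub>" if f: "f \<in> (derived PF ^^ k) (carrier PF)" for f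
  proof (rule poly_fun_ext)
    show "f \<in> carrier PF" using f subgroup.mem_carrier[OF sub] by blast
    fix t assume t: "t \<in> tuples G n"
    interpret e: group_hom PF G "\<lambda>f. f t" by (rule eval_hom[OF t])
    have im: "(\<lambda>f. f t) ` carrier PF \<subseteq> carrier G" by auto
    have "f t \<in> (\<lambda>f. f t) ` (derived PF ^^ k) (carrier PF)" using f by blast
    also have "\<dots> = (derived G ^^ k) ((\<lambda>f. f t) ` carrier PF)"
      using e.exp_of_derived_img[of "carrier PF" k] by simp
    also have "\<dots> \<subseteq> (derived G ^^ k) (carrier G)"
      by (rule mono_exp_of_derived[OF im])
    finally show "f t = \<one>\<^bsub>PF\<^esub> t" using k e.hom_one by simp
  qed simp
  then have "(derived PF ^^ k) (carrier PF) = {\<one>\<^bsub>PF\<^esub>}"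
    using subgroup.one_closed[OF sub] by blast
  then show ?thesis using PF.solvable_iff_trivial_derived_seq by blast
qed

text \<open>The functions with this property form a subgroup that contains the constants and the coordinate
  functions.\<close>
lemma poly_fun_congruence:
  assumes N: "N \<lhd> G" and t: "t \<in> tuples G n" "t' \<in> tuples G n"
    and cong: "\<And>i. i \<in> {1..n} \<Longrightarrow> N #> t i = N #> t' i"
    and f: "f \<in> carrier PF"
  shows "N #> f t = N #> f t'"
proof -
  interpret N: normal N G by (rule N)
  interpret e: group_hom PF G "\<lambda>f. f t" by (rule eval_hom[OF t(1)])
  interpret e': group_hom PF G "\<lambda>f. f t'" by (rule eval_hom[OF t(2)])
  let ?S = "poly_const G n ` carrier G \<union> poly_var G n ` {1..n}"
  have S: "?S \<subseteq> carrier PF"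
    by (rule generators_closed) simp
  have letter: "N #> f t = N #> f t'" if "f \<in> ?S" for f
    using that cong t by (auto simp: poly_const_apply poly_var_apply simp del: PiE_iff)
  have "f \<in> generate PF ?S" using f poly_fun_group_generate by simp
  then show ?thesis
  proof induction
    case one
    show ?case using e.hom_one e'.hom_one by simp
  next
    case (incl f)
    then show ?case by (rule letter)
  next
    case (inv f)
    then have "f \<in> carrier PF" using S by blast
    then show ?case
      using letter[OF inv] N.rcos_inv[of "f t"] N.rcos_inv[of "f t'"] by simp
  next
    case (eng f g)
    then have fg: "f \<in> carrier PF" "g \<in> carrier PF" using PF.generate_in_carrier[OF S] by blast+
    then have "N #> (f \<otimes>\<^bsub>PF\<^esub> g) t = (N #> f t) <#> (N #> g t)" by (simp add: N.rcos_sum)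
    also have "\<dots> = N #> (f \<otimes>\<^bsub>PF\<^esub> g) t'" using fg eng by (simp add: N.rcos_sum)
    finally show ?case .
  qed
qed

text \<open>\<open>K\<close> consists of the functions with all values in \<open>N\<close>. Its lower central series is bounded pointwise by
  that of \<open>N\<close>. For the index, let \<open>R\<close> be a finite set of representatives of the cosets of \<open>N\<close>: by
  \<open>poly_fun_congruence\<close> the coset of \<open>f\<close> modulo \<open>K\<close> is determined by the values of \<open>f\<close> modulo \<open>N\<close>
  on the finite set \<open>R\<^sup>n\<close>.\<close>
lemma poly_fun_group_nilpotent_by_finite:
  assumes "nilpotent_by_finite G"
  shows "nilpotent_by_finite PF"
proof -
  obtain N where N: "N \<lhd> G" "nilpotent_group (G\<lparr>carrier := N\<rparr>)" "finite (rcosets N)"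
    using assms by (auto simp: nilpotent_by_finite_def)
  interpret N: normal N G by (rule N(1))
  have sN: "subgroup N G" by (rule N.is_subgroup)
  define K where "K = {f \<in> carrier PF. \<forall>t\<in>tuples G n. f t \<in> N}"
  have e: "group_hom PF G (\<lambda>f. f t)" if "t \<in> tuples G n" for t by (rule eval_hom[OF that])
  have emult: "(f \<otimes>\<^bsub>PF\<^esub> g) t = f t \<otimes> g t" and einv: "(inv\<^bsub>PF\<^esub> f) t = inv (f t)" and ecl: "f t \<in> carrier G"
    if "t \<in> tuples G n" "f \<in> carrier PF" "g \<in> carrier PF" for f g t
    using group_hom.hom_mult[OF e[OF that(1)] that(2,3)] group_hom.hom_inv[OF e[OF that(1)] that(2)]
      group_hom.hom_closed[OF e[OF that(1)] that(2)] by auto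
  have K: "subgroup K PF"
  proof (rule PF.subgroupI)
    show "K \<subseteq> carrier PF" by (auto simp: K_def)
    have "\<one>\<^bsub>PF\<^esub> \<in> K"
      unfolding K_def using group_hom.hom_one[OF e] N.one_closed by auto
    then show "K \<noteq> {}" by blast
  qed (auto simp: K_def emult einv simp del: PiE_iff)
  have "K \<lhd> PF"
    unfolding PF.normal_inv_iff
  proof (intro conjI ballI K)
    fix f h assume f: "f \<in> carrier PF" and h: "h \<in> K"
    then have hc: "h \<in> carrier PF" by (simp add: K_def)
    show "f \<otimes>\<^bsub>PF\<^esub> h \<otimes>\<^bsub>PF\<^esub> inv\<^bsub>PF\<^esub> f \<in> K"
      unfolding K_def
    proof (intro CollectI conjI ballI)
      show "f \<otimes>\<^bsub>PF\<^esub> h \<otimes>\<^bsub>PF\<^esub> inv\<^bsub>PF\<^esub> f \<in> carrier PF" using f hc by simp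
      fix t assume t: "t \<in> tuples G n"
      have "f t \<in> carrier G" "h t \<in> N" using ecl[OF t f f] h t by (auto simp: K_def)
      then show "(f \<otimes>\<^bsub>PF\<^esub> h \<otimes>\<^bsub>PF\<^esub> inv\<^bsub>PF\<^esub> f) t \<in> N"
        using f hc t by (simp add: emult[OF t] einv[OF t] N.inv_op_closed2 del: PiE_iff)
    qed
  qed
  moreover have "nilpotent_group (PF\<lparr>carrier := K\<rparr>)"
  proof -
    let ?K = "lower_central (PF\<lparr>carrier := K\<rparr>)" and ?N = "lower_central (G\<lparr>carrier := N\<rparr>)"
    have pt: "f t \<in> ?N i" if "f \<in> ?K i" "t \<in> tuples G n" for f t i
      using that
    proof (induction i arbitrary: f)
      case 0
      then show ?case by (simp add: K_def)
    next
      case (Suc i)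
      interpret e: group_hom PF G "\<lambda>f. f t" by (rule e[OF Suc.prems(2)])
      have sub: "?K i \<subseteq> K" "?N i \<subseteq> N"
        using PF.lower_central_subgroup[OF K] lower_central_subgroup[OF sN] by blast+
      let ?S = "{PF.commutator x y | x y. x \<in> ?K i \<and> y \<in> K}"
      have KP: "K \<subseteq> carrier PF" by (rule subgroup.subset[OF K])
      have S: "?S \<subseteq> carrier PF" using sub(1) KP by auto
      have "f t \<in> (\<lambda>f. f t) ` generate PF ?S"
        using Suc.prems(1) PF.lower_central_Suc_subgroup[OF K sub(1)] by blast
      then have "f t \<in> generate G ((\<lambda>f. f t) ` ?S)" using e.generate_img[OF S] by simp
      moreover have "(\<lambda>f. f t) ` ?S \<subseteq> {commutator x y | x y. x \<in> ?N i \<and> y \<in> N}"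
      proof (intro subsetI, elim imageE CollectE exE conjE, hypsubst)
        fix x y assume xy: "x \<in> ?K i" "y \<in> K"
        then have "x \<in> carrier PF" "y \<in> carrier PF" using sub(1) KP by blast+
        then have "PF.commutator x y t = commutator (x t) (y t)"
          by (simp add: PF.commutator_def commutator_def)
        moreover have "x t \<in> ?N i" "y t \<in> N" using Suc xy by (auto simp: K_def)
        ultimately show "PF.commutator x y t \<in> {commutator x y | x y. x \<in> ?N i \<and> y \<in> N}" by blast
      qed
      ultimately show ?case
        unfolding lower_central_Suc_subgroup[OF sN sub(2)]
        using mono_generate by blast
    qed
    obtain c where c: "?N c = {\<one>}" using N(2) by (auto simp: nilpotent_group_def)
    have Kc: "subgroup (?K c) PF" using PF.lower_central_subgroup[OF K] by blast
    have "f = \<one>\<^bsub>PF\<^esub>" if f: "f \<in> ?K c" for f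
    proof (rule poly_fun_ext)
      show "f \<in> carrier PF" using f subgroup.mem_carrier[OF Kc] by blast
      fix t assume t: "t \<in> tuples G n"
      then show "f t = \<one>\<^bsub>PF\<^esub> t" using pt[OF f t] c group_hom.hom_one[OF e[OF t]] by simp
    qed simp
    then have "?K c = {\<one>\<^bsub>PF\<^esub>}" using subgroup.one_closed[OF Kc] by blast
    then show ?thesis by (auto simp: nilpotent_group_def)
  qed
  moreover have "finite (rcosets\<^bsub>PF\<^esub> K)"
  proof -
    have "finite ((\<lambda>h. N #> h) ` carrier G)"
      using N(3) finite_index_in_carrier finite_index_in_def by auto
    then obtain R where R: "R \<subseteq> carrier G" "finite R" "(\<lambda>h. N #> h) ` carrier G = (\<lambda>h. N #> h) ` R"
      using finite_subset_image[OF _ subset_refl] by metis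
    let ?R = "\<Pi>\<^sub>E i\<in>{1..n}. R"
    have Rt: "?R \<subseteq> tuples G n" using R(1) by (intro PiE_mono) auto
    define \<Phi> where "\<Phi> f = (\<lambda>t\<in>?R. N #> f t)" for f :: "(nat \<Rightarrow> 'a) \<Rightarrow> 'a"
    have "\<Phi> ` carrier PF \<subseteq> (\<Pi>\<^sub>E t\<in>?R. rcosets N)"
    proof (rule image_subsetI)
      fix f assume f: "f \<in> carrier PF"
      show "\<Phi> f \<in> (\<Pi>\<^sub>E t\<in>?R. rcosets N)"
        unfolding \<Phi>_def
      proof (rule restrict_PiE_iff[THEN iffD2], rule ballI)
        fix t assume "t \<in> ?R"
        then have "f t \<in> carrier G" using ecl[OF _ f f] Rt by blast
        then show "N #> f t \<in> rcosets N" by (rule rcosetsI[OF N.subset])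
      qed
    qed
    moreover have "finite (\<Pi>\<^sub>E t\<in>?R. rcosets N)"
      using N(3) R(2) by (intro finite_PiE) auto
    ultimately have fin: "finite (\<Phi> ` carrier PF)" by (rule finite_subset)
    have same: "K #>\<^bsub>PF\<^esub> f = K #>\<^bsub>PF\<^esub> g"
      if f: "f \<in> carrier PF" and g: "g \<in> carrier PF" and fg: "\<Phi> f = \<Phi> g" for f g
    proof -
      have "f t \<otimes> inv (g t) \<in> N" if t: "t \<in> tuples G n" for t
      proof -
        have "\<forall>i\<in>{1..n}. \<exists>r\<in>R. N #> t i = N #> r"
        proof
          fix i assume "i \<in> {1..n}"
          then have "N #> t i \<in> (\<lambda>h. N #> h) ` carrier G" using t by auto
          then show "\<exists>r\<in>R. N #> t i = N #> r" unfolding R(3) by blast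
        qed
        then obtain r where r: "\<And>i. i \<in> {1..n} \<Longrightarrow> r i \<in> R \<and> N #> t i = N #> r i" by metis
        let ?r = "\<lambda>i\<in>{1..n}. r i"
        have rR: "?r \<in> ?R" using r by auto
        then have rt: "?r \<in> tuples G n" using Rt by blast
        have cong: "N #> t i = N #> ?r i" if "i \<in> {1..n}" for i using r that by simp
        have "N #> f t = N #> f ?r" by (rule poly_fun_congruence[OF N(1) t rt cong f])
        also have "\<dots> = N #> g ?r" using fun_cong[OF fg, of ?r] rR by (simp add: \<Phi>_def del: PiE_iff)
        also have "\<dots> = N #> g t" by (rule poly_fun_congruence[OF N(1) t rt cong g, symmetric])
        finally show ?thesis
          using r_coset_eq_iff[OF sN ecl[OF t f f] ecl[OF t g g]] by simp
      qed
      then have "f \<otimes>\<^bsub>PF\<^esub> inv\<^bsub>PF\<^esub> g \<in> K"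
        using f g by (simp add: K_def emult einv del: PiE_iff)
      then show ?thesis using PF.r_coset_eq_iff[OF K f g] by simp
    qed
    have "(\<lambda>f. K #>\<^bsub>PF\<^esub> f) ` carrier PF \<subseteq>
        (\<lambda>y. K #>\<^bsub>PF\<^esub> (inv_into (carrier PF) \<Phi> y)) ` \<Phi> ` carrier PF"
    proof
      fix C assume "C \<in> (\<lambda>f. K #>\<^bsub>PF\<^esub> f) ` carrier PF"
      then obtain f where f: "f \<in> carrier PF" "C = K #>\<^bsub>PF\<^esub> f" by blast
      then have "C = K #>\<^bsub>PF\<^esub> (inv_into (carrier PF) \<Phi> (\<Phi> f))"
        using same[OF f(1) inv_into_into[of "\<Phi> f" \<Phi> "carrier PF"]] f_inv_into_f[of "\<Phi> f" \<Phi> "carrier PF"]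
        by simp
      then show "C \<in> (\<lambda>y. K #>\<^bsub>PF\<^esub> (inv_into (carrier PF) \<Phi> y)) ` \<Phi> ` carrier PF" using f by blast
    qed
    then have "finite ((\<lambda>f. K #>\<^bsub>PF\<^esub> f) ` carrier PF)" using fin finite_subset by blast
    then show ?thesis using PF.finite_index_in_carrier PF.finite_index_in_def by auto
  qed
  ultimately show ?thesis unfolding nilpotent_by_finite_def by blast
qed

section \<open>Equivalence of the three conditions\<close>

text \<open>Restricting to the diagonal of \<open>G\<^sup>n\<close> turns the first coordinate function into the identity of \<open>G\<close>, which is
  why at least one variable is needed.\<close>
lemma polycyclic_poly_fun_group_imp:
  assumes n: "n > 0" and pc: "polycyclic_group PF"
  shows "finitely_generated_group G \<and> solvable G \<and> nilpotent_by_finite G"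
proof -
  have solv: "solvable PF" and noeth: "noetherian_group PF" using pc by (auto simp: polycyclic_group_def)
  define diag where "diag s = (\<lambda>i\<in>{1..n}. s)" for s :: 'a
  have diag: "diag s \<in> tuples G n" if "s \<in> carrier G" for s using that by (auto simp: diag_def)
  interpret e: group_hom PF G "\<lambda>f. f (diag \<one>)" by (rule eval_hom[OF diag[OF one_closed]])
  have surj: "(\<lambda>f. f (diag \<one>)) ` carrier PF = carrier G"
  proof
    show "(\<lambda>f. f (diag \<one>)) ` carrier PF \<subseteq> carrier G" by auto
    show "carrier G \<subseteq> (\<lambda>f. f (diag \<one>)) ` carrier PF"
    proof
      fix g assume g: "g \<in> carrier G"
      then have "g = poly_const G n g (diag \<one>)" using diag poly_const_apply by simp
      then show "g \<in> (\<lambda>f. f (diag \<one>)) ` carrier PF"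
        using hom_in_carrier[OF poly_const_hom g] by (rule image_eqI)
    qed
  qed
  have noethG: "noetherian_group G" by (rule e.noetherian_image[OF surj noeth])
  have solvG: "solvable G" by (rule e.surj_hom_imp_solvable[OF surj solv])
  have "finitely_generated_group G"
    using noetherian_imp_finitely_generated[OF noethG subgroup_self] unfolding finitely_generated_group_def by metis
  moreover have "conj_recurrent a" if a: "a \<in> carrier G" for a
  proof (rule conj_recurrent_of_noetherian[OF PF.is_group noeth])
    show "(\<lambda>f. f (diag s)) \<in> hom PF G" if "s \<in> carrier G" for s
      using eval_hom[OF diag[OF that]] by (simp add: group_hom_def group_hom_axioms_def)
    show "poly_var G n 1 \<in> carrier PF" using n by (intro poly_var_closed) simp
    show "poly_var G n 1 (diag s) = s" if "s \<in> carrier G" for s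
      using n poly_var_apply[of 1, OF _ diag[OF that]] by (simp add: diag_def)
    show "poly_const G n a \<in> carrier PF" by (rule hom_in_carrier[OF poly_const_hom a])
    show "poly_const G n a (diag s) = a" if "s \<in> carrier G" for s
      by (rule poly_const_apply[OF a diag[OF that]])
  qed
  then have "nilpotent_by_finite G" by (rule nilpotent_by_finite_of_recurrent[OF noethG _ solvG])
  ultimately show ?thesis using solvG by blast
qed

end

end

theorem theorem1p1:
  fixes G :: "('a, 'b) monoid_scheme" and n :: nat
  assumes "group G" and "n > 0"
  shows "(polycyclic_group (poly_fun_group G n) \<longleftrightarrow>
            finitely_generated_group G \<and> solvable G \<and> nilpotent_by_finite G) \<and>
         (finitely_generated_group G \<and> solvable G \<and> nilpotent_by_finite G \<longleftrightarrow>
            finitely_generated_group (poly_fun_group G n) \<and>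
            solvable (poly_fun_group G n) \<and>
            nilpotent_by_finite (poly_fun_group G n))"
proof -
  interpret G: group G by (rule assms(1))
  interpret P: group "poly_fun_group G n" by (rule group_poly_fun_group[OF assms(1)])
  let ?ii = "finitely_generated_group G \<and> solvable G \<and> nilpotent_by_finite G"
  let ?iii = "finitely_generated_group (poly_fun_group G n) \<and> solvable (poly_fun_group G n) \<and>
    nilpotent_by_finite (poly_fun_group G n)"
  have "polycyclic_group (poly_fun_group G n) \<Longrightarrow> ?ii"
    by (rule G.polycyclic_poly_fun_group_imp[OF assms(2)])
  moreover have "?ii \<Longrightarrow> ?iii"
    using G.poly_fun_group_finitely_generated G.poly_fun_group_solvable
      G.poly_fun_group_nilpotent_by_finite by blast
  moreover have "?iii \<Longrightarrow> polycyclic_group (poly_fun_group G n)"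
    using P.noetherian_of_nilpotent_by_finite by (simp add: polycyclic_group_def)
  ultimately show ?thesis by blast
qed

end
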